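(* Let $u_0\in C(\overline D)$ be of the form $u_0(x)=s_0(|x|)x^\perp$. For $\nu>0$ let $u^\nu$ be the solution of the Navier–Stokes problem $$\partial_tu^\nu+\nabla_{u^\nu}u^\nu+\nabla p^\nu=\nu\Delta u^\nu,\quad\operatorname{div}u^\nu=0\ \text{ on } D,\qquad u^\nu(t,x)=0\ (|x|=1,\ t>0),\qquad u^\nu(0)=u_0.$$ Let $T_0\in(0,\infty)$, and let $\delta(\nu)>0$ satisfy $$\frac{\delta(\nu)}{\nu^{1/2}}\longrightarrow\infty\quad\text{as }\nu\searrow0.$$ Then, uniformly in $t\in[0,T_0]$, $u^\nu(t,x)\to u_0(x)$ as $\nu\searrow0$ uniformly on $\{(x,\nu):|x|\le1-\delta(\nu)\}$; that is, $$\lim_{\nu\searrow0}\ \sup_{0\le t\le T_0}\ \sup_{|x|\le1-\delta(\nu)}|u^\nu(t,x)-u_0(x)|=0.$$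
   Context: $D=\{x\in\mathbb R^2:|x|<1\}$, $x^\perp=(-x_2,x_1)$, $\nabla_uv=(u\cdot\nabla)v$. For such circularly symmetric initial data (no compatibility with the boundary condition is required) the Navier–Stokes solution is of the form $u^\nu(t,x)=s^\nu(t,|x|)x^\perp$ and coincides with the solution of the linear heat equation $\partial_tu^\nu=\nu\Delta u^\nu$ with the same initial and boundary data, i.e. $u^\nu(t)=e^{\nu tA}u_0$, where $A$ is the Dirichlet Laplacian ($\mathcal D(A)=H^2(D)\cap H^1_0(D)$, $Au=\Delta u$ on $L^2(D)$) and $e^{tA}$ its semigroup. A supremum over an empty set is taken to be $0$. *)

theory Defs
  imports "HOL-Analysis.Analysis"
begin

definition perp :: "real^2 \<Rightarrow> real^2" where
  "perp x = vector [- (x $ 2), x $ 1]"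

abbreviation disk :: "(real^2) set" where "disk \<equiv> ball 0 1"
abbreviation closed_disk :: "(real^2) set" where "closed_disk \<equiv> cball 0 1"

definition partial_deriv :: "2 \<Rightarrow> (real^2 \<Rightarrow> 'a::real_normed_vector) \<Rightarrow> real^2 \<Rightarrow> 'a" where
  "partial_deriv i f x = frechet_derivative f (at x) (axis i 1)"

definition gradient :: "(real^2 \<Rightarrow> real) \<Rightarrow> real^2 \<Rightarrow> real^2" where
  "gradient q x = (\<chi> i. partial_deriv i q x)"

definition divergence :: "(real^2 \<Rightarrow> real^2) \<Rightarrow> real^2 \<Rightarrow> real" where
  "divergence v x = (\<Sum>i\<in>UNIV. partial_deriv i v x $ i)"

definition laplacian :: "(real^2 \<Rightarrow> 'a::real_normed_vector) \<Rightarrow> real^2 \<Rightarrow> 'a" where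
  "laplacian f x = (\<Sum>i\<in>UNIV. partial_deriv i (partial_deriv i f) x)"

definition advection :: "(real^2 \<Rightarrow> real^2) \<Rightarrow> (real^2 \<Rightarrow> real^2) \<Rightarrow> real^2 \<Rightarrow> real^2" where
  "advection u v x = (\<Sum>i\<in>UNIV. u x $ i *\<^sub>R partial_deriv i v x)"

definition time_deriv :: "(real \<Rightarrow> real^2 \<Rightarrow> real^2) \<Rightarrow> real \<Rightarrow> real^2 \<Rightarrow> real^2" where
  "time_deriv u t x = vector_derivative (\<lambda>\<tau>. u \<tau> x) (at t)"

definition extends_continuously :: "(real \<Rightarrow> real^2 \<Rightarrow> 'a::topological_space) \<Rightarrow> bool" where
  "extends_continuously f \<longleftrightarrow>
     (\<exists>g. continuous_on ({0<..} \<times> closed_disk) g \<and> (\<forall>t>0. \<forall>x\<in>disk. g (t, x) = f t x))"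

text \<open>
  The usual class \<open>C\<^sup>1\<close> in time and \<open>C\<^sup>2\<close> in space on \<open>(0, \<infinity>) \<times> closed_disk\<close>: the derivatives
  exist in the open disk and extend continuously up to the boundary. Nothing is required as
  \<open>t\<close> tends to 0, since the initial velocity need not vanish on the boundary circle.
\<close>

definition regular_for_positive_time :: "(real \<Rightarrow> real^2 \<Rightarrow> real^2) \<Rightarrow> bool" where
  "regular_for_positive_time u \<longleftrightarrow>
     continuous_on ({0<..} \<times> closed_disk) (\<lambda>(t, x). u t x) \<and>
     (\<forall>t>0. \<forall>x\<in>disk.
        (\<lambda>\<tau>. u \<tau> x) differentiable (at t) \<and>
        u t differentiable (at x) \<and>
        (\<forall>i. partial_deriv i (u t) differentiable (at x))) \<and>
     extends_continuously (time_deriv u) \<and>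
     (\<forall>i. extends_continuously (\<lambda>t. partial_deriv i (u t))) \<and>
     (\<forall>i j. extends_continuously (\<lambda>t. partial_deriv i (partial_deriv j (u t))))"

text \<open>
  The pressure is determined only up to a function of time, so no regularity in time is imposed
  on it; continuity of its gradient follows from the equation. The initial velocity is the value
  at time 0 and is attained in the sense of strong continuity in \<open>L\<^sup>2\<close>; uniform
  continuity at time 0 up to the boundary would exclude initial data not vanishing there.
  The velocity is not assumed to be circularly symmetric.
\<close>

definition navier_stokes_solution ::
  "real \<Rightarrow> (real^2 \<Rightarrow> real^2) \<Rightarrow> (real \<Rightarrow> real^2 \<Rightarrow> real^2) \<Rightarrow> (real \<Rightarrow> real^2 \<Rightarrow> real) \<Rightarrow> bool" where
  "navier_stokes_solution \<nu> u\<^sub>0 u p \<longleftrightarrow>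
     regular_for_positive_time u \<and>
     (\<forall>t>0. \<forall>x\<in>disk.
        p t differentiable (at x) \<and>
        time_deriv u t x + advection (u t) (u t) x + gradient (p t) x = \<nu> *\<^sub>R laplacian (u t) x \<and>
        divergence (u t) x = 0) \<and>
     (\<forall>t>0. \<forall>x. norm x = 1 \<longrightarrow> u t x = 0) \<and>
     (\<forall>x\<in>closed_disk. u 0 x = u\<^sub>0 x) \<and>
     ((\<lambda>t. LINT x:disk|lborel. (norm (u t x - u\<^sub>0 x))\<^sup>2) \<longlongrightarrow> 0) (at_right 0)"

end

theory Submission
  imports Defs
begin

text \<open>
  The equations commute with rotations and the initial velocity is rotation equivariant, so every
  rotated copy of a solution is a solution with the same initial velocity. Planar solutions are
  unique (\<open>navier_stokes_unique\<close>); hence the velocity is itself equivariant at all times.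
  An equivariant divergence-free field has no radial component. The nonlinear term is then radial,
  the tangential derivative of the pressure is constant on every circle about the origin and
  therefore zero by periodicity, and what remains of the momentum equation is the heat equation
  (\<open>symmetric_solution_heat\<close>).

  Uniqueness has to cope with a velocity gradient that may blow up as time tends to 0. Let \<open>E\<close> be
  the energy of the difference of two solutions, and \<open>F\<close> the energy and \<open>G\<close> the squared \<open>L\<^sup>2\<close> norm
  of the gradient of one of them. The Ladyzhenskaya inequality gives \<open>E' \<le> G E / \<nu>\<close>, while
  \<open>F' = - 2 \<nu> G\<close>. So \<open>E exp (F / (2 \<nu>\<^sup>2))\<close> is nonincreasing; since \<open>F\<close> stays bounded and \<open>E\<close> tends to
  0 at time 0, it vanishes.

  For the convergence, fix a component of the velocity up to sign and a polynomial \<open>P\<close> within \<open>\<eta>\<close>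
  of its initial value. Up to an error of order \<open>\<nu>\<close>, \<open>P\<close> is a stationary solution of the heat equation,
  and its mismatch with the boundary condition is dominated by a multiple \<open>M\<close> of the supersolution
  \<open>exp (a (|x|\<^sup>2 - 1) / 2 + \<nu> (2 a + a\<^sup>2) t)\<close>. For \<open>a = 1 / sqrt \<nu>\<close> this is at most a bounded factor
  times \<open>exp (- \<delta> / (2 sqrt \<nu>))\<close> where \<open>|x| \<le> 1 - \<delta>\<close>, which tends to 0 exactly because
  \<open>\<delta> / sqrt \<nu>\<close> tends to infinity. Because the initial velocity is only attained in \<open>L\<^sup>2\<close>, the comparison
  principle is proved by an energy argument (\<open>heat_comparison\<close>) rather than pointwise.

  Both energy arguments rest on integration by parts in the disk, which is obtained from the
  fundamental theorem of calculus on the slices parallel to the axes and from Fubini's theorem.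
\<close>

section \<open>Partial derivatives\<close>

abbreviation PD where "PD \<equiv> partial_deriv"

lemma partial_deriv_unique:
  assumes "(f has_derivative D) (at x)"
  shows "PD i f x = D (axis i 1)"
  unfolding partial_deriv_def using frechet_derivative_at[OF assms] by simp

lemma has_derivative_partials:
  assumes "f differentiable (at x)"
  shows "(f has_derivative (\<lambda>v. \<Sum>i\<in>UNIV. v $ i *\<^sub>R PD i f x)) (at x)"
proof -
  let ?D = "frechet_derivative f (at x)"
  have D: "(f has_derivative ?D) (at x)"
    using assms frechet_derivative_works by blast
  then interpret bounded_linear ?D by (rule has_derivative_bounded_linear)
  have "?D v = (\<Sum>i\<in>UNIV. v $ i *\<^sub>R PD i f x)" for v
  proof -
    have "?D v = ?D (\<Sum>i\<in>UNIV. v $ i *\<^sub>R axis i 1)"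
      using basis_expansion[of v] by (simp add: scalar_mult_eq_scaleR)
    also have "\<dots> = (\<Sum>i\<in>UNIV. v $ i *\<^sub>R PD i f x)"
      by (simp add: sum scaleR partial_deriv_def)
    finally show ?thesis .
  qed
  then have "?D = (\<lambda>v. \<Sum>i\<in>UNIV. v $ i *\<^sub>R PD i f x)" by blast
  with D show ?thesis by simp
qed

lemma has_derivative_frechet:
  "f differentiable (at x) \<Longrightarrow> (f has_derivative frechet_derivative f (at x)) (at x)"
  using frechet_derivative_works by blast

lemma has_derivative_along_axis:
  fixes g :: "real^2 \<Rightarrow> real"
  assumes "g differentiable (at (x + t *\<^sub>R axis i 1))"
  shows "((\<lambda>t. g (x + t *\<^sub>R axis i 1)) has_real_derivative PD i g (x + t *\<^sub>R axis i 1)) (at t)"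
proof -
  let ?y = "x + t *\<^sub>R axis i (1::real)" and ?D = "frechet_derivative g"
  have 1: "((\<lambda>t. x + t *\<^sub>R axis i (1::real)) has_derivative (\<lambda>h. h *\<^sub>R axis i 1)) (at t)"
    by (auto intro!: derivative_eq_intros)
  have "(g has_derivative ?D (at ?y)) (at ?y)" using assms by (rule has_derivative_frechet)
  from has_derivative_compose[OF 1 this]
  have 2: "((\<lambda>t. g (x + t *\<^sub>R axis i 1)) has_derivative (\<lambda>h. ?D (at ?y) (h *\<^sub>R axis i 1))) (at t)" .
  have "?D (at ?y) (h *\<^sub>R axis i 1) = PD i g ?y * h" for h
    using linear_cmul[OF linear_frechet_derivative[OF assms]] by (simp add: partial_deriv_def)
  with 2 show ?thesis by (simp add: has_field_derivative_def)
qed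

lemma partial_deriv_cong:
  assumes "open S" "x \<in> S" "\<And>y. y \<in> S \<Longrightarrow> f y = g y"
  shows "PD i f x = PD i g x"
proof -
  have "(f has_derivative D) (at x) \<longleftrightarrow> (g has_derivative D) (at x)" for D
    using has_derivative_transform_within_open[OF _ assms(1,2), of f D UNIV g]
      has_derivative_transform_within_open[OF _ assms(1,2), of g D UNIV f] assms(3) by auto
  then show ?thesis unfolding partial_deriv_def frechet_derivative_def by simp
qed

lemma differentiable_cong_open:
  assumes "open S" "x \<in> S" "\<And>y. y \<in> S \<Longrightarrow> f y = g y" "f differentiable (at x)"
  shows "g differentiable (at x)"
  using assms has_derivative_transform_within_open[OF _ assms(1,2), of f _ UNIV g]
  unfolding differentiable_def by blast

lemma partial_deriv_const [simp]: "PD i (\<lambda>x. c) x = 0"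
  by (rule partial_deriv_unique) (auto intro!: derivative_eq_intros)

lemma partial_deriv_add:
  assumes "f differentiable (at x)" "g differentiable (at x)"
  shows "PD i (\<lambda>x. f x + g x) x = PD i f x + PD i g x"
  using partial_deriv_unique[OF has_derivative_add[OF assms[THEN has_derivative_frechet]]]
  by (simp add: partial_deriv_def)

lemma partial_deriv_diff:
  assumes "f differentiable (at x)" "g differentiable (at x)"
  shows "PD i (\<lambda>x. f x - g x) x = PD i f x - PD i g x"
  using partial_deriv_unique[OF has_derivative_diff[OF assms[THEN has_derivative_frechet]]]
  by (simp add: partial_deriv_def)

lemma partial_deriv_mult:
  fixes f g :: "real^2 \<Rightarrow> real"
  assumes "f differentiable (at x)" "g differentiable (at x)"
  shows "PD i (\<lambda>x. f x * g x) x = f x * PD i g x + PD i f x * g x"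
  using partial_deriv_unique[OF has_derivative_mult[OF assms[THEN has_derivative_frechet]]]
  by (simp add: partial_deriv_def)

lemma partial_deriv_linear:
  assumes "bounded_linear L" "f differentiable (at x)"
  shows "PD i (\<lambda>x. L (f x)) x = L (PD i f x)"
  using partial_deriv_unique[OF bounded_linear.has_derivative[OF assms(1) has_derivative_frechet[OF assms(2)]]]
  by (simp add: partial_deriv_def)

lemma partial_deriv_component:
  fixes f :: "real^2 \<Rightarrow> real^2"
  shows "f differentiable (at x) \<Longrightarrow> PD i (\<lambda>x. f x $ j) x = PD i f x $ j"
  by (rule partial_deriv_linear) (auto simp: bounded_linear_vec_nth)

lemma partial_deriv_compose_real:
  fixes f :: "real^2 \<Rightarrow> real"
  assumes "f differentiable (at x)" "(h has_real_derivative h') (at (f x))"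
  shows "PD i (\<lambda>x. h (f x)) x = h' * PD i f x"
    and "(\<lambda>x. h (f x)) differentiable (at x)"
proof -
  have *: "((\<lambda>x. h (f x)) has_derivative (\<lambda>v. frechet_derivative f (at x) v * h')) (at x)"
    using DERIV_compose_FDERIV[OF assms(2) has_derivative_frechet[OF assms(1)]] by simp
  from partial_deriv_unique[OF this] show "PD i (\<lambda>x. h (f x)) x = h' * PD i f x"
    by (simp add: partial_deriv_def)
  from * show "(\<lambda>x. h (f x)) differentiable (at x)" unfolding differentiable_def by blast
qed

lemma partial_deriv_coordinate [simp]:
  "PD i (\<lambda>x. x $ j) x = (if i = j then 1 else 0)"
  by (subst partial_deriv_unique[of _ "\<lambda>x. x $ j"])
    (auto intro!: derivative_eq_intros bounded_linear_imp_has_derivative bounded_linear_vec_nth simp: axis_def)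

section \<open>Functions that are smooth in the disk with bounded derivatives\<close>

text \<open>
  Only the open disk matters, since derivatives are not controlled on the circle. Boundedness makes
  such functions integrable over the disk.
\<close>

definition bounded_continuous :: "(real^2 \<Rightarrow> real) \<Rightarrow> bool" where
  "bounded_continuous f \<longleftrightarrow> continuous_on disk f \<and> bounded (f ` disk)"

definition C1_disk :: "(real^2 \<Rightarrow> real) \<Rightarrow> bool" where
  "C1_disk f \<longleftrightarrow> bounded_continuous f \<and> (\<forall>x\<in>disk. f differentiable (at x)) \<and>
     (\<forall>i. bounded_continuous (PD i f))"

definition C2_disk :: "(real^2 \<Rightarrow> real) \<Rightarrow> bool" where
  "C2_disk f \<longleftrightarrow> C1_disk f \<and> (\<forall>i. C1_disk (PD i f))"

definition vanishes_on_circle :: "(real^2 \<Rightarrow> real) \<Rightarrow> bool" where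
  "vanishes_on_circle f \<longleftrightarrow> continuous_on closed_disk f \<and> (\<forall>x. norm x = 1 \<longrightarrow> f x = 0)"

lemma bounded_continuousE:
  assumes "bounded_continuous f"
  obtains K where "K > 0" "\<And>x. x \<in> disk \<Longrightarrow> \<bar>f x\<bar> \<le> K"
  using assms unfolding bounded_continuous_def bounded_pos by auto

lemma bounded_continuousI:
  assumes "continuous_on disk f" "\<And>x. x \<in> disk \<Longrightarrow> \<bar>f x\<bar> \<le> K"
  shows "bounded_continuous f"
  unfolding bounded_continuous_def bounded_iff using assms(1) by (intro conjI exI[of _ K]) (auto intro: assms(2))

lemma bounded_continuous_cong:
  assumes "\<And>x. x \<in> disk \<Longrightarrow> f x = g x"
  shows "bounded_continuous f \<longleftrightarrow> bounded_continuous g"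
  unfolding bounded_continuous_def
  using assms continuous_on_cong[of disk disk f g] image_cong[of disk disk f g] by auto

lemma bounded_continuous_const: "bounded_continuous (\<lambda>x. c)"
  by (rule bounded_continuousI[of _ "\<bar>c\<bar>"]) auto

lemma bounded_continuous_closed:
  assumes "continuous_on closed_disk f"
  shows "bounded_continuous f"
proof -
  have "bounded (f ` closed_disk)"
    using assms compact_imp_bounded compact_continuous_image compact_cball by blast
  then show ?thesis
    unfolding bounded_continuous_def
    using assms bounded_subset[OF _ image_mono[OF ball_subset_cball]] continuous_on_subset[OF _ ball_subset_cball]
    by blast
qed

lemma bounded_continuous_add:
  assumes "bounded_continuous f" "bounded_continuous g"
  shows "bounded_continuous (\<lambda>x. f x + g x)"
proof -
  obtain K where K: "K > 0" "\<And>x. x \<in> disk \<Longrightarrow> \<bar>f x\<bar> \<le> K" using bounded_continuousE[OF assms(1)] by blast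
  obtain L where L: "L > 0" "\<And>x. x \<in> disk \<Longrightarrow> \<bar>g x\<bar> \<le> L" using bounded_continuousE[OF assms(2)] by blast
  show ?thesis
  proof (rule bounded_continuousI)
    show "continuous_on disk (\<lambda>x. f x + g x)"
      using assms unfolding bounded_continuous_def by (intro continuous_on_add) auto
    show "\<bar>f x + g x\<bar> \<le> K + L" if "x \<in> disk" for x
      using K(2)[OF that] L(2)[OF that] by linarith
  qed
qed

lemma bounded_continuous_mult:
  assumes "bounded_continuous f" "bounded_continuous g"
  shows "bounded_continuous (\<lambda>x. f x * g x)"
proof -
  obtain K where K: "K > 0" "\<And>x. x \<in> disk \<Longrightarrow> \<bar>f x\<bar> \<le> K" using bounded_continuousE[OF assms(1)] by blast
  obtain L where L: "L > 0" "\<And>x. x \<in> disk \<Longrightarrow> \<bar>g x\<bar> \<le> L" using bounded_continuousE[OF assms(2)] by blast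
  show ?thesis
  proof (rule bounded_continuousI)
    show "continuous_on disk (\<lambda>x. f x * g x)"
      using assms unfolding bounded_continuous_def by (intro continuous_on_mult) auto
    show "\<bar>f x * g x\<bar> \<le> K * L" if "x \<in> disk" for x
      unfolding abs_mult using K(1) K(2)[OF that] L(2)[OF that] by (intro mult_mono) auto
  qed
qed

lemma bounded_continuous_minus:
  "bounded_continuous f \<Longrightarrow> bounded_continuous (\<lambda>x. - f x)"
  using bounded_continuous_mult[OF bounded_continuous_const[of "-1"], of f] by simp

lemma bounded_continuous_diff:
  "bounded_continuous f \<Longrightarrow> bounded_continuous g \<Longrightarrow> bounded_continuous (\<lambda>x. f x - g x)"
  using bounded_continuous_add[OF _ bounded_continuous_minus, of f g] by simp

lemma bounded_continuous_power:
  "bounded_continuous f \<Longrightarrow> bounded_continuous (\<lambda>x. f x ^ n)"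
  by (induction n) (simp_all add: bounded_continuous_const bounded_continuous_mult)

lemma bounded_continuous_compose:
  assumes "bounded_continuous f" "continuous_on UNIV h"
  shows "bounded_continuous (\<lambda>x. h (f x))"
proof -
  obtain K where K: "K > 0" "\<And>x. x \<in> disk \<Longrightarrow> \<bar>f x\<bar> \<le> K" using bounded_continuousE[OF assms(1)] by blast
  have "bounded (h ` cball 0 K)"
    using assms(2) by (intro compact_imp_bounded compact_continuous_image) (auto intro: continuous_on_subset)
  moreover have "(\<lambda>x. h (f x)) ` disk \<subseteq> h ` cball 0 K" using K(2) by auto
  moreover have "continuous_on disk (\<lambda>x. h (f x))"
    using assms continuous_on_compose2[OF assms(2), of disk f] by (auto simp: bounded_continuous_def)
  ultimately show ?thesis unfolding bounded_continuous_def by (blast intro: bounded_subset)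
qed

lemma bounded_continuous_abs:
  "bounded_continuous f \<Longrightarrow> bounded_continuous (\<lambda>x. \<bar>f x\<bar>)"
  by (rule bounded_continuous_compose) (auto intro!: continuous_intros)

lemmas bounded_continuous_intros =
  bounded_continuous_const bounded_continuous_add bounded_continuous_diff bounded_continuous_minus
  bounded_continuous_mult bounded_continuous_power bounded_continuous_abs

lemma C1_disk_bounded_continuous: "C1_disk f \<Longrightarrow> bounded_continuous f"
  and C1_disk_differentiable: "C1_disk f \<Longrightarrow> x \<in> disk \<Longrightarrow> f differentiable (at x)"
  and C1_disk_partial: "C1_disk f \<Longrightarrow> bounded_continuous (PD i f)"
  and C2_disk_C1: "C2_disk f \<Longrightarrow> C1_disk f"
  and C2_disk_partial: "C2_disk f \<Longrightarrow> C1_disk (PD i f)"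
  by (auto simp: C1_disk_def C2_disk_def)

lemma C1_diskI:
  assumes "bounded_continuous f" "\<And>x. x \<in> disk \<Longrightarrow> f differentiable (at x)"
    "\<And>i x. x \<in> disk \<Longrightarrow> PD i f x = f' i x" "\<And>i. bounded_continuous (f' i)"
  shows "C1_disk f"
  unfolding C1_disk_def
proof (intro conjI allI ballI)
  fix i show "bounded_continuous (PD i f)"
    using assms(3,4) bounded_continuous_cong[of "PD i f" "f' i"] by auto
qed (use assms in auto)

lemma C1_disk_const: "C1_disk (\<lambda>x. c)"
  by (rule C1_diskI[where f' = "\<lambda>i x. 0"]) (simp_all add: bounded_continuous_const)

lemma C1_disk_add:
  assumes "C1_disk f" "C1_disk g" shows "C1_disk (\<lambda>x. f x + g x)"
  using assms
  by (intro C1_diskI[where f' = "\<lambda>i x. PD i f x + PD i g x"])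
    (auto simp: C1_disk_def partial_deriv_add intro!: bounded_continuous_intros)

lemma C1_disk_diff:
  assumes "C1_disk f" "C1_disk g" shows "C1_disk (\<lambda>x. f x - g x)"
  using assms
  by (intro C1_diskI[where f' = "\<lambda>i x. PD i f x - PD i g x"])
    (auto simp: C1_disk_def partial_deriv_diff intro!: bounded_continuous_intros)

lemma C1_disk_mult:
  assumes "C1_disk f" "C1_disk g" shows "C1_disk (\<lambda>x. f x * g x)"
  using assms
  by (intro C1_diskI[where f' = "\<lambda>i x. f x * PD i g x + PD i f x * g x"])
    (auto simp: C1_disk_def partial_deriv_mult intro!: bounded_continuous_intros)

lemma C1_disk_cong:
  assumes "\<And>x. x \<in> disk \<Longrightarrow> f x = g x" "C1_disk f" shows "C1_disk g"
proof (rule C1_diskI[where f' = "\<lambda>i. PD i f"])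
  show "bounded_continuous g" using assms bounded_continuous_cong[of f g] by (auto simp: C1_disk_def)
  fix x :: "real^2" assume "x \<in> disk"
  then show "g differentiable at x"
    using assms by (intro differentiable_cong_open[of disk x f g]) (auto simp: C1_disk_def)
  show "\<And>i. PD i g x = PD i f x"
    using assms \<open>x \<in> disk\<close> by (intro partial_deriv_cong[of disk]) auto
qed (use assms in \<open>auto simp: C1_disk_def\<close>)

lemma C1_disk_coordinate: "C1_disk (\<lambda>x. x $ j)"
proof (rule C1_diskI[where f' = "\<lambda>i x. if i = j then 1 else 0"])
  show "bounded_continuous (\<lambda>x::real^2. x $ j)"
    by (intro bounded_continuous_closed continuous_intros)
qed (auto intro!: bounded_linear_imp_differentiable bounded_linear_vec_nth bounded_continuous_const)

lemma C1_disk_compose: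
  assumes "C1_disk f" "\<And>s. (h has_real_derivative h' s) (at s)" "continuous_on UNIV h'"
  shows "C1_disk (\<lambda>x. h (f x))"
proof (rule C1_diskI[where f' = "\<lambda>i x. h' (f x) * PD i f x"])
  have h: "continuous_on UNIV h"
    using assms(2) by (meson DERIV_isCont continuous_at_imp_continuous_on)
  have f: "bounded_continuous f" using assms(1) by (rule C1_disk_bounded_continuous)
  show "bounded_continuous (\<lambda>x. h (f x))" using f h by (rule bounded_continuous_compose)
  show "bounded_continuous (\<lambda>x. h' (f x) * PD i f x)" for i
    using bounded_continuous_compose[OF f assms(3)] C1_disk_partial[OF assms(1)]
    by (rule bounded_continuous_mult)
  fix x :: "real^2" assume "x \<in> disk"
  then have "f differentiable (at x)" using assms(1) by (simp add: C1_disk_def)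
  then show "(\<lambda>x. h (f x)) differentiable at x"
    "PD i (\<lambda>x. h (f x)) x = h' (f x) * PD i f x" for i
    using assms(2) by (rule partial_deriv_compose_real)+
qed

text \<open>
  Second derivatives see the first ones only through their values in the open disk, so a formula
  valid there may be differentiated once more.
\<close>

lemma C2_diskI:
  assumes "C1_disk f" "\<And>i x. x \<in> disk \<Longrightarrow> PD i f x = f' i x" "\<And>i. C1_disk (f' i)"
  shows "C2_disk f"
    and "x \<in> disk \<Longrightarrow> PD k (PD i f) x = PD k (f' i) x"
  using assms partial_deriv_cong[of disk x "PD i f" "f' i" k]
  by (auto simp: C2_disk_def intro: C1_disk_cong[of "f' _" "PD _ f"])

lemma C2_disk_const: "C2_disk (\<lambda>x. c)"
  by (rule C2_diskI(1)[where f' = "\<lambda>i x. 0"]) (simp_all add: C1_disk_const)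

lemma C2_disk_diff:
  assumes f: "C2_disk f" and g: "C2_disk g"
  shows "C2_disk (\<lambda>x. f x - g x)"
    and "x \<in> disk \<Longrightarrow> PD i (\<lambda>x. f x - g x) x = PD i f x - PD i g x"
    and "x \<in> disk \<Longrightarrow> PD k (PD i (\<lambda>x. f x - g x)) x
      = PD k (PD i f) x - PD k (PD i g) x"
proof -
  have d: "PD i (\<lambda>x. f x - g x) x = PD i f x - PD i g x" if "x \<in> disk" for i x
    by (intro partial_deriv_diff C1_disk_differentiable C2_disk_C1 f g that)
  note C2 = C2_diskI[OF C1_disk_diff[OF f[THEN C2_disk_C1] g[THEN C2_disk_C1]] d
      C1_disk_diff[OF f[THEN C2_disk_partial] g[THEN C2_disk_partial]]]
  show "C2_disk (\<lambda>x. f x - g x)" using C2(1) by blast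
  show "PD i (\<lambda>x. f x - g x) x = PD i f x - PD i g x" if "x \<in> disk"
    by (rule d[OF that])
  show "PD k (PD i (\<lambda>x. f x - g x)) x
      = PD k (PD i f) x - PD k (PD i g) x" if "x \<in> disk"
    using C2(2)[OF _ that]
      partial_deriv_diff[OF f[THEN C2_disk_partial, THEN C1_disk_differentiable, OF that]
        g[THEN C2_disk_partial, THEN C1_disk_differentiable, OF that]] by simp
qed

lemma C2_disk_cmult:
  assumes f: "C2_disk f"
  shows "C2_disk (\<lambda>x. c * f x)"
    and "x \<in> disk \<Longrightarrow> PD k (PD i (\<lambda>x. c * f x)) x = c * PD k (PD i f) x"
proof -
  have scale: "PD i (\<lambda>x. c * g x) x = c * PD i g x" if "C1_disk g" "x \<in> disk" for i x g
    using partial_deriv_mult[of "\<lambda>x. c" x g i] C1_disk_differentiable[OF that] by simp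
  note C2 = C2_diskI[OF C1_disk_mult[OF C1_disk_const f[THEN C2_disk_C1]] scale[OF f[THEN C2_disk_C1]]
      C1_disk_mult[OF C1_disk_const f[THEN C2_disk_partial]]]
  show "C2_disk (\<lambda>x. c * f x)" using C2(1) by blast
  show "PD k (PD i (\<lambda>x. c * f x)) x = c * PD k (PD i f) x" if "x \<in> disk"
    using C2(2)[OF _ that] scale[OF f[THEN C2_disk_partial] that] by simp
qed

section \<open>Integration over the disk\<close>

abbreviation disk_integral :: "(real^2 \<Rightarrow> real) \<Rightarrow> real"  (binder "DINT " 10) where
  "disk_integral f \<equiv> set_lebesgue_integral lborel disk f"

lemma disk_integrable:
  assumes "bounded_continuous f"
  shows "set_integrable lborel disk f"
proof -
  obtain K where K: "K > 0" "\<And>x. x \<in> disk \<Longrightarrow> \<bar>f x\<bar> \<le> K" using bounded_continuousE[OF assms] by blast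
  have m: "(\<lambda>x. indicator disk x *\<^sub>R f x) \<in> borel_measurable lborel"
    using borel_measurable_continuous_on_indicator[of disk f] assms
    unfolding bounded_continuous_def by simp
  have "integrable lborel (\<lambda>x. K * indicator disk x :: real)"
    using emeasure_lborel_ball_finite[of "0::real^2" 1]
    by (intro integrable_mult_right) (simp add: integrable_indicator_iff top.not_eq_extremum infinity_ennreal_def)
  then show ?thesis unfolding set_integrable_def
  proof (rule Bochner_Integration.integrable_bound[OF _ m])
    have "norm (indicator disk x *\<^sub>R f x) \<le> norm (K * indicator disk x :: real)" for x
      using K(2)[of x] by (cases "x \<in> disk") auto
    then show "AE x in lborel. norm (indicator disk x *\<^sub>R f x) \<le> norm (K * indicator disk x :: real)"
      by blast
  qed
qed

lemma disk_integral_cong: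
  assumes "\<And>x. x \<in> disk \<Longrightarrow> f x = g x"
  shows "(DINT x. f x) = (DINT x. g x)"
  by (rule set_lebesgue_integral_cong) (auto simp: assms)

lemma disk_integral_add:
  assumes "bounded_continuous f" "bounded_continuous g"
  shows "(DINT x. f x + g x) = (DINT x. f x) + (DINT x. g x)"
  using assms by (intro set_integral_add disk_integrable)

lemma disk_integral_diff:
  assumes "bounded_continuous f" "bounded_continuous g"
  shows "(DINT x. f x - g x) = (DINT x. f x) - (DINT x. g x)"
  using assms by (intro set_integral_diff disk_integrable)

lemma disk_integral_cmult:
  fixes f :: "real^2 \<Rightarrow> real"
  shows "(DINT x. c * f x) = c * (DINT x. f x)"
  by simp

lemma disk_integral_mono:
  assumes "bounded_continuous f" "bounded_continuous g" "\<And>x. x \<in> disk \<Longrightarrow> f x \<le> g x"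
  shows "(DINT x. f x) \<le> (DINT x. g x)"
  using assms by (intro set_integral_mono disk_integrable) auto

lemma disk_integral_nonneg:
  fixes f :: "real^2 \<Rightarrow> real"
  assumes "\<And>x. x \<in> disk \<Longrightarrow> 0 \<le> f x"
  shows "0 \<le> (DINT x. f x)"
  using assms unfolding set_lebesgue_integral_def
  by (intro integral_nonneg_AE AE_I2) (auto simp: indicator_def)

lemma disk_integral_zero_imp:
  assumes f: "bounded_continuous f" "\<And>x. x \<in> disk \<Longrightarrow> 0 \<le> f x"
    and zero: "(DINT x. f x) \<le> 0" and x: "x \<in> disk"
  shows "f x = 0"
proof (rule ccontr)
  assume ne: "f x \<noteq> 0"
  let ?U = "{y\<in>disk. f y \<noteq> 0}"
  have cont: "continuous_on disk f" using f(1) by (simp add: bounded_continuous_def)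
  have U: "open ?U"
    using continuous_openin_preimage_gen[OF cont, of "-{0}"]
    by (auto simp: vimage_def Int_def openin_open_eq open_Compl)
  have int: "integrable lborel (\<lambda>x. indicator disk x *\<^sub>R f x)"
    using disk_integrable[OF f(1)] by (simp add: set_integrable_def)
  have nn: "AE x in lborel. 0 \<le> indicator disk x *\<^sub>R f x"
    using f(2) by (intro AE_I2) (auto simp: indicator_def)
  have "(DINT x. f x) = 0"
    using zero disk_integral_nonneg[OF f(2)] by (intro antisym) auto
  then have "AE x in lborel. indicator disk x *\<^sub>R f x = 0"
    using integral_nonneg_eq_0_iff_AE[OF int nn] by (simp add: set_lebesgue_integral_def)
  then have "AE x in lborel. x \<notin> ?U"
    by eventually_elim (auto simp: indicator_def)
  then have "?U \<in> null_sets lborel"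
    using U by (subst (asm) AE_iff_null_sets[symmetric]) auto
  then have "negligible ?U"
    by (simp add: negligible_iff_null_sets null_sets_completionI)
  then show False
    using open_not_negligible[OF U] x ne by blast
qed

text \<open>
  Applied to the integral of \<open>(f + l g)\<^sup>2\<close> as a polynomial in \<open>l\<close>, this is the Cauchy--Schwarz
  inequality.
\<close>

lemma quadratic_nonneg_discriminant:
  fixes a b c :: real
  assumes "c \<ge> 0" "\<And>l. a + 2 * b * l + c * l\<^sup>2 \<ge> 0"
  shows "b\<^sup>2 \<le> a * c"
proof (cases "c = 0")
  case True
  have "b = 0"
  proof (rule ccontr)
    assume "b \<noteq> 0"
    have "a + 2 * b * (-(a+1)/(2*b)) \<ge> 0" using assms(2)[of "-(a+1)/(2*b)"] True by simp
    then show False using \<open>b \<noteq> 0\<close> by (simp add: field_simps)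
  qed
  then show ?thesis using True by simp
next
  case False
  then have "c > 0" using assms(1) by simp
  have "c * (a + 2 * b * (-b/c) + c * (-b/c)\<^sup>2) \<ge> 0" using assms by (intro mult_nonneg_nonneg)
  then show ?thesis using \<open>c > 0\<close> by (simp add: field_simps power2_eq_square)
qed

text \<open>
  Extension by zero turns integrals over the disk into integrals over the plane, to which Fubini's
  theorem applies.
\<close>

definition zero_extension :: "(real^2 \<Rightarrow> real) \<Rightarrow> real^2 \<Rightarrow> real" where
  "zero_extension f x = indicator disk x * f x"

lemma zero_extension_integrable:
  "bounded_continuous f \<Longrightarrow> integrable lborel (zero_extension f)"
  using disk_integrable[of f] by (simp add: set_integrable_def zero_extension_def[abs_def])

lemma zero_extension_measurable:
  "bounded_continuous f \<Longrightarrow> zero_extension f \<in> borel_measurable borel"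
  using borel_measurable_integrable[OF zero_extension_integrable] by simp

lemma disk_integral_zero_extension:
  "(DINT x. f x) = (LINT x|lborel. zero_extension f x)"
  by (simp add: set_lebesgue_integral_def zero_extension_def)

section \<open>Slices of the disk and integration by parts\<close>

lemma vector_2_in_box:
  "(vector [x, y] :: real^2) \<in> box l u \<longleftrightarrow> x \<in> box (l $ 1) (u $ 1) \<and> y \<in> box (l $ 2) (u $ 2)"
  by (auto simp: mem_box_cart forall_2)

lemma prod_Basis_vec: "(\<Prod>b\<in>(Basis :: (real^2) set). f b) = f (axis 1 1) * f (axis 2 1)"
proof -
  have B: "(Basis :: (real^2) set) = {axis 1 1, axis 2 1}"
    unfolding Basis_vec_def by auto (metis exhaust_2)
  have "axis 1 (1::real) \<noteq> (axis 2 1 :: real^2)"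
    by (simp add: axis_eq_axis)
  then show ?thesis unfolding B by simp
qed

lemma vector_2_measurable [measurable]:
  "(\<lambda>p. vector [fst p, snd p] :: real^2) \<in> borel_measurable (borel \<Otimes>\<^sub>M borel)"
proof -
  have "(\<lambda>p. vector [fst p, snd p] :: real^2) = (\<lambda>p. \<chi> i. if i = 1 then fst p else snd p)"
    by (auto simp: vec_eq_iff forall_2)
  moreover have "continuous_on UNIV (\<lambda>p::real\<times>real. (\<chi> i. if i = 1 then fst p else snd p) :: real^2)"
  proof (rule continuous_on_vec_lambda)
    fix i :: 2 show "continuous_on UNIV (\<lambda>p::real\<times>real. if i = 1 then fst p else snd p)"
      by (cases "i = 1") (auto intro!: continuous_intros)
  qed
  ultimately show ?thesis
    by (simp add: borel_measurable_continuous_onI borel_prod)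
qed

lemma lborel_vec_2:
  "lborel = distr (lborel \<Otimes>\<^sub>M lborel) borel (\<lambda>p. vector [fst p, snd p] :: real^2)"
proof (rule lborel_eqI)
  fix l u :: "real^2" assume le: "\<And>b. b \<in> Basis \<Longrightarrow> l \<bullet> b \<le> u \<bullet> b"
  have le': "l $ 1 \<le> u $ 1" "l $ 2 \<le> u $ 2"
    using le[of "axis 1 1"] le[of "axis 2 1"] by (auto simp: inner_axis)
  let ?T = "\<lambda>p. vector [fst p, snd p] :: real^2"
  have "?T -` box l u = box (l $ 1) (u $ 1) \<times> box (l $ 2) (u $ 2)"
    by (auto simp: vector_2_in_box)
  then have "emeasure (distr (lborel \<Otimes>\<^sub>M lborel) borel ?T) (box l u)
      = emeasure (lborel \<Otimes>\<^sub>M lborel) (box (l $ 1) (u $ 1) \<times> box (l $ 2) (u $ 2))"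
    by (subst emeasure_distr) (auto simp: space_pair_measure)
  also have "\<dots> = emeasure lborel (box (l $ 1) (u $ 1)) * emeasure lborel (box (l $ 2) (u $ 2))"
    by (rule lborel.emeasure_pair_measure_Times) auto
  also have "\<dots> = ennreal ((u $ 1 - l $ 1) * (u $ 2 - l $ 2))"
    using le' by (simp add: ennreal_mult)
  also have "\<dots> = ennreal (\<Prod>b\<in>Basis. (u - l) \<bullet> b)"
    by (simp add: prod_Basis_vec inner_axis)
  finally show "emeasure (distr (lborel \<Otimes>\<^sub>M lborel) borel ?T) (box l u) = (\<Prod>b\<in>Basis. (u - l) \<bullet> b)"
    by simp
qed simp

lemma nn_integral_vec_2:
  fixes f :: "real^2 \<Rightarrow> ennreal"
  assumes [measurable]: "f \<in> borel_measurable borel"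
  shows "(\<integral>\<^sup>+z. f z \<partial>lborel) = (\<integral>\<^sup>+x. \<integral>\<^sup>+y. f (vector [x, y]) \<partial>lborel \<partial>lborel)"
    and "(\<integral>\<^sup>+z. f z \<partial>lborel) = (\<integral>\<^sup>+y. \<integral>\<^sup>+x. f (vector [x, y]) \<partial>lborel \<partial>lborel)"
proof -
  have "(\<integral>\<^sup>+z. f z \<partial>lborel)
      = (\<integral>\<^sup>+p. f (vector [fst p, snd p]) \<partial>(lborel \<Otimes>\<^sub>M lborel))"
    by (subst lborel_vec_2, subst nn_integral_distr) auto
  then show "(\<integral>\<^sup>+z. f z \<partial>lborel) = (\<integral>\<^sup>+x. \<integral>\<^sup>+y. f (vector [x, y]) \<partial>lborel \<partial>lborel)"
    "(\<integral>\<^sup>+z. f z \<partial>lborel) = (\<integral>\<^sup>+y. \<integral>\<^sup>+x. f (vector [x, y]) \<partial>lborel \<partial>lborel)"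
    using lborel.nn_integral_fst[of "\<lambda>p. f (vector [fst p, snd p])" lborel]
      lborel_pair.nn_integral_snd[of "\<lambda>p. f (vector [fst p, snd p])"] by auto
qed

text \<open>
  The line meets the disk in an interval centred at \<open>z\<close>, because \<open>z\<close> is its point closest to the
  origin.
\<close>

lemma slice_interval:
  fixes z :: "real^2"
  assumes z: "z $ i = 0" "z \<in> disk"
  obtains r where "r > 0" "\<And>t. norm (z + t *\<^sub>R axis i 1) < 1 \<longleftrightarrow> \<bar>t\<bar> < r"
    "\<And>t. norm (z + t *\<^sub>R axis i 1) \<le> 1 \<longleftrightarrow> \<bar>t\<bar> \<le> r"
proof
  let ?e = "axis i (1::real)" and ?r = "sqrt (1 - (norm z)\<^sup>2)"
  have "(norm z)\<^sup>2 < 1" using z(2) by (simp add: abs_square_less_1)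
  then have r: "?r > 0" "?r\<^sup>2 = 1 - (norm z)\<^sup>2" by simp_all
  have sq: "(norm (z + t *\<^sub>R ?e))\<^sup>2 = 1 - (?r\<^sup>2 - t\<^sup>2)" for t
  proof -
    have "orthogonal z (t *\<^sub>R ?e)" using z(1) by (simp add: orthogonal_def inner_axis)
    from norm_add_Pythagorean[OF this] show ?thesis using r(2) by simp
  qed
  show "norm (z + t *\<^sub>R ?e) < 1 \<longleftrightarrow> \<bar>t\<bar> < ?r" for t
    using abs_square_less_1[of "norm (z + t *\<^sub>R ?e)"] abs_le_square_iff[of ?r t] r(1) sq[of t] by force
  show "norm (z + t *\<^sub>R ?e) \<le> 1 \<longleftrightarrow> \<bar>t\<bar> \<le> ?r" for t
    using abs_square_le_1[of "norm (z + t *\<^sub>R ?e)"] abs_le_square_iff[of t ?r] r(1) sq[of t] by force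
qed (use z in \<open>simp add: abs_square_less_1\<close>)

text \<open>
  The fundamental theorem of calculus on the part of the slice to the left of \<open>s\<close>; the contribution
  of the left endpoint vanishes because it lies on the circle.
\<close>

lemma slice_integral:
  assumes w: "vanishes_on_circle w" "\<And>x. x \<in> disk \<Longrightarrow> w differentiable (at x)"
    and bc: "bounded_continuous (PD i w)"
    and z: "z $ i = 0" "z \<in> disk" and s: "z + s *\<^sub>R axis i 1 \<in> closed_disk"
  shows "integrable lborel (\<lambda>t. indicator {..s} t * zero_extension (PD i w) (z + t *\<^sub>R axis i 1))"
    and "(LINT t|lborel. indicator {..s} t * zero_extension (PD i w) (z + t *\<^sub>R axis i 1))
      = w (z + s *\<^sub>R axis i 1)"
proof -
  let ?e = "axis i (1::real)" and ?D = "zero_extension (PD i w)"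
  obtain r where r: "r > 0" and inside: "\<And>t. norm (z + t *\<^sub>R ?e) < 1 \<longleftrightarrow> \<bar>t\<bar> < r"
    and closed: "\<And>t. norm (z + t *\<^sub>R ?e) \<le> 1 \<longleftrightarrow> \<bar>t\<bar> \<le> r"
    using slice_interval[OF z] by blast
  have "norm (z + (- r) *\<^sub>R ?e) = 1"
    using inside[of "- r"] closed[of "- r"] r by simp
  then have w0: "w (z + (- r) *\<^sub>R ?e) = 0" using w(1) by (simp add: vanishes_on_circle_def)
  have s': "- r \<le> s" "s \<le> r" using s closed[of s] by auto
  have mD [measurable]: "?D \<in> borel_measurable borel"
    by (rule zero_extension_measurable[OF bc])
  obtain K where K: "K > 0" "\<And>x. x \<in> disk \<Longrightarrow> \<bar>PD i w x\<bar> \<le> K"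
    using bounded_continuousE[OF bc] by blast
  \<comment> \<open>The derivative of \<open>w\<close> exists only inside the disk, whence the version with interior derivatives.\<close>
  have FTC: "((\<lambda>t. PD i w (z + t *\<^sub>R ?e)) has_integral (w (z + s *\<^sub>R ?e) - w (z + (- r) *\<^sub>R ?e))) {- r..s}"
  proof (rule fundamental_theorem_of_calculus_interior[OF s'(1)])
    have "continuous_on closed_disk w" using w(1) by (simp add: vanishes_on_circle_def)
    then show "continuous_on {- r..s} (\<lambda>t. w (z + t *\<^sub>R ?e))"
      by (rule continuous_on_compose2) (use closed s' in \<open>auto intro!: continuous_intros\<close>)
    fix t assume "t \<in> {- r<..<s}"
    then show "((\<lambda>t. w (z + t *\<^sub>R ?e)) has_vector_derivative PD i w (z + t *\<^sub>R ?e)) (at t)"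
      using inside[of t] s'
      by (intro has_real_derivative_iff_has_vector_derivative[THEN iffD1] has_derivative_along_axis w(2)) auto
  qed
  define f where "f = (\<lambda>t. indicator {..s} t * ?D (z + t *\<^sub>R ?e))"
  have int: "integrable lborel f"
  proof (rule Bochner_Integration.integrable_bound)
    show "integrable lborel (\<lambda>t. K * indicator {- r..r} t :: real)"
      using r by (intro integrable_mult_right) (simp add: integrable_indicator_iff)
    show "f \<in> borel_measurable lborel" unfolding f_def by simp
    have "norm (f t) \<le> norm (K * indicator {- r..r} t)" for t
      using K inside[of t] by (auto simp: f_def zero_extension_def indicator_def)
    then show "AE t in lborel. norm (f t) \<le> norm (K * indicator {- r..r} t)" by simp
  qed
  then show "integrable lborel (\<lambda>t. indicator {..s} t * ?D (z + t *\<^sub>R ?e))" by (simp add: f_def)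
  have "(f has_integral w (z + s *\<^sub>R ?e)) {- r..s}"
    by (rule has_integral_spike_finite[of "{- r, s}", OF _ _ FTC[unfolded w0 diff_0_right]])
      (use inside s' in \<open>auto simp: f_def zero_extension_def\<close>)
  then have "((\<lambda>t. if t \<in> {- r..s} then f t else 0) has_integral w (z + s *\<^sub>R ?e)) UNIV"
    by (simp only: has_integral_restrict_UNIV)
  moreover have "(\<lambda>t. if t \<in> {- r..s} then f t else 0) = f"
    using inside s' by (auto simp: f_def fun_eq_iff indicator_def zero_extension_def)
  ultimately have "(f has_integral w (z + s *\<^sub>R ?e)) UNIV" by simp
  with has_integral_integral_lborel[OF int] have "(LINT t|lborel. f t) = w (z + s *\<^sub>R ?e)"
    by (rule has_integral_unique)
  then show "(LINT t|lborel. indicator {..s} t * ?D (z + t *\<^sub>R ?e)) = w (z + s *\<^sub>R ?e)"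
    by (simp add: f_def)
qed

lemma slice_outside:
  assumes "z $ i = 0" "z \<notin> disk"
  shows "zero_extension f (z + t *\<^sub>R axis i 1) = 0"
proof -
  have "orthogonal z (t *\<^sub>R axis i 1)" using assms(1) by (simp add: orthogonal_def inner_axis)
  from norm_add_Pythagorean[OF this] have "(norm z)\<^sup>2 \<le> (norm (z + t *\<^sub>R axis i 1))\<^sup>2" by simp
  then have "norm z \<le> norm (z + t *\<^sub>R axis i 1)" by (rule power2_le_imp_le) simp
  then show ?thesis using assms(2) by (simp add: zero_extension_def)
qed

text \<open>
  The whole slice is the case where the right endpoint lies on the circle as well.
\<close>

lemma slice_integral_zero:
  assumes w: "vanishes_on_circle w" "\<And>x. x \<in> disk \<Longrightarrow> w differentiable (at x)"
    and bc: "bounded_continuous (PD i w)" and z: "z $ i = 0"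
  shows "(LINT t|lborel. zero_extension (PD i w) (z + t *\<^sub>R axis i 1)) = 0"
proof (cases "z \<in> disk")
  case True
  let ?e = "axis i (1::real)"
  obtain r where r: "r > 0" and inside: "\<And>t. norm (z + t *\<^sub>R ?e) < 1 \<longleftrightarrow> \<bar>t\<bar> < r"
    and closed: "\<And>t. norm (z + t *\<^sub>R ?e) \<le> 1 \<longleftrightarrow> \<bar>t\<bar> \<le> r"
    using slice_interval[OF z True] by blast
  have s: "norm (z + r *\<^sub>R ?e) = 1" using inside[of r] closed[of r] r by simp
  have "zero_extension f (z + t *\<^sub>R ?e) = 0" if "r < t" for f t
    using inside[of t] that by (simp add: zero_extension_def)
  then have "(\<lambda>t. zero_extension (PD i w) (z + t *\<^sub>R ?e))
      = (\<lambda>t. indicator {..r} t * zero_extension (PD i w) (z + t *\<^sub>R ?e))"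
    by (auto simp: fun_eq_iff indicator_def)
  then show ?thesis
    using slice_integral(2)[OF w bc z True, of r] s w(1) by (simp add: vanishes_on_circle_def)
qed (simp add: slice_outside[OF z])

lemma slice_bound:
  assumes w: "vanishes_on_circle w" "C1_disk w" and z: "z $ i = 0"
  shows "ennreal \<bar>zero_extension w (z + s *\<^sub>R axis i 1)\<bar>
    \<le> (\<integral>\<^sup>+t. ennreal \<bar>zero_extension (PD i w) (z + t *\<^sub>R axis i 1)\<bar> \<partial>lborel)"
proof (cases "z + s *\<^sub>R axis i 1 \<in> disk")
  case True
  let ?D = "\<lambda>t. zero_extension (PD i w) (z + t *\<^sub>R axis i 1)"
  have zd: "z \<in> disk"
    using slice_outside[OF z, of "\<lambda>x. 1" s] True by (auto simp: zero_extension_def)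
  have "z + s *\<^sub>R axis i 1 \<in> closed_disk" using True by simp
  moreover have "w differentiable (at x)" if "x \<in> disk" for x using w(2) that by (rule C1_disk_differentiable)
  ultimately have slice: "integrable lborel (\<lambda>t. indicator {..s} t * ?D t)"
    "(LINT t|lborel. indicator {..s} t * ?D t) = w (z + s *\<^sub>R axis i 1)"
    using w(1) C1_disk_partial[OF w(2)] z zd by (auto intro: slice_integral)
  have "ennreal \<bar>w (z + s *\<^sub>R axis i 1)\<bar> \<le> (\<integral>\<^sup>+t. ennreal \<bar>indicator {..s} t * ?D t\<bar> \<partial>lborel)"
    using integral_norm_bound_ennreal[OF slice(1)] by (simp add: slice(2))
  also have "\<dots> \<le> (\<integral>\<^sup>+t. ennreal \<bar>?D t\<bar> \<partial>lborel)"
    by (intro nn_integral_mono) (auto simp: indicator_def)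
  finally show ?thesis using True by (simp add: zero_extension_def)
qed (simp add: zero_extension_def)

lemma vector_2_slices:
  "(vector [x, y] :: real^2) = vector [0, y] + x *\<^sub>R axis 1 1"
  "(vector [x, y] :: real^2) = vector [x, 0] + y *\<^sub>R axis 2 1"
  by (auto simp: vec_eq_iff forall_2 axis_def)

text \<open>
  Every slice parallel to the axis \<open>i\<close> contributes zero.
\<close>

theorem disk_integral_partial_deriv:
  assumes g: "vanishes_on_circle g" "\<And>x. x \<in> disk \<Longrightarrow> g differentiable (at x)"
    and bc: "bounded_continuous (PD i g)"
  shows "(DINT x. PD i g x) = 0"
proof -
  let ?D = "zero_extension (PD i g)"
  let ?T = "\<lambda>p. vector [fst p, snd p] :: real^2"
  have [measurable]: "?D \<in> borel_measurable borel"
    by (rule zero_extension_measurable[OF bc])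
  have "integrable (distr (lborel \<Otimes>\<^sub>M lborel) borel ?T) ?D"
    using zero_extension_integrable[OF bc] lborel_vec_2 by simp
  then have int: "integrable (lborel \<Otimes>\<^sub>M lborel) (\<lambda>(x, y). ?D (vector [x, y]))"
    by (subst (asm) integrable_distr_eq) (auto simp: case_prod_unfold)
  have "(LINT x|lborel. ?D x) = (LINT p|(lborel \<Otimes>\<^sub>M lborel). ?D (?T p))"
    by (subst lborel_vec_2, rule integral_distr) auto
  also have "\<dots> = integral\<^sup>L (lborel \<Otimes>\<^sub>M lborel) (\<lambda>(x, y). ?D (vector [x, y]))"
    by (simp add: case_prod_unfold)
  also have "\<dots> = 0"
  proof (cases "i = 1")
    case True
    have "(LINT x|lborel. ?D (vector [x, y])) = 0" for y
      using slice_integral_zero[OF g bc, of "vector [0, y]"] True by (subst vector_2_slices(1)) simp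
    then show ?thesis using lborel_pair.integral_snd[OF int] by simp
  next
    case False
    then have i: "i = 2" using exhaust_2 by blast
    have "(LINT y|lborel. ?D (vector [x, y])) = 0" for x
      using slice_integral_zero[OF g bc, of "vector [x, 0]"] i by (subst vector_2_slices(2)) simp
    then show ?thesis using lborel_pair.integral_fst[OF int] by simp
  qed
  finally show ?thesis by (simp only: disk_integral_zero_extension)
qed

text \<open>
  A bounded factor preserves the limit 0 at the circle. This is how the pressure and the gradient of
  the velocity enter integrations by parts.
\<close>

lemma vanishes_on_circle_mult:
  assumes a: "vanishes_on_circle a" and b: "bounded_continuous b"
  shows "vanishes_on_circle (\<lambda>x. a x * b x)"
  unfolding vanishes_on_circle_def
proof
  obtain K where K: "K > 0" "\<And>x. x \<in> disk \<Longrightarrow> \<bar>b x\<bar> \<le> K" using bounded_continuousE[OF b] by blast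
  have ca: "continuous_on closed_disk a" and za: "\<And>x. norm x = 1 \<Longrightarrow> a x = 0"
    using a by (auto simp: vanishes_on_circle_def)
  show "continuous_on closed_disk (\<lambda>x. a x * b x)"
    unfolding continuous_on_eq_continuous_within
  proof
    fix x :: "real^2" assume x: "x \<in> closed_disk"
    show "continuous (at x within closed_disk) (\<lambda>x. a x * b x)"
    proof (cases "norm x = 1")
      case True
      have "(a \<longlongrightarrow> 0) (at x within closed_disk)"
        using ca x za[OF True] by (metis continuous_on_def)
      then have "((\<lambda>y. K * \<bar>a y\<bar>) \<longlongrightarrow> 0) (at x within closed_disk)"
        by (auto intro!: tendsto_eq_intros)
      moreover have "\<forall>\<^sub>F y in at x within closed_disk. norm (a y * b y) \<le> K * \<bar>a y\<bar>"
      proof (rule eventually_at_topological[THEN iffD2, OF exI[of _ UNIV]], safe)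
        fix y :: "real^2" assume y: "y \<in> closed_disk"
        show "norm (a y * b y) \<le> K * \<bar>a y\<bar>"
        proof (cases "norm y = 1")
          case False
          then have "y \<in> disk" using y by simp
          then show ?thesis using mult_left_mono[OF K(2), of y "\<bar>a y\<bar>"] by (simp add: abs_mult mult.commute)
        qed (simp add: za)
      qed auto
      ultimately have "((\<lambda>y. a y * b y) \<longlongrightarrow> 0) (at x within closed_disk)"
        by (rule Lim_null_comparison[rotated])
      then show ?thesis using za[OF True] by (simp add: continuous_within)
    next
      case False
      then have xd: "x \<in> disk" using x by simp
      have "isCont b x" using b xd by (simp add: bounded_continuous_def continuous_on_eq_continuous_at)
      moreover have "isCont a x"
        using ca xd continuous_on_subset[OF ca ball_subset_cball] by (simp add: continuous_on_eq_continuous_at)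
      ultimately have "isCont (\<lambda>x. a x * b x) x" by (intro isCont_mult)
      then show ?thesis by (rule continuous_at_imp_continuous_at_within)
    qed
  qed
  show "\<forall>x. norm x = 1 \<longrightarrow> a x * b x = 0" using za by simp
qed

corollary integration_by_parts:
  assumes "vanishes_on_circle a" "C1_disk a" "C1_disk b"
  shows "(DINT x. a x * PD i b x) = - (DINT x. PD i a x * b x)"
proof -
  note bc = C1_disk_bounded_continuous[OF assms(2)] C1_disk_bounded_continuous[OF assms(3)]
    C1_disk_partial[OF assms(2), of i] C1_disk_partial[OF assms(3), of i]
  have ab: "C1_disk (\<lambda>x. a x * b x)" using assms by (intro C1_disk_mult)
  have "0 = (DINT x. PD i (\<lambda>x. a x * b x) x)"
    using assms ab bc by (intro disk_integral_partial_deriv[symmetric] vanishes_on_circle_mult)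
      (auto intro: C1_disk_differentiable C1_disk_partial)
  also have "\<dots> = (DINT x. a x * PD i b x + PD i a x * b x)"
    using assms by (intro disk_integral_cong partial_deriv_mult) (auto intro: C1_disk_differentiable)
  also have "\<dots> = (DINT x. a x * PD i b x) + (DINT x. PD i a x * b x)"
    using bc by (intro disk_integral_add bounded_continuous_mult)
  finally show ?thesis by simp
qed

text \<open>
  At \<open>(x, y)\<close> the function is bounded by the integral of \<open>\<bar>\<partial>\<^sub>1w\<bar>\<close> over the horizontal line, which
  depends on \<open>y\<close> only, and by the integral of \<open>\<bar>\<partial>\<^sub>2w\<bar>\<close> over the vertical line, which depends on
  \<open>x\<close> only. The product of the two bounds integrates to the product of two integrals over the disk.
\<close>

theorem disk_square_integral_le:
  assumes w: "vanishes_on_circle w" "C1_disk w"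
  shows "(DINT z. (w z)\<^sup>2)
    \<le> (DINT z. \<bar>PD 1 w z\<bar>) * (DINT z. \<bar>PD 2 w z\<bar>)"
proof -
  define D where "D = (\<lambda>i z. ennreal \<bar>zero_extension (PD i w) z\<bar>)"
  have bc: "bounded_continuous (PD i w)" for i using w(2) by (rule C1_disk_partial)
  have bw: "bounded_continuous w" using w(2) by (rule C1_disk_bounded_continuous)
  have [measurable]: "zero_extension (PD i w) \<in> borel_measurable borel" for i
    by (rule zero_extension_measurable[OF bc])
  have [measurable]: "D i \<in> borel_measurable borel" for i unfolding D_def by simp
  have [measurable]: "zero_extension w \<in> borel_measurable borel"
    by (rule zero_extension_measurable[OF bw])
  define A where "A = (\<lambda>y. \<integral>\<^sup>+s. D 1 (vector [s, y]) \<partial>lborel)"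
  define B where "B = (\<lambda>x. \<integral>\<^sup>+s. D 2 (vector [x, s]) \<partial>lborel)"
  have meas2: "(\<lambda>p. D i (vector [fst p, snd p])) \<in> borel_measurable (lborel \<Otimes>\<^sub>M lborel)" for i
    by measurable
  have [measurable]: "A \<in> borel_measurable borel"
  proof -
    have "(\<lambda>p. D 1 (vector [snd p, fst p])) \<in> borel_measurable (lborel \<Otimes>\<^sub>M lborel)"
      using measurable_compose[OF measurable_Pair[OF measurable_snd measurable_fst] meas2[of 1]] by simp
    from lborel.borel_measurable_nn_integral_fst[OF this] show ?thesis by (simp add: A_def)
  qed
  have [measurable]: "B \<in> borel_measurable borel"
    using lborel.borel_measurable_nn_integral_fst[OF meas2[of 2]] by (simp add: B_def)
  have "ennreal \<bar>zero_extension w (vector [x, y])\<bar> \<le> A y" for x y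
    using slice_bound[OF w, of "vector [0, y]" 1 x] by (simp add: vector_2_slices(1)[symmetric] A_def D_def)
  moreover have "ennreal \<bar>zero_extension w (vector [x, y])\<bar> \<le> B x" for x y
    using slice_bound[OF w, of "vector [x, 0]" 2 y] by (simp add: vector_2_slices(2)[symmetric] B_def D_def)
  ultimately have le: "ennreal ((zero_extension w (vector [x, y]))\<^sup>2) \<le> B x * A y" for x y
    using mult_mono[of "ennreal \<bar>zero_extension w (vector [x, y])\<bar>" "B x"
        "ennreal \<bar>zero_extension w (vector [x, y])\<bar>" "A y"]
    by (simp add: ennreal_mult[symmetric] power2_eq_square)
  have A: "(\<integral>\<^sup>+y. A y \<partial>lborel) = (\<integral>\<^sup>+z. D 1 z \<partial>lborel)"
    unfolding A_def by (rule nn_integral_vec_2(2)[symmetric]) simp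
  have B: "(\<integral>\<^sup>+x. B x \<partial>lborel) = (\<integral>\<^sup>+z. D 2 z \<partial>lborel)"
    unfolding B_def by (rule nn_integral_vec_2(1)[symmetric]) simp
  have D: "(\<integral>\<^sup>+z. D i z \<partial>lborel) = ennreal (DINT z. \<bar>PD i w z\<bar>)" for i
  proof -
    have "(\<integral>\<^sup>+z. D i z \<partial>lborel) = ennreal (LINT z|lborel. \<bar>zero_extension (PD i w) z\<bar>)"
      unfolding D_def using zero_extension_integrable[OF bc]
      by (intro nn_integral_eq_integral) auto
    also have "(LINT z|lborel. \<bar>zero_extension (PD i w) z\<bar>)
        = (DINT z. \<bar>PD i w z\<bar>)"
      unfolding disk_integral_zero_extension by (simp add: zero_extension_def[abs_def] abs_mult)
    finally show ?thesis .
  qed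
  have "ennreal (DINT z. (w z)\<^sup>2) = (\<integral>\<^sup>+z. ennreal ((zero_extension w z)\<^sup>2) \<partial>lborel)"
  proof -
    have "(DINT z. (w z)\<^sup>2) = (LINT z|lborel. (zero_extension w z)\<^sup>2)"
      unfolding set_lebesgue_integral_def zero_extension_def
      by (intro Bochner_Integration.integral_cong) (auto simp: indicator_def)
    moreover have "integrable lborel (\<lambda>z. (zero_extension w z)\<^sup>2)"
    proof -
      have "(\<lambda>z. (zero_extension w z)\<^sup>2) = zero_extension (\<lambda>z. (w z)\<^sup>2)"
        by (auto simp: zero_extension_def indicator_def fun_eq_iff)
      then show ?thesis using zero_extension_integrable[OF bounded_continuous_power[OF bw]] by simp
    qed
    ultimately show ?thesis by (subst nn_integral_eq_integral) auto
  qed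
  also have "\<dots> = (\<integral>\<^sup>+x. \<integral>\<^sup>+y. ennreal ((zero_extension w (vector [x, y]))\<^sup>2) \<partial>lborel \<partial>lborel)"
    by (rule nn_integral_vec_2(1)) simp
  also have "\<dots> \<le> (\<integral>\<^sup>+x. \<integral>\<^sup>+y. B x * A y \<partial>lborel \<partial>lborel)"
    by (intro nn_integral_mono le)
  also have "\<dots> = (\<integral>\<^sup>+x. B x \<partial>lborel) * (\<integral>\<^sup>+y. A y \<partial>lborel)"
    by (simp add: nn_integral_cmult nn_integral_multc)
  also have "\<dots> = ennreal ((DINT z. \<bar>PD 1 w z\<bar>) * (DINT z. \<bar>PD 2 w z\<bar>))"
    unfolding A B D by (subst ennreal_mult) (auto intro: disk_integral_nonneg simp: mult.commute)
  finally show ?thesis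
    by (subst (asm) ennreal_le_iff) (auto intro!: mult_nonneg_nonneg disk_integral_nonneg)
qed

section \<open>Energy estimates\<close>

lemma bounded_continuous_sum:
  assumes "\<And>k. k \<in> A \<Longrightarrow> bounded_continuous (f k)"
  shows "bounded_continuous (\<lambda>x. \<Sum>k\<in>A. f k x)"
  using assms
  by (induction A rule: infinite_finite_induct)
    (simp_all add: bounded_continuous_const bounded_continuous_add)

lemma C2_disk_laplacian: "C2_disk f \<Longrightarrow> bounded_continuous (laplacian f)"
  unfolding laplacian_def[abs_def]
  by (intro bounded_continuous_sum C1_disk_partial C2_disk_partial)

lemma disk_integral_sum:
  assumes "\<And>k. k \<in> A \<Longrightarrow> bounded_continuous (f k)"
  shows "(DINT x. (\<Sum>k\<in>A. f k x)) = (\<Sum>k\<in>A. DINT x. f k x)"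
  using assms
proof (induction A rule: infinite_finite_induct)
  case (insert a A)
  then have "(DINT x. (\<Sum>k\<in>insert a A. f k x)) = (DINT x. f a x + (\<Sum>k\<in>A. f k x))"
    by (intro disk_integral_cong) simp
  also have "\<dots> = (DINT x. f a x) + (DINT x. (\<Sum>k\<in>A. f k x))"
    using insert by (intro disk_integral_add bounded_continuous_sum) auto
  finally show ?case using insert by simp
qed (simp_all add: set_lebesgue_integral_def)

lemma disk_Cauchy_Schwarz_sum:
  assumes f: "\<And>k. k \<in> A \<Longrightarrow> bounded_continuous (f k)" and g: "\<And>k. k \<in> A \<Longrightarrow> bounded_continuous (g k)"
  shows "(\<Sum>k\<in>A. DINT x. f k x * g k x)\<^sup>2
    \<le> (\<Sum>k\<in>A. DINT x. (f k x)\<^sup>2) * (\<Sum>k\<in>A. DINT x. (g k x)\<^sup>2)"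
proof (rule quadratic_nonneg_discriminant)
  show "0 \<le> (\<Sum>k\<in>A. DINT x. (g k x)\<^sup>2)"
    by (intro sum_nonneg disk_integral_nonneg) simp
  fix l :: real
  note bc = bounded_continuous_intros f g
  have "(DINT x. (f k x + l * g k x)\<^sup>2) = (DINT x. (f k x)\<^sup>2)
      + (2 * l) * (DINT x. f k x * g k x) + l\<^sup>2 * (DINT x. (g k x)\<^sup>2)"
    if "k \<in> A" for k
  proof -
    have "(DINT x. (f k x + l * g k x)\<^sup>2)
        = (DINT x. (f k x)\<^sup>2 + ((2 * l) * (f k x * g k x) + l\<^sup>2 * (g k x)\<^sup>2))"
      by (rule disk_integral_cong) (simp add: power2_eq_square algebra_simps)
    also have "\<dots> = (DINT x. (f k x)\<^sup>2) + (2 * l) * (DINT x. f k x * g k x)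
        + l\<^sup>2 * (DINT x. (g k x)\<^sup>2)"
      by (subst disk_integral_add, (intro bc that)+, subst disk_integral_add, (intro bc that)+)
        (simp only: disk_integral_cmult add.assoc)
    finally show ?thesis .
  qed
  then have "(\<Sum>k\<in>A. DINT x. (f k x + l * g k x)\<^sup>2)
      = (\<Sum>k\<in>A. DINT x. (f k x)\<^sup>2) + 2 * (\<Sum>k\<in>A. DINT x. f k x * g k x) * l
      + (\<Sum>k\<in>A. DINT x. (g k x)\<^sup>2) * l\<^sup>2"
    by (simp add: sum.distrib sum_distrib_left sum_distrib_right mult_ac)
  moreover have "0 \<le> (\<Sum>k\<in>A. DINT x. (f k x + l * g k x)\<^sup>2)"
    by (intro sum_nonneg disk_integral_nonneg) simp
  ultimately show "0 \<le> (\<Sum>k\<in>A. DINT x. (f k x)\<^sup>2)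
      + 2 * (\<Sum>k\<in>A. DINT x. f k x * g k x) * l + (\<Sum>k\<in>A. DINT x. (g k x)\<^sup>2) * l\<^sup>2"
    by simp
qed

text \<open>
  Dominated convergence of the difference quotients; the mean value theorem bounds them by \<open>K\<close>.
\<close>

lemma disk_integral_has_derivative:
  fixes f f' :: "real \<Rightarrow> real^2 \<Rightarrow> real"
  assumes t0: "a < t0" "t0 < b"
    and bc: "\<And>t. a < t \<Longrightarrow> t < b \<Longrightarrow> bounded_continuous (f t)"
    and deriv: "\<And>t x. a < t \<Longrightarrow> t < b \<Longrightarrow> x \<in> disk \<Longrightarrow> ((\<lambda>\<tau>. f \<tau> x) has_real_derivative f' t x) (at t)"
    and bound: "\<And>t x. a < t \<Longrightarrow> t < b \<Longrightarrow> x \<in> disk \<Longrightarrow> \<bar>f' t x\<bar> \<le> K"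
    and bc': "bounded_continuous (f' t0)"
  shows "((\<lambda>t. DINT x. f t x) has_real_derivative (DINT x. f' t0 x)) (at t0)"
proof -
  let ?S = "{a<..<b}"
  have at: "at t0 within ?S = at t0" using t0 by (intro at_within_open) auto
  have K0: "K \<ge> 0" using bound[of t0 0] t0 by simp
  have "((\<lambda>t. ((DINT x. f t x) - (DINT x. f t0 x)) / (t - t0))
      \<longlongrightarrow> (DINT x. f' t0 x)) (at t0 within ?S)"
    unfolding tendsto_at_iff_sequentially
  proof (intro allI impI)
    fix X assume X: "\<forall>i. X i \<in> ?S - {t0}" and lim: "X \<longlonglongrightarrow> t0"
    define s where "s = (\<lambda>n. zero_extension (\<lambda>x. (f (X n) x - f t0 x) / (X n - t0)))"
    have bcs: "bounded_continuous (\<lambda>x. (f (X n) x - f t0 x) / (X n - t0))" for n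
      using bounded_continuous_mult[OF bounded_continuous_diff[OF bc[of "X n"] bc[of t0]] bounded_continuous_const[of "1 / (X n - t0)"]]
        X t0 by simp
    have eq: "((DINT x. f (X n) x) - (DINT x. f t0 x)) / (X n - t0) = (LINT x|lborel. s n x)" for n
    proof -
      have "(LINT x|lborel. s n x) = (DINT x. (f (X n) x - f t0 x) / (X n - t0))"
        by (simp only: s_def disk_integral_zero_extension)
      also have "\<dots> = (DINT x. f (X n) x - f t0 x) / (X n - t0)" by simp
      also have "(DINT x. f (X n) x - f t0 x) = (DINT x. f (X n) x) - (DINT x. f t0 x)"
        using X t0 by (intro disk_integral_diff bc) auto
      finally show ?thesis by simp
    qed
    have "(\<lambda>n. LINT x|lborel. s n x) \<longlonglongrightarrow> (LINT x|lborel. zero_extension (f' t0) x)"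
    proof (rule integral_dominated_convergence)
      show "zero_extension (f' t0) \<in> borel_measurable lborel"
        using zero_extension_measurable[OF bc'] by simp
      show "s n \<in> borel_measurable lborel" for n
        using zero_extension_integrable[OF bcs] unfolding s_def by (rule borel_measurable_integrable)
      show "integrable lborel (zero_extension (\<lambda>x. K))"
        by (intro zero_extension_integrable bounded_continuous_const)
      show "AE x in lborel. norm (s n x) \<le> zero_extension (\<lambda>x. K) x" for n
      proof (rule AE_I2)
        fix x :: "real^2"
        show "norm (s n x) \<le> zero_extension (\<lambda>x. K) x"
        proof (cases "x \<in> disk")
          case True
          have "norm (f (X n) x - f t0 x) \<le> K * norm (X n - t0)"
          proof (rule field_differentiable_bound[of ?S "\<lambda>\<tau>. f \<tau> x" "\<lambda>\<tau>. f' \<tau> x"])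
            show "((\<lambda>\<tau>. f \<tau> x) has_real_derivative f' z x) (at z within ?S)" if "z \<in> ?S" for z
              using deriv[of z x] that True by (auto intro: has_field_derivative_at_within)
          qed (use X t0 True bound in auto)
          moreover have "X n \<noteq> t0" using X by auto
          ultimately show ?thesis using True by (simp add: s_def zero_extension_def field_simps)
        qed (simp add: s_def zero_extension_def)
      qed
      show "AE x in lborel. (\<lambda>n. s n x) \<longlonglongrightarrow> zero_extension (f' t0) x"
      proof (rule AE_I2)
        fix x :: "real^2"
        show "(\<lambda>n. s n x) \<longlonglongrightarrow> zero_extension (f' t0) x"
        proof (cases "x \<in> disk")
          case True
          have "((\<lambda>\<tau>. f \<tau> x) has_real_derivative f' t0 x) (at t0 within ?S)"
            using deriv[of t0 x] t0 True by (auto intro: has_field_derivative_at_within)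
          then have "((\<lambda>t. (f t x - f t0 x) / (t - t0)) \<longlongrightarrow> f' t0 x) (at t0 within ?S)"
            by (simp add: has_field_derivative_iff)
          then have "((\<lambda>t. (f t x - f t0 x) / (t - t0)) \<circ> X) \<longlonglongrightarrow> f' t0 x"
            using X lim unfolding tendsto_at_iff_sequentially by blast
          then show ?thesis using True by (simp add: s_def zero_extension_def o_def)
        qed (simp add: s_def zero_extension_def)
      qed
    qed
    then show "((\<lambda>t. ((DINT x. f t x) - (DINT x. f t0 x)) / (t - t0)) \<circ> X)
        \<longlonglongrightarrow> (DINT x. f' t0 x)"
      unfolding o_def eq disk_integral_zero_extension[of "f' t0"] .
  qed
  then show ?thesis by (simp add: has_field_derivative_iff at)
qed

text \<open>
  The disk is convex, so a bounded gradient makes the function Lipschitz and thereby bounded. In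
  this way bounds for the pressure follow from bounds for its gradient.
\<close>

lemma C1_diskI_partials:
  assumes diff: "\<And>x. x \<in> disk \<Longrightarrow> f differentiable (at x)"
    and bc: "\<And>i. bounded_continuous (PD i f)"
  shows "C1_disk f"
proof -
  have "\<exists>K. \<forall>i. \<forall>x\<in>disk. \<bar>PD i f x\<bar> \<le> K"
  proof -
    obtain K1 where "\<And>x. x \<in> disk \<Longrightarrow> \<bar>PD 1 f x\<bar> \<le> K1" using bounded_continuousE[OF bc] by blast
    moreover obtain K2 where "\<And>x. x \<in> disk \<Longrightarrow> \<bar>PD 2 f x\<bar> \<le> K2" using bounded_continuousE[OF bc] by blast
    ultimately show ?thesis unfolding forall_2 by (meson max.coboundedI1 max.coboundedI2)
  qed
  then obtain K where K: "\<And>i x. x \<in> disk \<Longrightarrow> \<bar>PD i f x\<bar> \<le> K" by blast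
  have K0: "K \<ge> 0" using K[of 0] by (meson abs_ge_zero centre_in_ball order_trans zero_less_one)
  have "\<bar>f x\<bar> \<le> \<bar>f 0\<bar> + 2 * K" if x: "x \<in> disk" for x
  proof -
    have "norm (f x - f 0) \<le> (2 * K) * norm (x - 0)"
    proof (rule differentiable_bound[of disk f "\<lambda>x v. \<Sum>i\<in>UNIV. v $ i *\<^sub>R PD i f x"])
      fix y assume y: "y \<in> disk"
      show "(f has_derivative (\<lambda>v. \<Sum>i\<in>UNIV. v $ i *\<^sub>R PD i f y)) (at y within disk)"
        using has_derivative_partials[OF diff[OF y]] by (rule has_derivative_at_withinI)
      show "onorm (\<lambda>v. \<Sum>i\<in>UNIV. v $ i *\<^sub>R PD i f y) \<le> 2 * K"
      proof (rule onorm_bound)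
        fix v :: "real^2"
        have "\<bar>v $ i * PD i f y\<bar> \<le> norm v * K" for i
          unfolding abs_mult using K[OF y] component_le_norm_cart[of v i] by (intro mult_mono) auto
        from add_mono[OF this[of 1] this[of 2]]
        have "\<bar>v $ 1 * PD 1 f y + v $ 2 * PD 2 f y\<bar> \<le> norm v * K + norm v * K"
          using abs_triangle_ineq order_trans by blast
        then show "norm (\<Sum>i\<in>UNIV. v $ i *\<^sub>R PD i f y) \<le> 2 * K * norm v"
          by (simp add: sum_2 mult_ac)
      qed (use K0 in simp)
    qed (use x in auto)
    also have "\<dots> \<le> (2 * K) * 1" using x K0 by (intro mult_left_mono) auto
    finally show ?thesis by simp
  qed
  moreover have "continuous_on disk f"
    using diff by (meson continuous_at_imp_continuous_on differentiable_imp_continuous_within)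
  ultimately have "bounded_continuous f" by (intro bounded_continuousI) auto
  then show ?thesis using diff bc by (simp add: C1_disk_def)
qed

text \<open>
  The pressure and the transport by \<open>a\<close> do no work because \<open>v\<close> and \<open>a\<close> are divergence free and vanish
  on the circle. With \<open>a = v\<close> and \<open>r = 0\<close> this is the energy balance of a single flow; for the
  difference \<open>v\<close> of two flows \<open>u\<close> and \<open>a\<close> the remainder \<open>r\<close> is the advection of \<open>u\<close> by \<open>v\<close>.
\<close>

theorem disk_energy_identity:
  fixes v a :: "2 \<Rightarrow> real^2 \<Rightarrow> real"
  assumes v: "\<And>j. C2_disk (v j)" "\<And>j. vanishes_on_circle (v j)"
    and a: "\<And>j. C1_disk (a j)" "\<And>j. vanishes_on_circle (a j)"
    and div: "\<And>x. x \<in> disk \<Longrightarrow> (\<Sum>j\<in>UNIV. PD j (v j) x) = 0"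
      "\<And>x. x \<in> disk \<Longrightarrow> (\<Sum>j\<in>UNIV. PD j (a j) x) = 0"
    and q: "C1_disk q" and r: "\<And>j. bounded_continuous (r j)"
    and d: "\<And>j x. x \<in> disk \<Longrightarrow> d j x = \<nu> * laplacian (v j) x
      - PD j q x - (\<Sum>i\<in>UNIV. a i x * PD i (v j) x) - r j x"
  shows "(\<Sum>j\<in>UNIV. DINT x. v j x * d j x)
    = - \<nu> * (\<Sum>j\<in>UNIV. \<Sum>i\<in>UNIV. DINT x. (PD i (v j) x)\<^sup>2)
      - (\<Sum>j\<in>UNIV. DINT x. v j x * r j x)"
proof -
  have v1: "C1_disk (v j)" "C1_disk (PD i (v j))" for i j
    using v(1) by (auto intro: C2_disk_C1 C2_disk_partial)
  have bc: "bounded_continuous (v j)" "bounded_continuous (a j)" "bounded_continuous (PD i (v j))"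
    "bounded_continuous (PD i (a j))" "bounded_continuous (PD i (PD k (v j)))"
    "bounded_continuous q" "bounded_continuous (PD i q)" for i j k
    using v1 a(1) q by (auto intro: C1_disk_bounded_continuous C1_disk_partial)
  note bci = bounded_continuous_intros bounded_continuous_sum bc r
  \<comment> \<open>The inner products with viscosity, pressure, transport and remainder.\<close>
  have split: "(DINT x. v j x * d j x)
      = \<nu> * (\<Sum>i\<in>UNIV. DINT x. v j x * PD i (PD i (v j)) x)
        - (DINT x. v j x * PD j q x)
        - (DINT x. (\<Sum>i\<in>UNIV. a i x * (v j x * PD i (v j) x)))
        - (DINT x. v j x * r j x)" for j
  proof -
    have "(DINT x. v j x * d j x)
      = (DINT x. \<nu> * (\<Sum>i\<in>UNIV. v j x * PD i (PD i (v j)) x)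
        - v j x * PD j q x
        - (\<Sum>i\<in>UNIV. a i x * (v j x * PD i (v j) x)) - v j x * r j x)"
      by (rule disk_integral_cong) (simp add: d laplacian_def algebra_simps sum_distrib_left)
    also have "\<dots> = \<nu> * (DINT x. \<Sum>i\<in>UNIV. v j x * PD i (PD i (v j)) x)
        - (DINT x. v j x * PD j q x)
        - (DINT x. (\<Sum>i\<in>UNIV. a i x * (v j x * PD i (v j) x)))
        - (DINT x. v j x * r j x)"
      by (subst disk_integral_diff, (intro bci)+)+ (simp only: disk_integral_cmult)
    also have "(DINT x. \<Sum>i\<in>UNIV. v j x * PD i (PD i (v j)) x)
        = (\<Sum>i\<in>UNIV. DINT x. v j x * PD i (PD i (v j)) x)"
      by (rule disk_integral_sum) (intro bci)
    finally show ?thesis .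
  qed
  have viscous: "(DINT x. v j x * PD i (PD i (v j)) x)
      = - (DINT x. (PD i (v j) x)\<^sup>2)" for i j
    using integration_by_parts[OF v(2) v1(1) v1(2)] by (simp add: power2_eq_square)
  have pressure: "(\<Sum>j\<in>UNIV. DINT x. v j x * PD j q x) = 0"
  proof -
    have "(\<Sum>j\<in>UNIV. DINT x. v j x * PD j q x)
        = - (\<Sum>j\<in>UNIV. DINT x. PD j (v j) x * q x)"
      by (simp add: integration_by_parts[OF v(2) v1(1) q] sum_negf)
    also have "(\<Sum>j\<in>UNIV. DINT x. PD j (v j) x * q x)
        = (DINT x. \<Sum>j\<in>UNIV. PD j (v j) x * q x)"
      by (rule disk_integral_sum[symmetric]) (intro bci)
    also have "\<dots> = (DINT x. 0)"
      by (rule disk_integral_cong) (simp add: div sum_distrib_right[symmetric])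
    finally show ?thesis by simp
  qed
  have transport: "(\<Sum>j\<in>UNIV. DINT x. (\<Sum>i\<in>UNIV. a i x * (v j x * PD i (v j) x))) = 0"
  proof -
    have "(DINT x. (\<Sum>i\<in>UNIV. a i x * (v j x * PD i (v j) x))) = 0" for j
    proof -
      have C1: "C1_disk (\<lambda>x. v j x * v j x)" using v1 by (intro C1_disk_mult)
      have "(DINT x. (\<Sum>i\<in>UNIV. a i x * (v j x * PD i (v j) x)))
        = (DINT x. 1/2 * (\<Sum>i\<in>UNIV. a i x * PD i (\<lambda>x. v j x * v j x) x))"
        using v1 by (intro disk_integral_cong)
          (simp add: partial_deriv_mult C1_disk_differentiable sum_2 algebra_simps)
      also have "\<dots> = 1/2 * (DINT x. (\<Sum>i\<in>UNIV. a i x * PD i (\<lambda>x. v j x * v j x) x))"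
        by (rule disk_integral_cmult)
      also have "(DINT x. (\<Sum>i\<in>UNIV. a i x * PD i (\<lambda>x. v j x * v j x) x))
        = (\<Sum>i\<in>UNIV. DINT x. a i x * PD i (\<lambda>x. v j x * v j x) x)"
        by (rule disk_integral_sum) (intro bci C1_disk_partial[OF C1])
      also have "\<dots> = - (\<Sum>i\<in>UNIV. DINT x. PD i (a i) x * (v j x * v j x))"
        by (simp add: integration_by_parts[OF a(2) a(1) C1] sum_negf)
      also have "(\<Sum>i\<in>UNIV. DINT x. PD i (a i) x * (v j x * v j x))
        = (DINT x. \<Sum>i\<in>UNIV. PD i (a i) x * (v j x * v j x))"
        by (rule disk_integral_sum[symmetric]) (intro bci)
      also have "\<dots> = (DINT x. 0)"
        by (rule disk_integral_cong) (simp add: div sum_distrib_right[symmetric])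
      finally show ?thesis by simp
    qed
    then show ?thesis by simp
  qed
  show ?thesis
    unfolding split sum_subtractf pressure transport viscous
    by (simp add: sum_negf sum_distrib_left)
qed

text \<open>
  The planar product inequality is applied to \<open>|v|\<^sup>2\<close>, whose derivatives are controlled by
  \<open>2 |v| |\<partial>\<^sub>iv|\<close>. The dimension enters here.
\<close>

lemma disk_Ladyzhenskaya:
  fixes v :: "2 \<Rightarrow> real^2 \<Rightarrow> real"
  assumes v: "\<And>j. C1_disk (v j)" "\<And>j. vanishes_on_circle (v j)"
  shows "(DINT x. (\<Sum>j\<in>UNIV. (v j x)\<^sup>2)\<^sup>2)
    \<le> 2 * (\<Sum>j\<in>UNIV. DINT x. (v j x)\<^sup>2)
        * (\<Sum>j\<in>UNIV. \<Sum>i\<in>UNIV. DINT x. (PD i (v j) x)\<^sup>2)"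
proof -
  let ?b = "\<lambda>x. \<Sum>j\<in>UNIV. (v j x)\<^sup>2"
  define E where "E = (\<Sum>j\<in>UNIV. DINT x. (v j x)\<^sup>2)"
  define G where "G = (\<lambda>i. \<Sum>j\<in>UNIV. DINT x. (PD i (v j) x)\<^sup>2)"
  define S where "S = (\<lambda>i. \<Sum>j\<in>UNIV. DINT x. \<bar>v j x\<bar> * \<bar>PD i (v j) x\<bar>)"
  have bc: "bounded_continuous (v j)" "bounded_continuous (PD i (v j))" for i j
    using v(1) by (auto intro: C1_disk_bounded_continuous C1_disk_partial)
  note bci = bounded_continuous_intros bounded_continuous_sum bc
  have E0: "E \<ge> 0" unfolding E_def by (intro sum_nonneg disk_integral_nonneg) simp
  have G0: "G i \<ge> 0" for i unfolding G_def by (intro sum_nonneg disk_integral_nonneg) simp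
  have S0: "S i \<ge> 0" for i unfolding S_def by (intro sum_nonneg disk_integral_nonneg) simp
  have b_eq: "?b = (\<lambda>x. v 1 x * v 1 x + v 2 x * v 2 x)" by (simp add: sum_2 power2_eq_square)
  have C1b: "C1_disk ?b" unfolding b_eq using v(1) by (intro C1_disk_add C1_disk_mult)
  have vb: "vanishes_on_circle ?b"
    using v(2) unfolding vanishes_on_circle_def by (auto intro!: continuous_intros)
  have S: "(DINT x. \<bar>PD i ?b x\<bar>) \<le> 2 * S i" for i
  proof -
    have "(DINT x. \<bar>PD i ?b x\<bar>)
        \<le> (DINT x. 2 * (\<Sum>j\<in>UNIV. \<bar>v j x\<bar> * \<bar>PD i (v j) x\<bar>))"
    proof (rule disk_integral_mono)
      show "bounded_continuous (\<lambda>x. \<bar>PD i ?b x\<bar>)"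
        by (intro bounded_continuous_abs C1_disk_partial C1b)
      show "bounded_continuous (\<lambda>x. 2 * (\<Sum>j\<in>UNIV. \<bar>v j x\<bar> * \<bar>PD i (v j) x\<bar>))"
        by (intro bci)
      fix x :: "real^2" assume x: "x \<in> disk"
      have "PD i ?b x = 2 * (v 1 x * PD i (v 1) x) + 2 * (v 2 x * PD i (v 2) x)"
        unfolding b_eq using x v(1)
        by (simp add: partial_deriv_add partial_deriv_mult C1_disk_differentiable differentiable_mult)
      then show "\<bar>PD i ?b x\<bar> \<le> 2 * (\<Sum>j\<in>UNIV. \<bar>v j x\<bar> * \<bar>PD i (v j) x\<bar>)"
        using abs_triangle_ineq[of "2 * (v 1 x * PD i (v 1) x)" "2 * (v 2 x * PD i (v 2) x)"]
        by (simp add: sum_2 abs_mult)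
    qed
    also have "\<dots> = 2 * S i"
      unfolding S_def by (subst disk_integral_cmult, subst disk_integral_sum, (intro bci)+) simp
    finally show ?thesis .
  qed
  have S_sq: "(S i)\<^sup>2 \<le> E * G i" for i
    unfolding S_def E_def G_def
    using disk_Cauchy_Schwarz_sum[of UNIV "\<lambda>j x. \<bar>v j x\<bar>" "\<lambda>j x. \<bar>PD i (v j) x\<bar>"]
    by (simp add: bounded_continuous_abs bc)
  have "(S 1 * S 2)\<^sup>2 \<le> (E * G 1) * (E * G 2)"
    unfolding power_mult_distrib using S_sq E0 G0 by (intro mult_mono) auto
  also have "\<dots> \<le> (E * (G 1 + G 2) / 2)\<^sup>2"
  proof -
    have "0 \<le> E\<^sup>2 * (G 1 - G 2)\<^sup>2" by simp
    then show ?thesis by (simp add: power2_eq_square algebra_simps)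
  qed
  finally have SS: "S 1 * S 2 \<le> E * (G 1 + G 2) / 2"
    by (rule power2_le_imp_le) (use E0 G0 in \<open>auto intro!: mult_nonneg_nonneg add_nonneg_nonneg\<close>)
  have "(DINT x. (?b x)\<^sup>2)
      \<le> (DINT x. \<bar>PD 1 ?b x\<bar>) * (DINT x. \<bar>PD 2 ?b x\<bar>)"
    by (rule disk_square_integral_le[OF vb C1b])
  also have "\<dots> \<le> (2 * S 1) * (2 * S 2)"
    using S S0 by (intro mult_mono disk_integral_nonneg) auto
  also have "\<dots> \<le> 2 * E * (G 1 + G 2)" using SS by simp
  also have "G 1 + G 2 = (\<Sum>j\<in>UNIV. \<Sum>i\<in>UNIV. DINT x. (PD i (v j) x)\<^sup>2)"
    unfolding G_def by (simp add: sum_2)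
  finally show ?thesis unfolding E_def .
qed

text \<open>
  By Cauchy--Schwarz the square of the left-hand side is at most the integral of \<open>|v|\<^sup>4\<close> times that of
  \<open>|g|\<^sup>2\<close>. The weights in the arithmetic-geometric mean inequality are chosen such that the gradient
  of \<open>v\<close> gets the coefficient \<open>\<nu>\<close> and is absorbed by the viscous dissipation.
\<close>

lemma disk_trilinear_estimate:
  fixes v :: "2 \<Rightarrow> real^2 \<Rightarrow> real"
  assumes v: "\<And>j. C1_disk (v j)" "\<And>j. vanishes_on_circle (v j)"
    and g: "\<And>i j. bounded_continuous (g i j)" and \<nu>: "\<nu> > 0"
  shows "\<bar>\<Sum>j\<in>UNIV. DINT x. v j x * (\<Sum>i\<in>UNIV. v i x * g i j x)\<bar>
    \<le> \<nu> * (\<Sum>j\<in>UNIV. \<Sum>i\<in>UNIV. DINT x. (PD i (v j) x)\<^sup>2)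
      + 1 / (2 * \<nu>) * (\<Sum>j\<in>UNIV. DINT x. (v j x)\<^sup>2)
        * (\<Sum>j\<in>UNIV. \<Sum>i\<in>UNIV. DINT x. (g i j x)\<^sup>2)"
proof -
  define X where "X = (\<Sum>j\<in>UNIV. DINT x. v j x * (\<Sum>i\<in>UNIV. v i x * g i j x))"
  define E where "E = (\<Sum>j\<in>UNIV. DINT x. (v j x)\<^sup>2)"
  define G where "G = (\<Sum>j\<in>UNIV. \<Sum>i\<in>UNIV. DINT x. (PD i (v j) x)\<^sup>2)"
  define H where "H = (\<Sum>j\<in>UNIV. \<Sum>i\<in>UNIV. DINT x. (g i j x)\<^sup>2)"
  have nn: "E \<ge> 0" "G \<ge> 0" "H \<ge> 0"
    unfolding E_def G_def H_def by (intro sum_nonneg disk_integral_nonneg; simp)+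
  have bc: "bounded_continuous (v j)" for j using v(1) by (rule C1_disk_bounded_continuous)
  note bci = bounded_continuous_intros bounded_continuous_sum bc g
  have "X = (\<Sum>j\<in>UNIV. DINT x. \<Sum>i\<in>UNIV. (v i x * v j x) * g i j x)"
    unfolding X_def by (intro sum.cong refl disk_integral_cong) (simp add: sum_2 algebra_simps)
  also have "\<dots> = (\<Sum>j\<in>UNIV. \<Sum>i\<in>UNIV. DINT x. (v i x * v j x) * g i j x)"
    by (intro sum.cong refl disk_integral_sum bci)
  finally have X: "X = (\<Sum>(j,i)\<in>UNIV\<times>UNIV. DINT x. (v i x * v j x) * g i j x)"
    by (simp add: sum.cartesian_product)
  have "(\<Sum>(j,i)\<in>UNIV\<times>UNIV. DINT x. (v i x * v j x)\<^sup>2)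
      = (DINT x. (\<Sum>j\<in>UNIV. (v j x)\<^sup>2)\<^sup>2)"
  proof -
    have "(\<Sum>(j,i)\<in>UNIV\<times>UNIV. DINT x. (v i x * v j x)\<^sup>2)
        = (DINT x. \<Sum>k\<in>UNIV\<times>UNIV. (v (snd k) x * v (fst k) x)\<^sup>2)"
      by (subst disk_integral_sum) (auto simp: case_prod_beta intro!: bci)
    also have "\<dots> = (DINT x. (\<Sum>j\<in>UNIV. (v j x)\<^sup>2)\<^sup>2)"
    proof (rule disk_integral_cong)
      fix x :: "real^2"
      have "(\<Sum>k\<in>UNIV\<times>UNIV. (v (snd k) x * v (fst k) x)\<^sup>2) = (\<Sum>j\<in>UNIV. \<Sum>i\<in>UNIV. (v i x * v j x)\<^sup>2)"
        by (simp add: sum.cartesian_product case_prod_beta)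
      also have "\<dots> = (\<Sum>j\<in>UNIV. (v j x)\<^sup>2)\<^sup>2"
        by (simp add: sum_2 power2_eq_square algebra_simps)
      finally show "(\<Sum>k\<in>UNIV\<times>UNIV. (v (snd k) x * v (fst k) x)\<^sup>2) = (\<Sum>j\<in>UNIV. (v j x)\<^sup>2)\<^sup>2" .
    qed
    finally show ?thesis .
  qed
  then have B: "(\<Sum>(j,i)\<in>UNIV\<times>UNIV. DINT x. (v i x * v j x)\<^sup>2) \<le> 2 * E * G"
    using disk_Ladyzhenskaya[OF v] by (simp add: E_def G_def)
  have "X\<^sup>2 \<le> (\<Sum>(j,i)\<in>UNIV\<times>UNIV. DINT x. (v i x * v j x)\<^sup>2) * H"
    using disk_Cauchy_Schwarz_sum[of "UNIV \<times> UNIV" "\<lambda>k x. v (snd k) x * v (fst k) x" "\<lambda>k. g (snd k) (fst k)"]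
    by (simp add: X H_def sum.cartesian_product case_prod_beta bounded_continuous_mult bc g)
  also have "\<dots> \<le> (2 * E * G) * H" using B nn by (intro mult_right_mono)
  also have "\<dots> \<le> (\<nu> * G + 1 / (2 * \<nu>) * E * H)\<^sup>2"
  proof -
    have "0 \<le> (\<nu> * G - 1 / (2 * \<nu>) * E * H)\<^sup>2" by simp
    also have "\<dots> = (\<nu> * G + 1 / (2 * \<nu>) * E * H)\<^sup>2 - 2 * E * G * H"
      using \<nu> by (simp add: power2_eq_square field_simps)
    finally show ?thesis by simp
  qed
  finally have "X\<^sup>2 \<le> (\<nu> * G + 1 / (2 * \<nu>) * E * H)\<^sup>2" .
  moreover have "0 \<le> \<nu> * G + 1 / (2 * \<nu>) * E * H" using nn \<nu> by simp
  ultimately have "\<bar>X\<bar> \<le> \<nu> * G + 1 / (2 * \<nu>) * E * H"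
    using abs_le_square_iff[of X "\<nu> * G + 1 / (2 * \<nu>) * E * H"] by simp
  then show ?thesis unfolding X_def E_def G_def H_def .
qed

section \<open>Uniqueness of Navier--Stokes solutions\<close>

lemma extends_continuously_bounded:
  fixes f :: "real \<Rightarrow> real^2 \<Rightarrow> real^2"
  assumes "extends_continuously f"
  shows "t > 0 \<Longrightarrow> bounded_continuous (\<lambda>x. f t x $ j)"
    and "0 < a \<Longrightarrow> \<exists>K. \<forall>t\<in>{a..b}. \<forall>x\<in>disk. \<bar>f t x $ j\<bar> \<le> K"
proof -
  obtain g where g: "continuous_on ({0<..} \<times> closed_disk) g" "\<And>t x. t > 0 \<Longrightarrow> x \<in> disk \<Longrightarrow> g (t, x) = f t x"
    using assms unfolding extends_continuously_def by auto
  show "bounded_continuous (\<lambda>x. f t x $ j)" if t: "t > 0" for t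
  proof -
    have "continuous_on closed_disk (\<lambda>x. g (t, x) $ j)"
      using t by (intro continuous_intros continuous_on_compose2[OF g(1)]) auto
    then have "bounded_continuous (\<lambda>x. g (t, x) $ j)" by (rule bounded_continuous_closed)
    then show ?thesis
      using bounded_continuous_cong[of "\<lambda>x. g (t, x) $ j" "\<lambda>x. f t x $ j"] g(2)[OF t] by simp
  qed
  show "\<exists>K. \<forall>t\<in>{a..b}. \<forall>x\<in>disk. \<bar>f t x $ j\<bar> \<le> K" if a: "0 < a"
  proof -
    have "compact ((\<lambda>z. g z $ j) ` ({a..b} \<times> closed_disk))"
      using a by (intro compact_continuous_image continuous_intros continuous_on_subset[OF g(1)] compact_Times) auto
    from compact_imp_bounded[OF this]
    obtain K where "\<And>z. z \<in> {a..b} \<times> closed_disk \<Longrightarrow> \<bar>g z $ j\<bar> \<le> K"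
      unfolding bounded_iff by auto
    then have "\<bar>g (t, x) $ j\<bar> \<le> K" if "t \<in> {a..b}" "x \<in> disk" for t x
      using that by simp
    then have "\<bar>f t x $ j\<bar> \<le> K" if "t \<in> {a..b}" "x \<in> disk" for t x
      using g(2)[of t x] a that by fastforce
    then show ?thesis by blast
  qed
qed

lemma extends_continuously_cong:
  assumes "extends_continuously f" "\<And>t x. t > 0 \<Longrightarrow> x \<in> disk \<Longrightarrow> f t x = g t x"
  shows "extends_continuously g"
  using assms unfolding extends_continuously_def by metis

lemma extends_continuously_add:
  fixes f g :: "real \<Rightarrow> real^2 \<Rightarrow> 'a::real_normed_vector"
  assumes "extends_continuously f" "extends_continuously g"
  shows "extends_continuously (\<lambda>t x. f t x + g t x)"
proof -
  obtain F G where "continuous_on ({0<..} \<times> closed_disk) F" "\<forall>t>0. \<forall>x\<in>disk. F (t, x) = f t x"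
    "continuous_on ({0<..} \<times> closed_disk) G" "\<forall>t>0. \<forall>x\<in>disk. G (t, x) = g t x"
    using assms unfolding extends_continuously_def by auto
  then show ?thesis
    unfolding extends_continuously_def
    by (intro exI[of _ "\<lambda>z. F z + G z"] conjI continuous_on_add) simp_all
qed

lemma extends_continuously_linear:
  assumes "bounded_linear L" "extends_continuously f"
  shows "extends_continuously (\<lambda>t x. L (f t x))"
proof -
  obtain F where "continuous_on ({0<..} \<times> closed_disk) F" "\<forall>t>0. \<forall>x\<in>disk. F (t, x) = f t x"
    using assms unfolding extends_continuously_def by auto
  then show ?thesis
    unfolding extends_continuously_def
    by (intro exI[of _ "\<lambda>z. L (F z)"] conjI bounded_linear.continuous_on[OF assms(1)]) simp_all
qed

lemma extends_continuously_diff: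
  fixes f g :: "real \<Rightarrow> real^2 \<Rightarrow> 'a::real_normed_vector"
  assumes "extends_continuously f" "extends_continuously g"
  shows "extends_continuously (\<lambda>t x. f t x - g t x)"
  using extends_continuously_add[OF assms(1) extends_continuously_linear[OF bounded_linear_minus[OF bounded_linear_ident] assms(2)]]
  by simp

lemma regular_extends_continuously:
  "regular_for_positive_time u \<Longrightarrow> extends_continuously u"
  unfolding regular_for_positive_time_def extends_continuously_def
  by (intro exI[of _ "\<lambda>(t, x). u t x"]) auto

lemma regular_partials:
  assumes u: "regular_for_positive_time u" and t: "t > 0" and x: "x \<in> disk"
  shows "PD i (\<lambda>x. u t x $ j) x = PD i (u t) x $ j"
    and "PD i (PD k (\<lambda>x. u t x $ j)) x = PD i (PD k (u t)) x $ j"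
    and "(\<lambda>x. u t x $ j) differentiable (at x)"
    and "PD k (\<lambda>x. u t x $ j) differentiable (at x)"
proof -
  have d: "u t differentiable (at y)" "PD k (u t) differentiable (at y)" if "y \<in> disk" for y k
    using u t that by (auto simp: regular_for_positive_time_def)
  have 1: "PD i (\<lambda>x. u t x $ j) y = PD i (u t) y $ j" if "y \<in> disk" for y i
    using d[OF that] by (intro partial_deriv_component)
  show "PD i (\<lambda>x. u t x $ j) x = PD i (u t) x $ j" using x by (rule 1)
  have "PD i (PD k (\<lambda>x. u t x $ j)) x = PD i (\<lambda>y. PD k (u t) y $ j) x"
    using x 1 by (intro partial_deriv_cong[of disk]) auto
  also have "\<dots> = PD i (PD k (u t)) x $ j"
    using d[OF x] by (intro partial_deriv_component)
  finally show "PD i (PD k (\<lambda>x. u t x $ j)) x = PD i (PD k (u t)) x $ j" .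
  have comp: "(\<lambda>x. f x $ j) differentiable (at x)" if "f differentiable (at x)" for f :: "real^2 \<Rightarrow> real^2"
    using that bounded_linear.has_derivative[OF bounded_linear_vec_nth] unfolding differentiable_def by blast
  show "(\<lambda>x. u t x $ j) differentiable (at x)" using comp d[OF x] by blast
  have "(\<lambda>y. PD k (u t) y $ j) differentiable (at x)" using comp d[OF x] by blast
  then show "PD k (\<lambda>x. u t x $ j) differentiable (at x)"
    using x 1 differentiable_cong_open[of disk x "\<lambda>y. PD k (u t) y $ j"] by simp
qed

lemma regular_C2_disk:
  assumes u: "regular_for_positive_time u" and t: "t > 0"
  shows "C2_disk (\<lambda>x. u t x $ j)"
proof -
  have e1: "extends_continuously (\<lambda>t. PD i (u t))" for i
    using u by (auto simp: regular_for_positive_time_def)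
  have e2: "extends_continuously (\<lambda>t. PD i (PD k (u t)))" for i k
    using u by (auto simp: regular_for_positive_time_def)
  have "C1_disk (\<lambda>x. u t x $ j)"
  proof (rule C1_diskI_partials)
    show "bounded_continuous (PD i (\<lambda>x. u t x $ j))" for i
      using extends_continuously_bounded(1)[OF e1 t, of i j]
      by (subst bounded_continuous_cong[of _ "\<lambda>x. PD i (u t) x $ j"])
        (rule regular_partials(1)[OF u t])
  qed (rule regular_partials(3)[OF u t])
  moreover have "C1_disk (PD k (\<lambda>x. u t x $ j))" for k
  proof (rule C1_diskI_partials)
    show "bounded_continuous (PD i (PD k (\<lambda>x. u t x $ j)))" for i
      using extends_continuously_bounded(1)[OF e2 t, of i k j]
      by (subst bounded_continuous_cong[of _ "\<lambda>x. PD i (PD k (u t)) x $ j"])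
        (rule regular_partials(2)[OF u t])
  qed (rule regular_partials(4)[OF u t])
  ultimately show ?thesis by (simp add: C2_disk_def)
qed

lemma regular_time_deriv:
  assumes u: "regular_for_positive_time u" and t: "t > 0" and x: "x \<in> disk"
  shows "((\<lambda>\<tau>. u \<tau> x $ j) has_real_derivative time_deriv u t x $ j) (at t)"
proof -
  have "(\<lambda>\<tau>. u \<tau> x) differentiable (at t)"
    using u t x by (auto simp: regular_for_positive_time_def)
  then have "((\<lambda>\<tau>. u \<tau> x) has_vector_derivative time_deriv u t x) (at t)"
    by (simp add: time_deriv_def vector_derivative_works)
  from bounded_linear.has_vector_derivative[OF bounded_linear_vec_nth this]
  show ?thesis by (simp add: has_real_derivative_iff_has_vector_derivative)
qed

lemma solution_regular: "navier_stokes_solution \<nu> u\<^sub>0 u p \<Longrightarrow> regular_for_positive_time u"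
  by (simp add: navier_stokes_solution_def)

lemma solution_continuous:
  assumes "navier_stokes_solution \<nu> u\<^sub>0 u p" "t > 0"
  shows "continuous_on closed_disk (u t)"
proof -
  have "continuous_on ({0<..} \<times> closed_disk) (\<lambda>(t, x). u t x)"
    using assms by (auto simp: navier_stokes_solution_def regular_for_positive_time_def)
  then have "continuous_on closed_disk (\<lambda>x. case (t, x) of (t, x) \<Rightarrow> u t x)"
    by (rule continuous_on_compose2) (use assms(2) in \<open>auto intro!: continuous_intros\<close>)
  then show ?thesis by simp
qed

lemma solution_vanishing:
  assumes "navier_stokes_solution \<nu> u\<^sub>0 u p" "t > 0"
  shows "vanishes_on_circle (\<lambda>x. u t x $ j)"
  using assms continuous_on_component[OF solution_continuous[OF assms]]
  by (simp add: vanishes_on_circle_def navier_stokes_solution_def)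

lemma solution_components:
  assumes sol: "navier_stokes_solution \<nu> u\<^sub>0 u p" and t: "t > 0" and x: "x \<in> disk"
  shows "time_deriv u t x $ j = \<nu> * laplacian (\<lambda>x. u t x $ j) x
      - PD j (p t) x - (\<Sum>i\<in>UNIV. u t x $ i * PD i (\<lambda>x. u t x $ j) x)"
    and "(\<Sum>j\<in>UNIV. PD j (\<lambda>x. u t x $ j) x) = 0"
proof -
  note reg = solution_regular[OF sol]
  have "time_deriv u t x + advection (u t) (u t) x + gradient (p t) x = \<nu> *\<^sub>R laplacian (u t) x"
    and d: "divergence (u t) x = 0"
    using sol t x by (auto simp: navier_stokes_solution_def)
  then have "(time_deriv u t x + advection (u t) (u t) x + gradient (p t) x) $ j = (\<nu> *\<^sub>R laplacian (u t) x) $ j"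
    by simp
  then show "time_deriv u t x $ j = \<nu> * laplacian (\<lambda>x. u t x $ j) x
      - PD j (p t) x - (\<Sum>i\<in>UNIV. u t x $ i * PD i (\<lambda>x. u t x $ j) x)"
    by (simp add: advection_def gradient_def laplacian_def regular_partials[OF reg t x] algebra_simps)
  show "(\<Sum>j\<in>UNIV. PD j (\<lambda>x. u t x $ j) x) = 0"
    using d by (simp add: divergence_def regular_partials[OF reg t x])
qed

lemma solution_time_deriv_bounded:
  assumes "navier_stokes_solution \<nu> u\<^sub>0 u p" "t > 0"
  shows "bounded_continuous (\<lambda>x. time_deriv u t x $ j)"
  using solution_regular[OF assms(1)] assms(2) extends_continuously_bounded(1)
  by (auto simp: regular_for_positive_time_def)

text \<open>
  The momentum equation expresses the pressure gradient by bounded quantities.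
\<close>

lemma solution_pressure_C1:
  assumes sol: "navier_stokes_solution \<nu> u\<^sub>0 u p" and t: "t > 0"
  shows "C1_disk (p t)"
proof (rule C1_diskI_partials)
  show "p t differentiable (at x)" if "x \<in> disk" for x
    using sol t that by (auto simp: navier_stokes_solution_def)
  fix j
  note C2 = regular_C2_disk[OF solution_regular[OF sol] t]
  let ?f = "\<lambda>x. \<nu> * laplacian (\<lambda>x. u t x $ j) x
      - time_deriv u t x $ j - (\<Sum>i\<in>UNIV. u t x $ i * PD i (\<lambda>x. u t x $ j) x)"
  have "bounded_continuous ?f"
    by (intro bounded_continuous_intros bounded_continuous_sum C2_disk_laplacian C1_disk_partial
        C1_disk_bounded_continuous C2_disk_C1 C2 solution_time_deriv_bounded[OF sol t])
  moreover have "PD j (p t) x = ?f x" if "x \<in> disk" for x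
    using solution_components(1)[OF sol t that, of j] by simp
  ultimately show "bounded_continuous (PD j (p t))"
    using bounded_continuous_cong[of "PD j (p t)" ?f] by blast
qed

lemma kinetic_energy_has_derivative:
  fixes v v' :: "real \<Rightarrow> real^2 \<Rightarrow> real^2"
  assumes ext: "extends_continuously v" "extends_continuously v'"
    and deriv: "\<And>t x j. t > 0 \<Longrightarrow> x \<in> disk \<Longrightarrow> ((\<lambda>\<tau>. v \<tau> x $ j) has_real_derivative v' t x $ j) (at t)"
    and t: "t > 0"
  shows "((\<lambda>t. \<Sum>j\<in>UNIV. DINT x. (v t x $ j)\<^sup>2) has_real_derivative
    2 * (\<Sum>j\<in>UNIV. DINT x. v t x $ j * v' t x $ j)) (at t)"
  unfolding sum_distrib_left
proof (rule DERIV_sum)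
  fix j
  note bc = extends_continuously_bounded(1)[OF ext(1)] extends_continuously_bounded(1)[OF ext(2)]
  have t2: "0 < t / 2" using t by simp
  obtain K where K: "\<And>s x. s \<in> {t/2..2*t} \<Longrightarrow> x \<in> disk \<Longrightarrow> \<bar>v s x $ j\<bar> \<le> K"
    using extends_continuously_bounded(2)[OF ext(1) t2] by blast
  obtain L where L: "\<And>s x. s \<in> {t/2..2*t} \<Longrightarrow> x \<in> disk \<Longrightarrow> \<bar>v' s x $ j\<bar> \<le> L"
    using extends_continuously_bounded(2)[OF ext(2) t2] by blast
  have "((\<lambda>t. DINT x. (v t x $ j)\<^sup>2) has_real_derivative
      (DINT x. 2 * (v t x $ j * v' t x $ j))) (at t)"
  proof (rule disk_integral_has_derivative[of "t/2" t "2*t" _ _ "2 * (K * L)"])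
    fix s x assume s: "t / 2 < s" "s < 2 * t"
    then have "s > 0" using t by simp
    then show "bounded_continuous (\<lambda>x. (v s x $ j)\<^sup>2)" by (intro bounded_continuous_power bc)
    assume x: "x \<in> disk"
    show "((\<lambda>\<tau>. (v \<tau> x $ j)\<^sup>2) has_real_derivative 2 * (v s x $ j * v' s x $ j)) (at s)"
      using DERIV_power[OF deriv[OF \<open>s > 0\<close> x], of j 2] by (simp add: mult_ac)
    show "\<bar>2 * (v s x $ j * v' s x $ j)\<bar> \<le> 2 * (K * L)"
      using K[of s x] L[of s x] s x mult_mono[of "\<bar>v s x $ j\<bar>" K "\<bar>v' s x $ j\<bar>" L] by (simp add: abs_mult)
  next
    show "bounded_continuous (\<lambda>x. 2 * (v t x $ j * v' t x $ j))"
      using t by (intro bounded_continuous_intros bc)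
  qed (use t in auto)
  then show "((\<lambda>t. DINT x. (v t x $ j)\<^sup>2) has_real_derivative
      2 * (DINT x. v t x $ j * v' t x $ j)) (at t)" by simp
qed

text \<open>
  A Gronwall argument without integration in time. The growth rate of the energy \<open>E\<close> of the
  difference is a multiple of the dissipation \<open>G\<close> of one solution, and \<open>G\<close> is the rate of decrease of
  the energy \<open>F\<close> of that solution. The integrating factor can therefore be written as
  \<open>exp (F / (2 \<nu>\<^sup>2))\<close>, which stays bounded as time tends to 0.
\<close>

theorem navier_stokes_unique:
  assumes \<nu>: "\<nu> > 0" and u0: "continuous_on closed_disk u\<^sub>0"
    and u: "navier_stokes_solution \<nu> u\<^sub>0 u p" and w: "navier_stokes_solution \<nu> u\<^sub>0 w q"
    and t: "t > 0" and x: "x \<in> disk"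
  shows "u t x = w t x"
proof -
  note regu = solution_regular[OF u] and regw = solution_regular[OF w]
  note C2u = regular_C2_disk[OF regu] and C2w = regular_C2_disk[OF regw]
  define v where "v = (\<lambda>t j x. u t x $ j - w t x $ j)"
  define v' where "v' = (\<lambda>t j x. time_deriv u t x $ j - time_deriv w t x $ j)"
  define E where "E = (\<lambda>t. \<Sum>j\<in>UNIV. DINT x. (v t j x)\<^sup>2)"
  define F where "F = (\<lambda>t. \<Sum>j\<in>UNIV. DINT x. (u t x $ j)\<^sup>2)"
  define G where "G = (\<lambda>t. \<Sum>j\<in>UNIV. \<Sum>i\<in>UNIV. DINT x. (PD i (\<lambda>x. u t x $ j) x)\<^sup>2)"
  define H where "H = (\<lambda>t. \<Sum>j\<in>UNIV. \<Sum>i\<in>UNIV. DINT x. (PD i (v t j) x)\<^sup>2)"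
  have C2v: "C2_disk (v t j)" if "t > 0" for t j
    unfolding v_def by (rule C2_disk_diff(1)[OF C2u[OF that] C2w[OF that]])
  have pv: "PD i (v t j) x = PD i (\<lambda>x. u t x $ j) x - PD i (\<lambda>x. w t x $ j) x"
    and ppv: "PD i (PD k (v t j)) x = PD i (PD k (\<lambda>x. u t x $ j)) x
      - PD i (PD k (\<lambda>x. w t x $ j)) x"
    if "t > 0" "x \<in> disk" for t i j k x
    unfolding v_def by (rule C2_disk_diff(2,3)[OF C2u[OF that(1)] C2w[OF that(1)] that(2)])+
  have vv: "vanishes_on_circle (v t j)" if "t > 0" for t j
    using solution_vanishing[OF u that, of j] solution_vanishing[OF w that, of j]
    unfolding v_def vanishes_on_circle_def by (auto intro!: continuous_intros)
  have nn: "E t \<ge> 0" "G t \<ge> 0" "H t \<ge> 0" for t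
    unfolding E_def G_def H_def by (intro sum_nonneg disk_integral_nonneg; simp)+
  have ext: "extends_continuously u" "extends_continuously (time_deriv u)"
    "extends_continuously w" "extends_continuously (time_deriv w)"
    using regu regw by (simp_all add: regular_extends_continuously) (simp_all add: regular_for_positive_time_def)
  have F': "(F has_real_derivative - 2 * \<nu> * G t) (at t)" if t: "t > 0" for t
  proof -
    have "(F has_real_derivative 2 * (\<Sum>j\<in>UNIV. DINT x. u t x $ j * time_deriv u t x $ j)) (at t)"
      unfolding F_def by (intro kinetic_energy_has_derivative ext(1,2) regular_time_deriv[OF regu] t)
    moreover have "(\<Sum>j\<in>UNIV. DINT x. u t x $ j * time_deriv u t x $ j)
        = - \<nu> * G t - (\<Sum>j\<in>UNIV. DINT x. u t x $ j * 0)"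
      unfolding G_def
      by (rule disk_energy_identity[where a = "\<lambda>j x. u t x $ j" and q = "p t"])
        (use t u C2u in \<open>auto intro: solution_vanishing C2_disk_C1 solution_pressure_C1
          bounded_continuous_const simp: solution_components[OF u]\<close>)
    ultimately show ?thesis by (simp add: mult.assoc)
  qed
  have E': "\<exists>D. (E has_real_derivative D) (at t) \<and> D \<le> 1 / \<nu> * E t * G t" if t: "t > 0" for t
  proof (intro exI conjI)
    let ?I = "\<Sum>j\<in>UNIV. DINT x. v t j x * v' t j x"
    let ?X = "\<Sum>j\<in>UNIV. DINT x. v t j x * (\<Sum>i\<in>UNIV. v t i x * PD i (\<lambda>x. u t x $ j) x)"
    have "((\<lambda>t. \<Sum>j\<in>UNIV. DINT x. ((u t x - w t x) $ j)\<^sup>2) has_real_derivative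
        2 * (\<Sum>j\<in>UNIV. DINT x. (u t x - w t x) $ j * (time_deriv u t x - time_deriv w t x) $ j)) (at t)"
    proof (intro kinetic_energy_has_derivative extends_continuously_diff ext t)
      show "((\<lambda>\<tau>. (u \<tau> x - w \<tau> x) $ j) has_real_derivative (time_deriv u t x - time_deriv w t x) $ j) (at t)"
        if "t > 0" "x \<in> disk" for t j x
        using DERIV_diff[OF regular_time_deriv[OF regu that] regular_time_deriv[OF regw that]] by simp
    qed
    then show "(E has_real_derivative 2 * ?I) (at t)" by (simp add: E_def[abs_def] v_def v'_def)
    have "?I = - \<nu> * H t - ?X"
      unfolding H_def
    proof (rule disk_energy_identity[where a = "\<lambda>j x. w t x $ j" and q = "\<lambda>x. p t x - q t x"])
      show "C1_disk (\<lambda>x. p t x - q t x)"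
        using t by (intro C1_disk_diff solution_pressure_C1[OF u] solution_pressure_C1[OF w])
      show "bounded_continuous (\<lambda>x. \<Sum>i\<in>UNIV. v t i x * PD i (\<lambda>x. u t x $ j) x)" for j
        using t by (intro bounded_continuous_sum bounded_continuous_mult C1_disk_partial C1_disk_bounded_continuous C2_disk_C1 C2v C2u)
      fix x :: "real^2" assume x: "x \<in> disk"
      show "(\<Sum>j\<in>UNIV. PD j (v t j) x) = 0"
        using solution_components(2)[OF u t x] solution_components(2)[OF w t x]
        by (simp add: pv[OF t x] sum_subtractf)
      show "(\<Sum>j\<in>UNIV. PD j (\<lambda>x. w t x $ j) x) = 0"
        by (rule solution_components(2)[OF w t x])
      fix j
      have "PD j (\<lambda>x. p t x - q t x) x = PD j (p t) x - PD j (q t) x"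
        using t x by (intro partial_deriv_diff C1_disk_differentiable solution_pressure_C1[OF u] solution_pressure_C1[OF w])
      then show "v' t j x = \<nu> * laplacian (v t j) x
          - PD j (\<lambda>x. p t x - q t x) x - (\<Sum>i\<in>UNIV. w t x $ i * PD i (v t j) x)
          - (\<Sum>i\<in>UNIV. v t i x * PD i (\<lambda>x. u t x $ j) x)"
        by (simp add: v'_def solution_components(1)[OF u t x] solution_components(1)[OF w t x]
            pv[OF t x] ppv[OF t x] laplacian_def sum_2 algebra_simps) (simp add: v_def algebra_simps)
    qed (use t in \<open>auto intro: C2v vv C2_disk_C1 C2w solution_vanishing[OF w]\<close>)
    moreover have "\<bar>?X\<bar> \<le> \<nu> * H t + 1 / (2 * \<nu>) * E t * G t"
      unfolding H_def E_def G_def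
      using t by (intro disk_trilinear_estimate \<nu> vv C2_disk_C1 C2v C1_disk_partial C2u)
    ultimately have "2 * ?I \<le> 2 * (1 / (2 * \<nu>) * E t * G t)" by linarith
    then show "2 * ?I \<le> 1 / \<nu> * E t * G t" by simp
  qed
  \<comment> \<open>The derivative of \<open>F / (2 \<nu>\<^sup>2)\<close> is \<open>- G / \<nu>\<close>, which cancels the growth rate of \<open>E\<close>.\<close>
  define \<Lambda> where "\<Lambda> = (\<lambda>t. E t * exp (F t / (2 * \<nu>\<^sup>2)))"
  have mono: "\<Lambda> t \<le> \<Lambda> s" if s: "0 < s" "s \<le> t" for s t
  proof (rule DERIV_nonpos_imp_nonincreasing[OF s(2)])
    fix r assume "s \<le> r" "r \<le> t"
    then have r: "r > 0" using s by simp
    obtain D where D: "(E has_real_derivative D) (at r)" "D \<le> 1 / \<nu> * E r * G r" using E'[OF r] by blast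
    have "(\<Lambda> has_real_derivative D * exp (F r / (2 * \<nu>\<^sup>2))
        + (exp (F r / (2 * \<nu>\<^sup>2)) * ((- 2 * \<nu> * G r) / (2 * \<nu>\<^sup>2))) * E r) (at r)"
      unfolding \<Lambda>_def by (intro DERIV_mult' DERIV_mult D DERIV_fun_exp DERIV_cdivide F' r)
    moreover have "D * exp (F r / (2 * \<nu>\<^sup>2)) + (exp (F r / (2 * \<nu>\<^sup>2)) * ((- 2 * \<nu> * G r) / (2 * \<nu>\<^sup>2))) * E r
        = exp (F r / (2 * \<nu>\<^sup>2)) * (D - 1 / \<nu> * E r * G r)"
      using \<nu> by (simp add: field_simps power2_eq_square)
    moreover have "\<dots> \<le> 0" using D(2) by (intro mult_nonneg_nonpos) auto
    ultimately show "\<exists>y. (\<Lambda> has_real_derivative y) (at r) \<and> y \<le> 0" by metis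
  qed
  have bc0: "bounded_continuous (\<lambda>x. u\<^sub>0 x $ j)" for j
    using u0 by (intro bounded_continuous_closed continuous_intros)
  define N where "N = (\<lambda>f (t::real). DINT x. (norm (f t x - u\<^sub>0 x))\<^sup>2)"
  have N: "N f t = (\<Sum>j\<in>UNIV. DINT x. (f t x $ j - u\<^sub>0 x $ j)\<^sup>2)"
    if "\<And>j. bounded_continuous (\<lambda>x. f t x $ j)" for f :: "real \<Rightarrow> real^2 \<Rightarrow> real^2" and t
  proof -
    have "N f t = (DINT x. \<Sum>j\<in>UNIV. (f t x $ j - u\<^sub>0 x $ j)\<^sup>2)"
      unfolding N_def by (intro disk_integral_cong) (simp add: norm_vec_def L2_set_def sum_nonneg)
    also have "\<dots> = (\<Sum>j\<in>UNIV. DINT x. (f t x $ j - u\<^sub>0 x $ j)\<^sup>2)"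
      by (intro disk_integral_sum bounded_continuous_power bounded_continuous_diff that bc0)
    finally show ?thesis .
  qed
  have square_split: "(DINT x. (f x + g x)\<^sup>2) \<le> 2 * (DINT x. (f x)\<^sup>2) + 2 * (DINT x. (g x)\<^sup>2)"
    if "bounded_continuous f" "bounded_continuous g" for f g
  proof -
    have "(DINT x. (f x + g x)\<^sup>2) \<le> (DINT x. 2 * (f x)\<^sup>2 + 2 * (g x)\<^sup>2)"
    proof (rule disk_integral_mono)
      fix x show "(f x + g x)\<^sup>2 \<le> 2 * (f x)\<^sup>2 + 2 * (g x)\<^sup>2"
        using sum_squares_bound[of "f x" "g x"] by (simp add: power2_sum)
    qed (intro bounded_continuous_intros that)+
    also have "\<dots> = 2 * (DINT x. (f x)\<^sup>2) + 2 * (DINT x. (g x)\<^sup>2)"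
      by (subst disk_integral_add, (intro bounded_continuous_intros that)+) (simp only: disk_integral_cmult)
    finally show ?thesis .
  qed
  define C where "C = (\<Sum>j\<in>UNIV. DINT x. (u\<^sub>0 x $ j)\<^sup>2)"
  have bcu: "bounded_continuous (\<lambda>x. u t x $ j)" and bcw: "bounded_continuous (\<lambda>x. w t x $ j)" if "t > 0" for t j
    using that by (auto intro: C1_disk_bounded_continuous C2_disk_C1 C2u C2w)
  \<comment> \<open>Both solutions are close to \<open>u\<^sub>0\<close> in \<open>L\<^sup>2\<close> for small times.\<close>
  have E_le: "E t \<le> 2 * N u t + 2 * N w t" if t: "t > 0" for t
  proof -
    have "(DINT x. (v t j x)\<^sup>2) \<le> 2 * (DINT x. (u t x $ j - u\<^sub>0 x $ j)\<^sup>2)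
        + 2 * (DINT x. (w t x $ j - u\<^sub>0 x $ j)\<^sup>2)" for j
      using square_split[OF bounded_continuous_diff[OF bcu[OF t, of j] bc0[of j]] bounded_continuous_diff[OF bc0[of j] bcw[OF t, of j]]]
      by (simp add: v_def power2_commute[of "u\<^sub>0 _ $ j"])
    then show ?thesis
      unfolding E_def N[of u t, OF bcu[OF t]] N[of w t, OF bcw[OF t]] sum_distrib_left sum.distrib[symmetric]
      by (intro sum_mono)
  qed
  have F_le: "F t \<le> 2 * N u t + 2 * C" if t: "t > 0" for t
  proof -
    have "(DINT x. (u t x $ j)\<^sup>2) \<le> 2 * (DINT x. (u t x $ j - u\<^sub>0 x $ j)\<^sup>2)
        + 2 * (DINT x. (u\<^sub>0 x $ j)\<^sup>2)" for j
      using square_split[OF bounded_continuous_diff[OF bcu[OF t, of j] bc0[of j]] bc0[of j]] by simp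
    then show ?thesis
      unfolding F_def N[of u t, OF bcu[OF t]] C_def sum_distrib_left sum.distrib[symmetric]
      by (intro sum_mono)
  qed
  have "\<Lambda> t \<le> 0"
  proof (rule tendsto_lowerbound)
    have "((\<lambda>s. N u s) \<longlongrightarrow> 0) (at_right 0)" "((\<lambda>s. N w s) \<longlongrightarrow> 0) (at_right 0)"
      using u w by (auto simp: navier_stokes_solution_def N_def)
    then have "((\<lambda>s. (2 * N u s + 2 * N w s) * exp ((2 * N u s + 2 * C) / (2 * \<nu>\<^sup>2))) \<longlongrightarrow>
        (2 * 0 + 2 * 0) * exp ((2 * 0 + 2 * C) / (2 * \<nu>\<^sup>2))) (at_right 0)"
      using \<nu> by (intro tendsto_intros) auto
    then show "((\<lambda>s. (2 * N u s + 2 * N w s) * exp ((2 * N u s + 2 * C) / (2 * \<nu>\<^sup>2))) \<longlongrightarrow> 0) (at_right 0)"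
      by simp
    have "\<forall>\<^sub>F s in at_right 0. s \<in> {0<..<t}" using t by (rule eventually_at_right_real)
    then show "\<forall>\<^sub>F s in at_right 0. \<Lambda> t \<le> (2 * N u s + 2 * N w s) * exp ((2 * N u s + 2 * C) / (2 * \<nu>\<^sup>2))"
    proof eventually_elim
      case (elim s)
      then have s: "0 < s" "s \<le> t" by auto
      have "\<Lambda> t \<le> \<Lambda> s" by (rule mono[OF s])
      also have "\<Lambda> s \<le> (2 * N u s + 2 * N w s) * exp ((2 * N u s + 2 * C) / (2 * \<nu>\<^sup>2))"
        unfolding \<Lambda>_def
        using E_le[OF s(1)] F_le[OF s(1)] nn(1)[of s] by (intro mult_mono) (auto intro!: divide_right_mono)
      finally show ?case .
    qed
  qed auto
  then have E0: "E t \<le> 0" unfolding \<Lambda>_def by (simp add: mult_le_0_iff)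
  have "v t j x = 0" for j
  proof -
    have "(DINT x. (v t j x)\<^sup>2) \<le> E t"
      unfolding E_def by (rule member_le_sum) (auto intro: disk_integral_nonneg)
    then have "(v t j x)\<^sup>2 = 0"
      using E0 C2v[OF t, of j] by (intro disk_integral_zero_imp[OF _ _ _ x])
        (auto intro: bounded_continuous_power C1_disk_bounded_continuous C2_disk_C1)
    then show ?thesis by simp
  qed
  then show ?thesis by (simp add: v_def vec_eq_iff)
qed

section \<open>Rotations\<close>

lemma perp_simps: "perp x $ 1 = - x $ 2" "perp x $ 2 = x $ 1"
  by (simp_all add: perp_def)

lemma vec2_eq_iff: "(x = y) \<longleftrightarrow> x $ 1 = y $ 1 \<and> x $ 2 = (y :: real^2) $ 2"
  by (simp add: vec_eq_iff forall_2)

text \<open>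
  For \<open>a\<^sup>2 + b\<^sup>2 = 1\<close> these are the rotations about the origin, and \<open>rotation a (- b)\<close> is the inverse.
  Angles are needed only where a derivative along a circle is taken.
\<close>

definition rotation :: "real \<Rightarrow> real \<Rightarrow> real^2 \<Rightarrow> real^2" where
  "rotation a b x = a *\<^sub>R x + b *\<^sub>R perp x"

lemma rotation_nth: "rotation a b x $ 1 = a * x $ 1 - b * x $ 2" "rotation a b x $ 2 = a * x $ 2 + b * x $ 1"
  by (simp_all add: rotation_def perp_simps)

lemma bounded_linear_perp: "bounded_linear perp"
proof -
  have "linear perp" by (rule linearI) (simp_all add: vec2_eq_iff perp_simps)
  then show ?thesis by (simp add: linear_conv_bounded_linear)
qed

lemma bounded_linear_rotation: "bounded_linear (rotation a b)"
  unfolding rotation_def[abs_def]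
  by (intro bounded_linear_add bounded_linear_const_scaleR bounded_linear_ident bounded_linear_perp)

lemma norm_square_vec2: "(norm (x :: real^2))\<^sup>2 = (x $ 1)\<^sup>2 + (x $ 2)\<^sup>2"
  by (simp add: norm_vec_def L2_set_def sum_2)

lemma norm_rotation:
  assumes "a\<^sup>2 + b\<^sup>2 = 1" shows "norm (rotation a b x) = norm x"
proof -
  have "(norm (rotation a b x))\<^sup>2 = (a\<^sup>2 + b\<^sup>2) * (norm x)\<^sup>2"
    unfolding norm_square_vec2 rotation_nth by (simp add: power2_eq_square algebra_simps)
  then show ?thesis using assms by (simp add: power2_eq_iff_nonneg)
qed

lemma rotation_inverse:
  assumes "a\<^sup>2 + b\<^sup>2 = 1" shows "rotation a b (rotation a (-b) x) = x" "rotation a (-b) (rotation a b x) = x"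
proof -
  have *: "a * (a * y) + b * (b * y) = y" for y
    using assms by (simp add: power2_eq_square mult.assoc[symmetric] distrib_right[symmetric])
  show "rotation a b (rotation a (-b) x) = x" "rotation a (-b) (rotation a b x) = x"
    using *[of "x $ 1"] *[of "x $ 2"] by (simp_all add: vec2_eq_iff rotation_nth algebra_simps)
qed

lemma rotation_in_disk:
  assumes "a\<^sup>2 + b\<^sup>2 = 1"
  shows "rotation a b x \<in> disk \<longleftrightarrow> x \<in> disk" "rotation a b x \<in> closed_disk \<longleftrightarrow> x \<in> closed_disk"
  using assms by (simp_all add: norm_rotation)

lemma lborel_rotation:
  assumes ab: "a\<^sup>2 + b\<^sup>2 = 1"
  shows "lborel = distr lborel borel (rotation a b)"
proof (rule lborel_eqI)
  fix l u :: "real^2" assume le: "\<And>i. i \<in> Basis \<Longrightarrow> l \<bullet> i \<le> u \<bullet> i"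
  have [measurable]: "rotation a b \<in> borel_measurable borel"
    using bounded_linear_rotation by (intro borel_measurable_continuous_onI linear_continuous_on)
  have orth: "orthogonal_transformation (rotation a (-b))"
    using ab bounded_linear.linear[OF bounded_linear_rotation]
    by (simp add: orthogonal_transformation norm_rotation)
  have pre: "rotation a b -` box l u = rotation a (-b) ` box l u"
    using rotation_inverse[OF ab] by (auto simp: image_iff) metis
  have "emeasure (distr lborel borel (rotation a b)) (box l u) = emeasure lborel (rotation a (-b) ` box l u)"
    by (simp add: emeasure_distr pre)
  also have "\<dots> = emeasure lebesgue (rotation a (-b) ` box l u)"
  proof -
    have "rotation a (-b) ` box l u \<in> sets borel"
      unfolding pre[symmetric] using measurable_sets[of "rotation a b" borel borel "box l u"] by simp
    then show ?thesis by simp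
  qed
  also have "\<dots> = ennreal (measure lebesgue (rotation a (-b) ` box l u))"
    by (intro emeasure_eq_measure2 measurable_orthogonal_image orth) auto
  also have "\<dots> = ennreal (measure lebesgue (box l u))"
    by (simp add: measure_orthogonal_image orth)
  also have "\<dots> = emeasure lborel (box l u)"
    using le by (simp add: emeasure_lborel_box measure_def)
  finally show "emeasure (distr lborel borel (rotation a b)) (box l u) = ennreal (\<Prod>i\<in>Basis. (u - l) \<bullet> i)"
    using le by (simp add: emeasure_lborel_box)
qed simp

lemma disk_integral_rotation:
  assumes ab: "a\<^sup>2 + b\<^sup>2 = 1" and f: "bounded_continuous f"
  shows "(DINT x. f (rotation a b x)) = (DINT x. f x)"
proof -
  have [measurable]: "rotation a b \<in> borel_measurable borel"
    using bounded_linear_rotation by (intro borel_measurable_continuous_onI linear_continuous_on)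
  have m [measurable]: "zero_extension f \<in> borel_measurable borel"
    by (rule zero_extension_measurable[OF f])
  have "(DINT x. f x) = (LINT x|distr lborel borel (rotation a b). zero_extension f x)"
    by (simp only: disk_integral_zero_extension lborel_rotation[OF ab, symmetric])
  also have "\<dots> = (LINT x|lborel. zero_extension f (rotation a b x))"
    by (rule integral_distr) auto
  also have "(\<lambda>x. zero_extension f (rotation a b x)) = zero_extension (\<lambda>x. f (rotation a b x))"
    using ab by (auto simp: zero_extension_def fun_eq_iff indicator_def norm_rotation)
  finally show ?thesis by (simp only: disk_integral_zero_extension)
qed

lemma partial_deriv_rotation:
  fixes f :: "real^2 \<Rightarrow> 'a::real_normed_vector"
  assumes "f differentiable (at (rotation a b x))"
  shows "PD i (\<lambda>x. f (rotation a b x)) x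
      = (\<Sum>k\<in>UNIV. rotation a b (axis i 1) $ k *\<^sub>R PD k f (rotation a b x))"
    and "(\<lambda>x. f (rotation a b x)) differentiable (at x)"
proof -
  have "((\<lambda>x. f (rotation a b x)) has_derivative
      (\<lambda>h. \<Sum>i\<in>UNIV. rotation a b h $ i *\<^sub>R PD i f (rotation a b x))) (at x)"
    by (rule has_derivative_compose[OF bounded_linear_imp_has_derivative[OF bounded_linear_rotation]
        has_derivative_partials[OF assms]])
  from partial_deriv_unique[OF this] this show "PD i (\<lambda>x. f (rotation a b x)) x
      = (\<Sum>k\<in>UNIV. rotation a b (axis i 1) $ k *\<^sub>R PD k f (rotation a b x))"
    "(\<lambda>x. f (rotation a b x)) differentiable (at x)"
    by (auto simp: differentiable_def)
qed

lemma extends_continuously_rotation: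
  assumes ab: "a\<^sup>2 + b\<^sup>2 = 1" and "extends_continuously f"
  shows "extends_continuously (\<lambda>t x. f t (rotation a b x))"
proof -
  obtain F where F: "continuous_on ({0<..} \<times> closed_disk) F" "\<And>t x. t > 0 \<Longrightarrow> x \<in> disk \<Longrightarrow> F (t, x) = f t x"
    using assms unfolding extends_continuously_def by auto
  have "continuous_on ({0<..} \<times> closed_disk) (\<lambda>z. F (fst z, rotation a b (snd z)))"
  proof (rule continuous_on_compose2[OF F(1)])
    show "continuous_on ({0<..} \<times> closed_disk) (\<lambda>z. (fst z, rotation a b (snd z)))"
      by (intro continuous_on_Pair continuous_on_fst continuous_on_id
          bounded_linear.continuous_on[OF bounded_linear_rotation] continuous_on_snd)
  qed (use ab in \<open>auto simp: norm_rotation\<close>)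
  moreover have "F (t, rotation a b x) = f t (rotation a b x)" if "t > 0" "x \<in> disk" for t x
    using F(2)[of t "rotation a b x"] that rotation_in_disk(1)[OF ab] by simp
  ultimately show ?thesis
    unfolding extends_continuously_def
    by (intro exI[of _ "\<lambda>z. F (fst z, rotation a b (snd z))"]) auto
qed

text \<open>
  The action of the rotation \<open>R\<close> on vector fields, \<open>R\<^sup>-\<^sup>1 \<circ> f \<circ> R\<close>. Its fixed points are the
  fields equivariant under \<open>R\<close>.
\<close>

definition rotate_field :: "real \<Rightarrow> real \<Rightarrow> (real^2 \<Rightarrow> real^2) \<Rightarrow> real^2 \<Rightarrow> real^2" where
  "rotate_field a b f x = rotation a (-b) (f (rotation a b x))"

lemma differentiable_linear:
  assumes "bounded_linear L" "f differentiable (at x)"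
  shows "(\<lambda>x. L (f x)) differentiable (at x)"
  using assms bounded_linear.has_derivative unfolding differentiable_def by blast

lemma partial_deriv_rotate_field:
  assumes "f differentiable (at (rotation a b x))"
  shows "PD i (rotate_field a b f) x
      = (\<Sum>k\<in>UNIV. rotation a b (axis i 1) $ k *\<^sub>R rotate_field a b (PD k f) x)"
    and "rotate_field a b f differentiable (at x)"
proof -
  note L = bounded_linear_rotation[of a "-b"]
  note R = partial_deriv_rotation[OF assms]
  show "PD i (rotate_field a b f) x
      = (\<Sum>k\<in>UNIV. rotation a b (axis i 1) $ k *\<^sub>R rotate_field a b (PD k f) x)"
    "rotate_field a b f differentiable (at x)"
    unfolding rotate_field_def[abs_def]
    using partial_deriv_linear[OF L R(2)] differentiable_linear[OF L R(2)] bounded_linear.linear[OF L]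
    by (simp_all add: R(1) linear_sum linear_scale)
qed

lemma partial_deriv2_rotate_field:
  assumes f: "\<And>y. y \<in> disk \<Longrightarrow> f differentiable (at y)"
    "\<And>y k. y \<in> disk \<Longrightarrow> PD k f differentiable (at y)"
    and ab: "a\<^sup>2 + b\<^sup>2 = 1" and x: "x \<in> disk"
  shows "PD j (rotate_field a b f) differentiable (at x)"
    and "PD i (PD j (rotate_field a b f)) x
      = (\<Sum>k\<in>UNIV. rotation a b (axis j 1) $ k *\<^sub>R PD i (rotate_field a b (PD k f)) x)"
proof -
  have R: "rotation a b y \<in> disk" if "y \<in> disk" for y using that rotation_in_disk(1)[OF ab] by blast
  let ?g = "\<lambda>k. rotate_field a b (PD k f)" and ?m = "\<lambda>k. rotation a b (axis j 1) $ k"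
  have d: "?g k differentiable (at x)" for k
    using partial_deriv_rotate_field(2) f(2) R x by blast
  have ds: "(\<lambda>y. c *\<^sub>R ?g k y) differentiable (at x)" for c k
    using differentiable_linear[OF bounded_linear_scaleR_right d] .
  have e: "PD j (rotate_field a b f) y = ?m 1 *\<^sub>R ?g 1 y + ?m 2 *\<^sub>R ?g 2 y" if "y \<in> disk" for y
    using partial_deriv_rotate_field(1)[OF f(1)[OF R[OF that]]] by (simp add: sum_2)
  have "PD i (PD j (rotate_field a b f)) x = PD i (\<lambda>y. ?m 1 *\<^sub>R ?g 1 y + ?m 2 *\<^sub>R ?g 2 y) x"
    by (rule partial_deriv_cong[of disk]) (use x e in auto)
  then show "PD i (PD j (rotate_field a b f)) x
      = (\<Sum>k\<in>UNIV. ?m k *\<^sub>R PD i (?g k) x)"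
    by (simp add: sum_2 partial_deriv_add ds partial_deriv_linear[OF bounded_linear_scaleR_right d])
  show "PD j (rotate_field a b f) differentiable (at x)"
    by (rule differentiable_cong_open[of disk x "\<lambda>y. ?m 1 *\<^sub>R ?g 1 y + ?m 2 *\<^sub>R ?g 2 y"])
      (use x e ds in \<open>auto intro!: differentiable_add\<close>)
qed

text \<open>
  The mixed derivatives cancel and the coefficients of the others add up to \<open>a\<^sup>2 + b\<^sup>2 = 1\<close>.
\<close>

lemma laplacian_rotate_field:
  assumes f: "\<And>y. y \<in> disk \<Longrightarrow> f differentiable (at y)"
    "\<And>y k. y \<in> disk \<Longrightarrow> PD k f differentiable (at y)"
    and ab: "a\<^sup>2 + b\<^sup>2 = 1" and x: "x \<in> disk"
  shows "laplacian (rotate_field a b f) x = rotate_field a b (laplacian f) x"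
proof -
  have R: "rotation a b x \<in> disk" using x rotation_in_disk(1)[OF ab] by blast
  let ?g = "\<lambda>i k. rotate_field a b (PD i (PD k f)) x"
  have S: "PD i (PD j (rotate_field a b f)) x
      = (\<Sum>k\<in>UNIV. rotation a b (axis j 1) $ k *\<^sub>R PD i (rotate_field a b (PD k f)) x)" for i j
    using f ab x by (rule partial_deriv2_rotate_field(2))
  have "laplacian (rotate_field a b f) x = (a\<^sup>2 + b\<^sup>2) *\<^sub>R (?g 1 1 + ?g 2 2)"
    by (simp add: laplacian_def sum_2 S partial_deriv_rotate_field(1)[OF f(2)[OF R]] rotation_nth axis_def
        power2_eq_square algebra_simps)
  also have "\<dots> = rotate_field a b (laplacian f) x"
    using bounded_linear.linear[OF bounded_linear_rotation]
    by (simp add: ab rotate_field_def laplacian_def[abs_def] sum_2 linear_add)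
  finally show ?thesis .
qed

text \<open>
  Derivatives of the rotated field are combinations, with constant coefficients, of rotated
  derivatives; so they inherit continuity up to the circle.
\<close>

lemma regular_rotate_field:
  assumes ab: "a\<^sup>2 + b\<^sup>2 = 1" and u: "regular_for_positive_time u"
  shows "regular_for_positive_time (\<lambda>t. rotate_field a b (u t))"
    and "t > 0 \<Longrightarrow> x \<in> disk \<Longrightarrow> time_deriv (\<lambda>t. rotate_field a b (u t)) t x = rotate_field a b (time_deriv u t) x"
proof -
  note L = bounded_linear_rotation[of a "-b"]
  have R: "rotation a b y \<in> disk" if "y \<in> disk" for y using that rotation_in_disk(1)[OF ab] by blast
  have d: "u t differentiable (at y)" "PD k (u t) differentiable (at y)" "(\<lambda>\<tau>. u \<tau> y) differentiable (at t)"
    if "t > 0" "y \<in> disk" for t y k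
    using u that by (auto simp: regular_for_positive_time_def)
  have ext: "extends_continuously (time_deriv u)" "extends_continuously (\<lambda>t. PD i (u t))"
    "extends_continuously (\<lambda>t. PD i (PD j (u t)))" for i j
    using u by (auto simp: regular_for_positive_time_def)
  have ext_rot: "extends_continuously (\<lambda>t. rotate_field a b (f t))" if "extends_continuously f" for f
    unfolding rotate_field_def[abs_def]
    by (intro extends_continuously_linear[OF L] extends_continuously_rotation[OF ab] that)
  have ext_comb: "extends_continuously (\<lambda>t x. \<Sum>k\<in>UNIV. c k *\<^sub>R f k t x)"
    if "\<And>k. extends_continuously (f k)" for c and f :: "2 \<Rightarrow> real \<Rightarrow> real^2 \<Rightarrow> real^2"
    unfolding sum_2
    by (intro extends_continuously_add extends_continuously_linear[OF bounded_linear_scaleR_right] that)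
  have time: "((\<lambda>\<tau>. rotate_field a b (u \<tau>) x) has_vector_derivative rotate_field a b (time_deriv u t) x) (at t)"
    if "t > 0" "x \<in> disk" for t x
    unfolding rotate_field_def
    using d(3)[OF that(1) R[OF that(2)]]
    by (intro bounded_linear.has_vector_derivative[OF L]) (simp add: time_deriv_def vector_derivative_works)
  show time_eq: "time_deriv (\<lambda>t. rotate_field a b (u t)) t x = rotate_field a b (time_deriv u t) x"
    if "t > 0" "x \<in> disk" for t x
    using vector_derivative_at[OF time[OF that]] by (simp add: time_deriv_def)
  have first: "extends_continuously (\<lambda>t. PD i (rotate_field a b (f t)))"
    if "\<And>k. extends_continuously (\<lambda>t. PD k (f t))"
      "\<And>t x. t > 0 \<Longrightarrow> x \<in> disk \<Longrightarrow> f t differentiable (at x)" for i f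
    by (rule extends_continuously_cong[OF ext_comb[OF ext_rot[OF that(1)]]])
      (rule partial_deriv_rotate_field(1)[OF that(2)[OF _ R], symmetric])
  show "regular_for_positive_time (\<lambda>t. rotate_field a b (u t))"
    unfolding regular_for_positive_time_def
  proof (intro conjI allI impI ballI)
    have cu: "continuous_on ({0<..} \<times> closed_disk) (\<lambda>(t, x). u t x)"
      using u by (simp add: regular_for_positive_time_def)
    have "continuous_on ({0<..} \<times> closed_disk) (\<lambda>z. case (fst z, rotation a b (snd z)) of (t, x) \<Rightarrow> u t x)"
    proof (rule continuous_on_compose2[OF cu])
      show "continuous_on ({0<..} \<times> closed_disk) (\<lambda>z. (fst z, rotation a b (snd z)))"
        by (intro continuous_on_Pair continuous_on_fst continuous_on_id
            bounded_linear.continuous_on[OF bounded_linear_rotation] continuous_on_snd)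
    qed (use ab in \<open>auto simp: norm_rotation\<close>)
    from bounded_linear.continuous_on[OF L this]
    show "continuous_on ({0<..} \<times> closed_disk) (\<lambda>(t, x). rotate_field a b (u t) x)"
      by (simp add: rotate_field_def case_prod_beta)
    show "extends_continuously (time_deriv (\<lambda>t. rotate_field a b (u t)))"
      by (rule extends_continuously_cong[OF ext_rot[OF ext(1)]]) (simp add: time_eq)
    show "extends_continuously (\<lambda>t. PD i (rotate_field a b (u t)))" for i
      by (rule first[OF ext(2) d(1)])
    show "extends_continuously (\<lambda>t. PD i (PD j (rotate_field a b (u t))))" for i j
    proof (rule extends_continuously_cong[OF ext_comb])
      show "extends_continuously (\<lambda>t. PD i (rotate_field a b (PD k (u t))))" for k
        using ext(3) d(2) by (rule first)
      show "(\<Sum>k\<in>UNIV. rotation a b (axis j 1) $ k *\<^sub>R PD i (rotate_field a b (PD k (u t))) x)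
          = PD i (PD j (rotate_field a b (u t))) x" if "t > 0" "x \<in> disk" for t x
        using d(1,2)[OF that(1)] ab that(2) by (rule partial_deriv2_rotate_field(2)[symmetric])
    qed
  next
    fix t :: real and x :: "real^2" assume t: "0 < t" and x: "x \<in> disk"
    show "(\<lambda>\<tau>. rotate_field a b (u \<tau>) x) differentiable at t"
      using time[OF t x] by (rule differentiableI_vector)
    show "rotate_field a b (u t) differentiable at x"
      using d(1)[OF t R[OF x]] by (rule partial_deriv_rotate_field(2))
    show "PD i (rotate_field a b (u t)) differentiable at x" for i
      using d(1,2)[OF t] ab x by (rule partial_deriv2_rotate_field(1))
  qed
qed

definition rotationally_symmetric :: "(real^2 \<Rightarrow> real^2) \<Rightarrow> bool" where
  "rotationally_symmetric f \<longleftrightarrow>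
     (\<forall>a b. a\<^sup>2 + b\<^sup>2 = 1 \<longrightarrow> (\<forall>x\<in>closed_disk. f (rotation a b x) = rotation a b (f x)))"

lemma rotationally_symmetricD:
  "rotationally_symmetric f \<Longrightarrow> a\<^sup>2 + b\<^sup>2 = 1 \<Longrightarrow> x \<in> closed_disk \<Longrightarrow> f (rotation a b x) = rotation a b (f x)"
  unfolding rotationally_symmetric_def by blast

text \<open>
  Each term of the momentum equation is mapped by \<open>rotate_field\<close> to the corresponding term for the
  rotated velocity and pressure. The initial condition is preserved because rotations preserve
  Lebesgue measure and the norm.
\<close>

theorem navier_stokes_rotate:
  assumes ab: "a\<^sup>2 + b\<^sup>2 = 1" and sol: "navier_stokes_solution \<nu> u\<^sub>0 u p"
    and u0: "continuous_on closed_disk u\<^sub>0"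
    and sym: "rotationally_symmetric u\<^sub>0"
  shows "navier_stokes_solution \<nu> u\<^sub>0 (\<lambda>t. rotate_field a b (u t)) (\<lambda>t x. p t (rotation a b x))"
  unfolding navier_stokes_solution_def
proof (intro conjI allI impI ballI)
  note reg = solution_regular[OF sol]
  note lin = bounded_linear.linear[OF bounded_linear_rotation]
  have R: "rotation a b y \<in> disk" if "y \<in> disk" for y using that rotation_in_disk(1)[OF ab] by blast
  have d: "u t differentiable (at y)" "PD k (u t) differentiable (at y)"
    if "t > 0" "y \<in> disk" for t y k
    using reg that by (auto simp: regular_for_positive_time_def)
  have sq: "a * a = 1 - b * b" using ab by (simp add: power2_eq_square)
  have fold: "a * (a * y) = y - b * (b * y)" for y
    using sq by (simp add: mult.assoc[symmetric] left_diff_distrib)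
  show "regular_for_positive_time (\<lambda>t. rotate_field a b (u t))" by (rule regular_rotate_field(1)[OF ab reg])
  fix t :: real and x :: "real^2" assume t: "0 < t" and x: "x \<in> disk"
  note Rx = R[OF x]
  have pd: "p t differentiable (at (rotation a b x))" using sol t Rx by (simp add: navier_stokes_solution_def)
  note P = partial_deriv_rotate_field(1)[OF d(1)[OF t Rx]]
  show "(\<lambda>x. p t (rotation a b x)) differentiable at x" by (rule partial_deriv_rotation(2)[OF pd])
  have grad: "gradient (\<lambda>x. p t (rotation a b x)) x = rotate_field a b (gradient (p t)) x"
    by (simp add: vec2_eq_iff gradient_def partial_deriv_rotation(1)[OF pd] sum_2 rotate_field_def rotation_nth axis_def)
  have adv: "advection (rotate_field a b (u t)) (rotate_field a b (u t)) x = rotate_field a b (advection (u t) (u t)) x"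
    unfolding vec2_eq_iff
    by (simp add: advection_def sum_2 P rotate_field_def rotation_nth axis_def algebra_simps fold)
  have lap: "laplacian (rotate_field a b (u t)) x = rotate_field a b (laplacian (u t)) x"
    using d[OF t] ab x by (rule laplacian_rotate_field)
  have "time_deriv u t (rotation a b x) + advection (u t) (u t) (rotation a b x) + gradient (p t) (rotation a b x)
      = \<nu> *\<^sub>R laplacian (u t) (rotation a b x)"
    using sol t Rx by (simp add: navier_stokes_solution_def)
  from arg_cong[OF this, of "rotation a (-b)"]
  show "time_deriv (\<lambda>t. rotate_field a b (u t)) t x
      + advection (rotate_field a b (u t)) (rotate_field a b (u t)) x
      + gradient (\<lambda>x. p t (rotation a b x)) x
      = \<nu> *\<^sub>R laplacian (rotate_field a b (u t)) x"
    unfolding grad adv regular_rotate_field(2)[OF ab reg t x] lap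
    by (simp add: rotate_field_def linear_add[OF lin] linear_scale[OF lin])
  have "divergence (u t) (rotation a b x) = 0" using sol t Rx by (simp add: navier_stokes_solution_def)
  then have dv: "PD 1 (u t) (rotation a b x) $ 1 = - PD 2 (u t) (rotation a b x) $ 2"
    by (simp add: divergence_def sum_2)
  show "divergence (rotate_field a b (u t)) x = 0"
    by (simp add: divergence_def sum_2 P rotate_field_def rotation_nth axis_def algebra_simps fold dv)
next
  fix t :: real and x :: "real^2" assume "0 < t" "norm x = 1"
  then have "u t (rotation a b x) = 0" using sol ab by (simp add: navier_stokes_solution_def norm_rotation)
  then show "rotate_field a b (u t) x = 0" by (simp add: rotate_field_def vec2_eq_iff rotation_nth)
next
  fix x :: "real^2" assume x: "x \<in> closed_disk"
  then have "u 0 (rotation a b x) = u\<^sub>0 (rotation a b x)"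
    using sol rotation_in_disk(2)[OF ab] by (simp add: navier_stokes_solution_def)
  then show "rotate_field a b (u 0) x = u\<^sub>0 x"
    by (simp add: rotate_field_def rotationally_symmetricD[OF sym ab x] rotation_inverse[OF ab])
next
  have "(DINT x. (norm (rotate_field a b (u t) x - u\<^sub>0 x))\<^sup>2) = (DINT x. (norm (u t x - u\<^sub>0 x))\<^sup>2)"
    if t: "t > 0" for t
  proof -
    let ?f = "\<lambda>x. (norm (u t x - u\<^sub>0 x))\<^sup>2"
    have bc: "bounded_continuous ?f"
      by (intro bounded_continuous_closed continuous_intros solution_continuous[OF sol t] u0)
    have "(DINT x. (norm (rotate_field a b (u t) x - u\<^sub>0 x))\<^sup>2) = (DINT x. ?f (rotation a b x))"
    proof (rule disk_integral_cong)
      fix x :: "real^2" assume x: "x \<in> disk"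
      then have "u\<^sub>0 (rotation a b x) = rotation a b (u\<^sub>0 x)" by (intro rotationally_symmetricD[OF sym ab]) simp
      then have "rotation a (-b) (u t (rotation a b x) - u\<^sub>0 (rotation a b x)) = rotate_field a b (u t) x - u\<^sub>0 x"
        by (simp add: rotate_field_def linear_diff[OF bounded_linear.linear[OF bounded_linear_rotation]] rotation_inverse[OF ab])
      moreover have "norm (rotation a (-b) (u t (rotation a b x) - u\<^sub>0 (rotation a b x))) = norm (u t (rotation a b x) - u\<^sub>0 (rotation a b x))"
        using ab by (intro norm_rotation) simp
      ultimately show "(norm (rotate_field a b (u t) x - u\<^sub>0 x))\<^sup>2 = ?f (rotation a b x)" by simp
    qed
    also have "\<dots> = (DINT x. ?f x)" by (rule disk_integral_rotation[OF ab bc])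
    finally show ?thesis .
  qed
  then have "\<forall>\<^sub>F t in at_right 0. (DINT x. (norm (u t x - u\<^sub>0 x))\<^sup>2)
      = (DINT x. (norm (rotate_field a b (u t) x - u\<^sub>0 x))\<^sup>2)"
    by (auto simp: eventually_at_right_field intro: exI[of _ 1])
  moreover have "((\<lambda>t. DINT x. (norm (u t x - u\<^sub>0 x))\<^sup>2) \<longlongrightarrow> 0) (at_right 0)"
    using sol by (simp add: navier_stokes_solution_def)
  ultimately show "((\<lambda>t. DINT x. (norm (rotate_field a b (u t) x - u\<^sub>0 x))\<^sup>2) \<longlongrightarrow> 0) (at_right 0)"
    by (rule Lim_transform_eventually[rotated])
qed

corollary navier_stokes_equivariant:
  assumes \<nu>: "\<nu> > 0" and sol: "navier_stokes_solution \<nu> u\<^sub>0 u p"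
    and u0: "continuous_on closed_disk u\<^sub>0"
    and sym: "rotationally_symmetric u\<^sub>0"
    and ab: "a\<^sup>2 + b\<^sup>2 = 1" and t: "t > 0" and x: "x \<in> disk"
  shows "rotate_field a b (u t) x = u t x" "u t (rotation a b x) = rotation a b (u t x)"
proof -
  show 1: "rotate_field a b (u t) x = u t x"
    using navier_stokes_unique[OF \<nu> u0 navier_stokes_rotate[OF ab sol u0 sym] sol t x] .
  then have "rotation a b (u t x) = rotation a b (rotation a (-b) (u t (rotation a b x)))"
    by (simp add: rotate_field_def)
  then show "u t (rotation a b x) = rotation a b (u t x)" by (simp add: rotation_inverse[OF ab])
qed

section \<open>Symmetric flows solve the heat equation\<close>

lemma rotation_has_vector_derivative:
  "((\<lambda>\<theta>. rotation (cos \<theta>) (sin \<theta>) x) has_vector_derivative perp (rotation (cos \<theta>) (sin \<theta>) x)) (at \<theta>)"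
proof -
  have "((\<lambda>\<theta>. cos \<theta> *\<^sub>R x + sin \<theta> *\<^sub>R perp x) has_vector_derivative - sin \<theta> *\<^sub>R x + cos \<theta> *\<^sub>R perp x) (at \<theta>)"
    by (auto intro!: derivative_eq_intros simp: has_real_derivative_iff_has_vector_derivative[symmetric])
  moreover have "perp (rotation (cos \<theta>) (sin \<theta>) x) = - sin \<theta> *\<^sub>R x + cos \<theta> *\<^sub>R perp x"
    by (simp add: vec2_eq_iff perp_simps rotation_nth algebra_simps)
  ultimately show ?thesis by (simp add: rotation_def[abs_def])
qed

lemma rotation_angle: "(cos \<theta>)\<^sup>2 + (sin \<theta>)\<^sup>2 = (1::real)"
  by simp

lemma inner_vec2: "(x :: real^2) \<bullet> y = x $ 1 * y $ 1 + x $ 2 * y $ 2"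
  by (simp add: inner_vec_def sum_2)

lemma rotation_perp_inner:
  "perp (rotation a b y) \<bullet> rotation a b w = (a\<^sup>2 + b\<^sup>2) * (perp y \<bullet> w)"
  by (simp add: inner_vec2 perp_simps rotation_nth power2_eq_square algebra_simps)

text \<open>
  \<open>y\<close> and \<open>perp y\<close> are orthogonal and have equal length; scaling by the square of that length avoids
  a division at the origin.
\<close>

lemma radial_tangential_decomposition:
  "(norm y)\<^sup>2 *\<^sub>R v = (y \<bullet> v) *\<^sub>R y + (perp y \<bullet> v) *\<^sub>R perp y"
  unfolding norm_square_vec2
  by (simp add: vec2_eq_iff inner_vec2 perp_simps power2_eq_square algebra_simps)

lemma angular_derivative:
  fixes f :: "real^2 \<Rightarrow> 'a::real_normed_vector"
  assumes "f differentiable (at (rotation (cos \<theta>) (sin \<theta>) x))"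
  shows "((\<lambda>\<theta>. f (rotation (cos \<theta>) (sin \<theta>) x)) has_vector_derivative
    (\<Sum>i\<in>UNIV. perp (rotation (cos \<theta>) (sin \<theta>) x) $ i *\<^sub>R PD i f (rotation (cos \<theta>) (sin \<theta>) x))) (at \<theta>)"
proof -
  from has_derivative_compose[OF rotation_has_vector_derivative[of x \<theta>, unfolded has_vector_derivative_def]
      has_derivative_partials[OF assms]]
  show ?thesis
    by (simp add: has_vector_derivative_def scaleR_sum_right)
qed

text \<open>
  Differentiate \<open>U (R x) = R (U x)\<close> with respect to the angle of \<open>R\<close> at the identity.
\<close>

lemma equivariant_angular_derivative:
  assumes eqv: "\<And>a b. a\<^sup>2 + b\<^sup>2 = 1 \<Longrightarrow> U (rotation a b x) = rotation a b (U x)"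
    and U: "U differentiable (at x)"
  shows "(\<Sum>i\<in>UNIV. perp x $ i *\<^sub>R PD i U x) = perp (U x)"
proof -
  have "((\<lambda>\<theta>. U (rotation (cos \<theta>) (sin \<theta>) x)) has_vector_derivative
      (\<Sum>i\<in>UNIV. perp x $ i *\<^sub>R PD i U x)) (at 0)"
    using angular_derivative[of U 0 x] U by (simp add: rotation_def)
  moreover have "((\<lambda>\<theta>. U (rotation (cos \<theta>) (sin \<theta>) x)) has_vector_derivative perp (U x)) (at 0)"
    using rotation_has_vector_derivative[of "U x" 0] by (simp add: eqv) (simp add: rotation_def)
  ultimately show ?thesis by (rule vector_derivative_unique_at)
qed

text \<open>
  On a ray from the origin in the direction \<open>e\<close>, the function \<open>r (U (r e) \<bullet> e)\<close> has derivative
  \<open>r div U\<close>: equivariance determines the angular part of the divergence as \<open>(U \<bullet> e) / r\<close>. Hence it is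
  constant, with value 0 at the origin.
\<close>

lemma equivariant_divergence_free_tangential:
  assumes eqv: "\<And>a b x. a\<^sup>2 + b\<^sup>2 = 1 \<Longrightarrow> x \<in> disk \<Longrightarrow> U (rotation a b x) = rotation a b (U x)"
    and U: "\<And>x. x \<in> disk \<Longrightarrow> U differentiable (at x)"
    and div: "\<And>x. x \<in> disk \<Longrightarrow> divergence U x = 0" and x: "x \<in> disk"
  shows "x \<bullet> U x = 0"
proof (cases "x = 0")
  case False
  define e where "e = x /\<^sub>R norm x"
  have ne: "norm e = 1" using False by (simp add: e_def)
  then have e2: "e $ 1 * e $ 1 + e $ 2 * e $ 2 = 1"
    using norm_square_vec2[of e] by (simp add: power2_eq_square)
  have xe: "x = norm x *\<^sub>R e" using False by (simp add: e_def)
  define \<psi> where "\<psi> = (\<lambda>r. r * (e $ 1 * U (r *\<^sub>R e) $ 1 + e $ 2 * U (r *\<^sub>R e) $ 2))"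
  have line: "((\<lambda>r. U (r *\<^sub>R e) $ j) has_real_derivative
      (\<Sum>i\<in>UNIV. e $ i * PD i U (r *\<^sub>R e) $ j)) (at r)" if r: "r *\<^sub>R e \<in> disk" for r j
  proof -
    have "((\<lambda>r. r *\<^sub>R e) has_derivative (\<lambda>h. h *\<^sub>R e)) (at r)"
      by (auto intro!: derivative_eq_intros)
    from has_derivative_compose[OF this has_derivative_partials[OF U[OF r]]]
    have "((\<lambda>r. U (r *\<^sub>R e)) has_vector_derivative (\<Sum>i\<in>UNIV. e $ i *\<^sub>R PD i U (r *\<^sub>R e))) (at r)"
      by (simp add: has_vector_derivative_def scaleR_sum_right)
    from bounded_linear.has_vector_derivative[OF bounded_linear_vec_nth[of j] this]
    show ?thesis by (simp add: has_real_derivative_iff_has_vector_derivative)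
  qed
  have in_disk: "r *\<^sub>R e \<in> disk" if "0 \<le> r" "r \<le> norm x" for r
    using that ne x by simp
  have "\<psi> (norm x) = \<psi> 0"
  proof (rule DERIV_isconst_end[of 0 "norm x" \<psi>])
    show "0 < norm x" using False by simp
    have "continuous_on {0..norm x} (\<lambda>r. U (r *\<^sub>R e))"
    proof (rule continuous_on_compose2[of disk U])
      show "continuous_on disk U"
        using U by (meson continuous_at_imp_continuous_on differentiable_imp_continuous_within)
    qed (use in_disk in \<open>auto intro!: continuous_intros\<close>)
    then show "continuous_on {0..norm x} \<psi>"
      unfolding \<psi>_def by (intro continuous_intros)
    fix r assume r: "0 < r" "r < norm x"
    then have rd: "r *\<^sub>R e \<in> disk" by (intro in_disk) auto
    let ?P = "\<lambda>i j. PD i U (r *\<^sub>R e) $ j" and ?U = "\<lambda>j. U (r *\<^sub>R e) $ j"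
    have "(\<psi> has_real_derivative
        1 * (e $ 1 * ?U 1 + e $ 2 * ?U 2)
        + (e $ 1 * (\<Sum>i\<in>UNIV. e $ i * ?P i 1) + e $ 2 * (\<Sum>i\<in>UNIV. e $ i * ?P i 2)) * r) (at r)"
      unfolding \<psi>_def by (intro DERIV_mult DERIV_ident DERIV_add DERIV_cmult line rd)
    moreover have "1 * (e $ 1 * ?U 1 + e $ 2 * ?U 2)
        + (e $ 1 * (\<Sum>i\<in>UNIV. e $ i * ?P i 1) + e $ 2 * (\<Sum>i\<in>UNIV. e $ i * ?P i 2)) * r = 0"
    proof -
      have ang: "(\<Sum>i\<in>UNIV. perp (r *\<^sub>R e) $ i *\<^sub>R PD i U (r *\<^sub>R e)) = perp (U (r *\<^sub>R e))"
        using eqv rd by (intro equivariant_angular_derivative U)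
      have a1: "r * (e $ 1 * ?P 2 1) = r * (e $ 2 * ?P 1 1) - ?U 2"
        using arg_cong[OF ang, of "\<lambda>v. v $ 1"] by (simp add: sum_2 perp_simps algebra_simps)
      have a2: "r * (e $ 2 * ?P 1 2) = r * (e $ 1 * ?P 2 2) - ?U 1"
        using arg_cong[OF ang, of "\<lambda>v. v $ 2"] by (simp add: sum_2 perp_simps algebra_simps)
      have dv: "?P 1 1 + ?P 2 2 = 0" using div[OF rd] by (simp add: divergence_def sum_2)
      have "(e $ 1 * (\<Sum>i\<in>UNIV. e $ i * ?P i 1) + e $ 2 * (\<Sum>i\<in>UNIV. e $ i * ?P i 2)) * r
          = r * (e $ 1 * e $ 1 * ?P 1 1 + e $ 2 * e $ 2 * ?P 2 2)
            + e $ 2 * (r * (e $ 1 * ?P 2 1)) + e $ 1 * (r * (e $ 2 * ?P 1 2))"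
        by (simp add: sum_2 algebra_simps)
      also have "\<dots> = r * ((e $ 1 * e $ 1 + e $ 2 * e $ 2) * (?P 1 1 + ?P 2 2)) - e $ 2 * ?U 2 - e $ 1 * ?U 1"
        unfolding a1 a2 by (simp add: algebra_simps)
      also have "\<dots> = - e $ 2 * ?U 2 - e $ 1 * ?U 1" unfolding dv by simp
      finally show ?thesis by simp
    qed
    ultimately show "(\<psi> has_real_derivative 0) (at r)" by (simp only:)
  qed
  moreover have "\<psi> (norm x) = x \<bullet> U x"
  proof -
    have "norm x * e $ 1 = x $ 1" "norm x * e $ 2 = x $ 2" using False by (simp_all add: e_def)
    then show ?thesis
      unfolding \<psi>_def xe[symmetric] distrib_left mult.assoc[symmetric] by (simp add: inner_vec2)
  qed
  moreover have "\<psi> 0 = 0" by (simp add: \<psi>_def)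
  ultimately show ?thesis by metis
qed simp

text \<open>
  The Laplacian of \<open>x \<bullet> U x\<close> is \<open>x \<bullet> \<Delta>U x + 2 div U x\<close>.
\<close>

lemma tangential_laplacian:
  fixes U :: "2 \<Rightarrow> real^2 \<Rightarrow> real"
  assumes U: "\<And>j. C2_disk (U j)"
    and tang: "\<And>x. x \<in> disk \<Longrightarrow> x $ 1 * U 1 x + x $ 2 * U 2 x = 0"
    and div: "\<And>x. x \<in> disk \<Longrightarrow> PD 1 (U 1) x + PD 2 (U 2) x = 0" and x: "x \<in> disk"
  shows "x $ 1 * laplacian (U 1) x
    + x $ 2 * laplacian (U 2) x = 0"
proof -
  have d: "U j differentiable (at y)" "PD i (U j) differentiable (at y)" if "y \<in> disk" for i j y
    using C1_disk_differentiable[OF C2_disk_C1[OF U] that] C1_disk_differentiable[OF C2_disk_partial[OF U] that] .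
  have xd: "(\<lambda>x::real^2. x $ j) differentiable (at y)" for j y
    by (intro bounded_linear_imp_differentiable bounded_linear_vec_nth)
  let ?c = "\<lambda>i j. if i = j then 1 else 0 :: real"
  let ?f = "\<lambda>i y. y $ 1 * PD i (U 1) y + ?c i 1 * U 1 y
    + (y $ 2 * PD i (U 2) y + ?c i 2 * U 2 y)"
  have first: "?f i y = 0" if y: "y \<in> disk" for i y
  proof -
    have "?f i y = PD i (\<lambda>x. x $ 1 * U 1 x + x $ 2 * U 2 x) y"
      using d[OF y] xd by (simp add: partial_deriv_add partial_deriv_mult differentiable_mult)
    also have "\<dots> = 0"
      using partial_deriv_cong[of disk y "\<lambda>x. x $ 1 * U 1 x + x $ 2 * U 2 x" "\<lambda>x. 0" i] tang y by simp
    finally show ?thesis .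
  qed
  have second: "x $ 1 * PD i (PD i (U 1)) x + ?c i 1 * PD i (U 1) x + ?c i 1 * PD i (U 1) x
      + (x $ 2 * PD i (PD i (U 2)) x + ?c i 2 * PD i (U 2) x + ?c i 2 * PD i (U 2) x) = 0"
    (is "?s = 0") for i
  proof -
    have "?s = PD i (?f i) x"
      using d[OF x] xd
      by (simp add: partial_deriv_add partial_deriv_mult differentiable_mult differentiable_add del: mult_if_delta if_distrib)
    also have "\<dots> = 0" using partial_deriv_cong[of disk x "?f i" "\<lambda>x. 0" i] first x by simp
    finally show ?thesis .
  qed
  show ?thesis
    using second[of 1] second[of 2] div[OF x] by (simp add: laplacian_def sum_2 algebra_simps)
qed

text \<open>
  Let \<open>W\<close> be the defect in the heat equation. Its radial component vanishes because those of the
  velocity and of its Laplacian do. Its tangential component is minus the tangential derivative of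
  the pressure, since advection of a tangential equivariant field by itself is radial; \<open>W\<close> is
  equivariant, so this derivative is the same at all points of a circle, and the pressure returns to
  its value after one turn.
\<close>

theorem symmetric_solution_heat:
  assumes \<nu>: "\<nu> > 0" and sol: "navier_stokes_solution \<nu> u\<^sub>0 u p"
    and u0: "continuous_on closed_disk u\<^sub>0"
    and sym: "rotationally_symmetric u\<^sub>0"
    and t: "t > 0" and x: "x \<in> disk"
  shows "time_deriv u t x = \<nu> *\<^sub>R laplacian (u t) x"
proof -
  note reg = solution_regular[OF sol]
  note lin = bounded_linear.linear[OF bounded_linear_rotation]
  have eqv: "rotate_field a b (u t) y = u t y" "u t (rotation a b y) = rotation a b (u t y)"
    if "a\<^sup>2 + b\<^sup>2 = 1" "t > 0" "y \<in> disk" for a b t y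
    using navier_stokes_equivariant[OF \<nu> sol u0 sym that] .
  have R: "rotation a b y \<in> disk" if "a\<^sup>2 + b\<^sup>2 = 1" "y \<in> disk" for a b y
    using that rotation_in_disk(1)[of a b y] by blast
  have d: "u t differentiable (at y)" "PD k (u t) differentiable (at y)" if "t > 0" "y \<in> disk" for t y k
    using reg that by (auto simp: regular_for_positive_time_def)
  have divu: "divergence (u t) y = 0" if "t > 0" "y \<in> disk" for t y
    using sol that by (simp add: navier_stokes_solution_def)
  have tang: "y \<bullet> u t y = 0" if "t > 0" "y \<in> disk" for t y
    using that by (intro equivariant_divergence_free_tangential[of "u t"] eqv(2) d(1) divu)
  have lap_tang: "y \<bullet> laplacian (u t) y = 0" if y: "y \<in> disk" for y
  proof -
    have "laplacian (u t) y $ j = laplacian (\<lambda>x. u t x $ j) y" for j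
      by (simp add: laplacian_def regular_partials(2)[OF reg t y])
    moreover have "y $ 1 * laplacian (\<lambda>x. u t x $ 1) y + y $ 2 * laplacian (\<lambda>x. u t x $ 2) y = 0"
    proof (rule tangential_laplacian[of "\<lambda>j x. u t x $ j", OF _ _ _ y])
      show "C2_disk (\<lambda>x. u t x $ j)" for j by (rule regular_C2_disk[OF reg t])
      show "z $ 1 * u t z $ 1 + z $ 2 * u t z $ 2 = 0" if "z \<in> disk" for z
        using tang[OF t that] by (simp add: inner_vec2)
      show "PD 1 (\<lambda>x. u t x $ 1) z + PD 2 (\<lambda>x. u t x $ 2) z = 0" if "z \<in> disk" for z
        using solution_components(2)[OF sol t that] by (simp add: sum_2)
    qed
    ultimately show ?thesis by (simp add: inner_vec2)
  qed
  have time_tang: "y \<bullet> time_deriv u t y = 0" if y: "y \<in> disk" for y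
  proof -
    have "((\<lambda>\<tau>. y \<bullet> u \<tau> y) has_real_derivative y \<bullet> time_deriv u t y) (at t)"
      unfolding inner_vec2 by (intro DERIV_add DERIV_cmult regular_time_deriv[OF reg t y])
    moreover have "((\<lambda>\<tau>. y \<bullet> u \<tau> y) has_real_derivative 0) (at t)"
      by (rule has_field_derivative_transform_within_open[of "\<lambda>\<tau>. 0" 0 t "{0<..}"])
        (use t y tang in auto)
    ultimately show ?thesis by (rule DERIV_unique)
  qed
  define W where "W = (\<lambda>y. time_deriv u t y - \<nu> *\<^sub>R laplacian (u t) y)"
  have W_rot: "W (rotation a b y) = rotation a b (W y)" if ab: "a\<^sup>2 + b\<^sup>2 = 1" and y: "y \<in> disk" for a b y
  proof -
    have "laplacian (u t) y = laplacian (rotate_field a b (u t)) y"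
    proof -
      have 1: "PD i (u t) z = PD i (rotate_field a b (u t)) z" if "z \<in> disk" for i z
        using that eqv(1)[OF ab t] by (intro partial_deriv_cong[of disk]) auto
      have "PD i (PD i (u t)) y = PD i (PD i (rotate_field a b (u t))) y" for i
        by (rule partial_deriv_cong[of disk]) (use y 1 in auto)
      then show ?thesis by (simp add: laplacian_def)
    qed
    also have "\<dots> = rotate_field a b (laplacian (u t)) y"
      using d[OF t] ab y by (rule laplacian_rotate_field)
    finally have L: "laplacian (u t) y = rotation a (-b) (laplacian (u t) (rotation a b y))"
      by (simp add: rotate_field_def)
    have "((\<lambda>\<tau>. u \<tau> y) has_vector_derivative time_deriv u t y) (at t)"
      using reg t y by (simp add: regular_for_positive_time_def time_deriv_def vector_derivative_works)
    then have "((\<lambda>\<tau>. rotate_field a b (u \<tau>) y) has_vector_derivative time_deriv u t y) (at t)"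
      by (rule has_vector_derivative_transform_within_open[of _ _ _ "{0<..}"])
        (use t y eqv(1)[OF ab] in auto)
    then have "time_deriv (\<lambda>t. rotate_field a b (u t)) t y = time_deriv u t y"
      using vector_derivative_at by (simp add: time_deriv_def)
    then have T: "time_deriv u t y = rotation a (-b) (time_deriv u t (rotation a b y))"
      using regular_rotate_field(2)[OF ab reg t y] by (simp add: rotate_field_def)
    have "rotation a b (W y) = rotation a b (rotation a (-b) (W (rotation a b y)))"
      by (simp add: W_def linear_diff[OF lin] linear_scale[OF lin] L[symmetric] T[symmetric])
    then show ?thesis by (simp add: rotation_inverse[OF ab])
  qed
  have W_perp: "perp y \<bullet> W y = - (perp y \<bullet> gradient (p t) y)" if y: "y \<in> disk" for y
  proof (cases "y = 0")
    case True
    then show ?thesis by (simp add: inner_vec2 perp_simps)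
  next
    case False
    \<comment> \<open>The velocity is tangential, so advection is a multiple of the angular derivative.\<close>
    have "(norm y)\<^sup>2 *\<^sub>R u t y = (perp y \<bullet> u t y) *\<^sub>R perp y"
      by (simp add: radial_tangential_decomposition[of y] tang[OF t y])
    then have U: "(norm y)\<^sup>2 * u t y $ i = (perp y \<bullet> u t y) * perp y $ i" for i
      by (metis real_scaleR_def vector_scaleR_component)
    have ang: "(\<Sum>i\<in>UNIV. perp y $ i *\<^sub>R PD i (u t) y) = perp (u t y)"
      using eqv(2) t y d by (intro equivariant_angular_derivative)
    have "(norm y)\<^sup>2 *\<^sub>R advection (u t) (u t) y = (perp y \<bullet> u t y) *\<^sub>R perp (u t y)"
      unfolding ang[symmetric] advection_def by (simp add: scaleR_sum_right U)
    then have "(norm y)\<^sup>2 * (perp y \<bullet> advection (u t) (u t) y) = (perp y \<bullet> u t y) * (perp y \<bullet> perp (u t y))"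
      by (metis inner_scaleR_right)
    also have "perp y \<bullet> perp (u t y) = 0"
      using tang[OF t y] by (simp add: inner_vec2 perp_simps)
    finally have adv: "perp y \<bullet> advection (u t) (u t) y = 0" using False by simp
    have "time_deriv u t y + advection (u t) (u t) y + gradient (p t) y = \<nu> *\<^sub>R laplacian (u t) y"
      using sol t y by (simp add: navier_stokes_solution_def)
    then have "W y = - advection (u t) (u t) y - gradient (p t) y"
      by (simp add: W_def algebra_simps eq_neg_iff_add_eq_0)
    then show ?thesis by (simp add: inner_diff_right adv)
  qed
  have pressure: "perp y \<bullet> W y = 0" if y: "y \<in> disk" for y
  proof -
    define c where "c = - (perp y \<bullet> W y)"
    \<comment> \<open>The pressure along the circle through \<open>y\<close> has constant derivative \<open>c\<close>.\<close>
    let ?R = "\<lambda>\<theta>. rotation (cos \<theta>) (sin \<theta>)"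
    have der: "((\<lambda>\<theta>. p t (?R \<theta> y)) has_real_derivative c) (at \<theta>)" for \<theta>
    proof -
      have Ry: "?R \<theta> y \<in> disk" using y by (intro R) auto
      have "p t differentiable (at (?R \<theta> y))" using sol t Ry by (simp add: navier_stokes_solution_def)
      from angular_derivative[OF this]
      have "((\<lambda>\<theta>. p t (?R \<theta> y)) has_real_derivative perp (?R \<theta> y) \<bullet> gradient (p t) (?R \<theta> y)) (at \<theta>)"
        by (simp add: has_real_derivative_iff_has_vector_derivative sum_2 inner_vec2 gradient_def)
      also have "perp (?R \<theta> y) \<bullet> gradient (p t) (?R \<theta> y) = - (perp (?R \<theta> y) \<bullet> W (?R \<theta> y))"
        using W_perp[OF Ry] by simp
      also have "\<dots> = c" unfolding W_rot[OF rotation_angle y] rotation_perp_inner by (simp add: c_def)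
      finally show ?thesis .
    qed
    have "\<exists>z>0. z < 2 * pi \<and> p t (?R (2 * pi) y) - p t (?R 0 y) = (2 * pi - 0) * c"
      by (rule MVT2) (auto intro: der)
    then have "c = 0" by auto
    then show ?thesis by (simp add: c_def)
  qed
  have radial: "x \<bullet> W x = 0"
    by (simp add: W_def inner_diff_right time_tang[OF x] lap_tang[OF x])
  have "W x = 0"
  proof (cases "x = 0")
    case True
    \<comment> \<open>At the centre there is no tangential direction; an equivariant field vanishes there.\<close>
    have "W (rotation (-1) 0 0) = rotation (-1) 0 (W 0)" by (rule W_rot) auto
    moreover have "rotation (-1) 0 0 = 0" by (simp add: vec2_eq_iff rotation_nth)
    ultimately have "W 0 = - W 0" by (simp add: rotation_def)
    then show ?thesis unfolding True by (simp add: eq_neg_iff_add_eq_0 scaleR_2[symmetric])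
  next
    case False
    have "(norm x)\<^sup>2 *\<^sub>R W x = 0"
      unfolding radial_tangential_decomposition[of x] radial pressure[OF x] by simp
    then show ?thesis using False by simp
  qed
  then show ?thesis by (simp add: W_def)
qed

section \<open>Comparison for the heat equation\<close>

text \<open>
  At 0 both one-sided derivatives vanish, so no corner arises.
\<close>

lemma positive_part_has_derivative:
  fixes k k' :: "real \<Rightarrow> real"
  assumes k: "\<And>s. (k has_real_derivative k' s) (at s)" and zero: "k 0 = 0" "k' 0 = 0"
  shows "((\<lambda>s. k (max 0 s)) has_real_derivative k' (max 0 s)) (at s)"
proof -
  consider "s > 0" | "s < 0" | "s = 0" by linarith
  then show ?thesis
  proof cases
    case 1
    have "((\<lambda>s. k (max 0 s)) has_real_derivative k' s) (at s)"
      by (rule has_field_derivative_transform_within_open[of k "k' s" s "{0<..}"]) (use 1 k in auto)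
    then show ?thesis using 1 by simp
  next
    case 2
    have "((\<lambda>s. k (max 0 s)) has_real_derivative 0) (at s)"
      by (rule has_field_derivative_transform_within_open[of "\<lambda>s. 0" 0 s "{..<0}"]) (use 2 zero in auto)
    then show ?thesis using 2 zero by simp
  next
    case 3
    have "((\<lambda>y. k y / y) \<longlongrightarrow> 0) (at 0)"
      using k[of 0] zero by (simp add: has_field_derivative_iff)
    then have "((\<lambda>y. k (max 0 y) / y) \<longlongrightarrow> 0) (at 0)"
    proof (rule Lim_null_comparison[rotated, OF tendsto_rabs_zero])
      show "\<forall>\<^sub>F y in at 0. norm (k (max 0 y) / y) \<le> \<bar>k y / y\<bar>"
      proof (intro always_eventually allI)
        fix y :: real
        have "k (max 0 y) = k y \<or> k (max 0 y) = 0" by (auto simp: max_def zero)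
        then show "norm (k (max 0 y) / y) \<le> \<bar>k y / y\<bar>"
          by (metis abs_ge_zero div_0 norm_zero order_refl real_norm_def)
      qed
    qed
    then show ?thesis using 3 zero by (simp add: has_field_derivative_iff)
  qed
qed

text \<open>
  A convex \<open>C\<^sup>2\<close> substitute for the positive part: it is positive exactly on the positive axis, its
  derivative is bounded, and it is dominated by the square of the positive part, so that attainment
  of the initial values in \<open>L\<^sup>2\<close> is enough.
\<close>

definition soft_plus :: "real \<Rightarrow> real" where
  "soft_plus s = max 0 s - arctan (max 0 s)"
definition soft_plus' :: "real \<Rightarrow> real" where
  "soft_plus' s = (max 0 s)\<^sup>2 / (1 + (max 0 s)\<^sup>2)"
definition soft_plus'' :: "real \<Rightarrow> real" where
  "soft_plus'' s = 2 * max 0 s / (1 + (max 0 s)\<^sup>2)\<^sup>2"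

lemma arctan_defect_derivative: "((\<lambda>s. s - arctan s) has_real_derivative s\<^sup>2 / (1 + s\<^sup>2)) (at s)"
proof -
  have "1 + s\<^sup>2 \<noteq> 0" using zero_le_power2[of s] by linarith
  then have "1 - inverse (1 + s\<^sup>2) = s\<^sup>2 / (1 + s\<^sup>2)" by (simp add: field_simps)
  then show ?thesis by (auto intro!: derivative_eq_intros)
qed

lemma soft_plus_derivative: "(soft_plus has_real_derivative soft_plus' s) (at s)"
  unfolding soft_plus_def[abs_def] soft_plus'_def
  by (rule positive_part_has_derivative[OF arctan_defect_derivative]) auto

lemma soft_plus'_derivative: "(soft_plus' has_real_derivative soft_plus'' s) (at s)"
  unfolding soft_plus'_def[abs_def] soft_plus''_def
proof (rule positive_part_has_derivative)
  fix s :: real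
  have "1 + s\<^sup>2 \<noteq> 0" using zero_le_power2[of s] by linarith
  then show "((\<lambda>s. s\<^sup>2 / (1 + s\<^sup>2)) has_real_derivative 2 * s / (1 + s\<^sup>2)\<^sup>2) (at s)"
    by (auto intro!: derivative_eq_intros simp: power2_eq_square field_simps)
qed auto

lemma soft_plus''_nonneg: "soft_plus'' s \<ge> 0"
  by (simp add: soft_plus''_def)

lemma continuous_soft_plus'': "continuous_on UNIV soft_plus''"
proof -
  have "1 + (max 0 s)\<^sup>2 \<noteq> (0::real)" for s using zero_le_power2[of "max 0 s"] by linarith
  then show ?thesis unfolding soft_plus''_def[abs_def] by (intro continuous_intros) auto
qed

lemma soft_plus'_zero: "s \<le> 0 \<Longrightarrow> soft_plus' s = 0"
  by (simp add: soft_plus'_def max_absorb1)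

lemma soft_plus'_bounds: "0 \<le> soft_plus' s" "soft_plus' s \<le> 1"
proof -
  have "1 + (max 0 s)\<^sup>2 > 0" using zero_le_power2[of "max 0 s"] by linarith
  then show "0 \<le> soft_plus' s" "soft_plus' s \<le> 1" by (simp_all add: soft_plus'_def divide_le_eq)
qed

lemma soft_plus_pos: "s > 0 \<Longrightarrow> soft_plus s > 0"
proof -
  assume s: "s > 0"
  have "(\<lambda>s. s - arctan s) 0 < (\<lambda>s. s - arctan s) s"
  proof (rule DERIV_pos_imp_increasing_open[OF s, of "\<lambda>s. s - arctan s"])
    fix r :: real assume r: "0 < r" "r < s"
    have "r\<^sup>2 / (1 + r\<^sup>2) > 0" using r by (intro divide_pos_pos add_pos_pos) auto
    then show "\<exists>y. ((\<lambda>s. s - arctan s) has_real_derivative y) (at r) \<and> 0 < y"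
      using arctan_defect_derivative by blast
  qed (intro continuous_intros)
  then show ?thesis using s by (simp add: soft_plus_def)
qed

lemma soft_plus_nonneg: "soft_plus s \<ge> 0"
  using soft_plus_pos[of s] by (cases "s > 0") (auto simp: soft_plus_def)

lemma soft_plus_le: "soft_plus s \<le> (max 0 s)\<^sup>2"
proof -
  let ?g = "\<lambda>s::real. s\<^sup>2 - (s - arctan s)"
  have "?g 0 \<le> ?g (max 0 s)"
  proof (rule DERIV_nonneg_imp_nondecreasing[of 0 "max 0 s" ?g])
    fix r :: real assume r: "0 \<le> r"
    have "r \<le> 1 + r\<^sup>2"
      using zero_le_power2[of "r - 1"] r by (simp add: power2_eq_square algebra_simps)
    from mult_left_mono[OF this r] have "r\<^sup>2 / (1 + r\<^sup>2) \<le> r"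
      using zero_le_power2[of r] by (subst pos_divide_le_eq) (auto simp: power2_eq_square add_pos_nonneg)
    then have "0 \<le> 2 * r - r\<^sup>2 / (1 + r\<^sup>2)" using r by simp
    moreover have "(?g has_real_derivative 2 * r - r\<^sup>2 / (1 + r\<^sup>2)) (at r)"
      by (rule DERIV_diff[OF _ arctan_defect_derivative]) (auto intro!: derivative_eq_intros)
    ultimately show "\<exists>y. (?g has_real_derivative y) (at r) \<and> 0 \<le> y" by blast
  qed simp
  then show ?thesis by (simp add: soft_plus_def)
qed

text \<open>
  The integral of \<open>soft_plus (f t)\<close> does not increase in time: after integration by parts, convexity
  of \<open>soft_plus\<close> makes the diffusion term nonpositive, and no boundary term arises because the
  derivative of \<open>soft_plus\<close> vanishes where \<open>f \<le> 0\<close>. Since the integral tends to 0 at time 0, it is zero.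
\<close>

theorem heat_comparison:
  fixes f f' :: "real \<Rightarrow> real^2 \<Rightarrow> real"
  assumes \<nu>: "\<nu> > 0" and C2: "\<And>t. t > 0 \<Longrightarrow> C2_disk (f t)"
    and cont: "\<And>t. t > 0 \<Longrightarrow> continuous_on closed_disk (f t)"
    and bdry: "\<And>t x. t > 0 \<Longrightarrow> norm x = 1 \<Longrightarrow> f t x \<le> 0"
    and deriv: "\<And>t x. t > 0 \<Longrightarrow> x \<in> disk \<Longrightarrow> ((\<lambda>\<tau>. f \<tau> x) has_real_derivative f' t x) (at t)"
    and bc: "\<And>t. t > 0 \<Longrightarrow> bounded_continuous (f' t)"
    and bound: "\<And>a b. 0 < a \<Longrightarrow> \<exists>K. \<forall>t\<in>{a..b}. \<forall>x\<in>disk. \<bar>f' t x\<bar> \<le> K"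
    and sub: "\<And>t x. t > 0 \<Longrightarrow> x \<in> disk \<Longrightarrow> f' t x \<le> \<nu> * laplacian (f t) x"
    and init: "((\<lambda>t. DINT x. (max 0 (f t x))\<^sup>2) \<longlongrightarrow> 0) (at_right 0)"
    and t: "t > 0" and x: "x \<in> disk"
  shows "f t x \<le> 0"
proof -
  define H where "H = (\<lambda>t. DINT x. soft_plus (f t x))"
  have cs: "continuous_on UNIV soft_plus" "continuous_on UNIV soft_plus'"
    using soft_plus_derivative soft_plus'_derivative
    by (meson DERIV_isCont continuous_at_imp_continuous_on)+
  have C1: "C1_disk (f t)" "C1_disk (PD i (f t))" if "t > 0" for t i
    using C2_disk_C1[OF C2[OF that]] C2_disk_partial[OF C2[OF that]] .
  have bcf: "bounded_continuous (f t)" if "t > 0" for t by (rule C1_disk_bounded_continuous[OF C1(1)[OF that]])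
  have bcs: "bounded_continuous (\<lambda>x. soft_plus (f t x))" "bounded_continuous (\<lambda>x. soft_plus' (f t x))"
    "bounded_continuous (\<lambda>x. soft_plus'' (f t x))" if "t > 0" for t
    using bounded_continuous_compose[OF bcf[OF that] cs(1)] bounded_continuous_compose[OF bcf[OF that] cs(2)]
      bounded_continuous_compose[OF bcf[OF that] continuous_soft_plus''] .
  have H': "(H has_real_derivative (DINT x. soft_plus' (f t x) * f' t x)) (at t)" if t: "t > 0" for t
  proof -
    obtain K where K: "\<forall>s\<in>{t/2..2*t}. \<forall>x\<in>disk. \<bar>f' s x\<bar> \<le> K" using bound[of "t/2" "2*t"] t by auto
    show ?thesis
      unfolding H_def
    proof (rule disk_integral_has_derivative[of "t/2" t "2*t" _ _ K])
      fix s x assume s: "t / 2 < s" "s < 2 * t"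
      then have s0: "s > 0" using t by simp
      show "bounded_continuous (\<lambda>x. soft_plus (f s x))" by (rule bcs(1)[OF s0])
      assume x: "x \<in> disk"
      show "((\<lambda>\<tau>. soft_plus (f \<tau> x)) has_real_derivative soft_plus' (f s x) * f' s x) (at s)"
        by (rule DERIV_chain2[OF soft_plus_derivative deriv[OF s0 x]])
      have "\<bar>soft_plus' (f s x)\<bar> * \<bar>f' s x\<bar> \<le> 1 * K"
        using K s x soft_plus'_bounds[of "f s x"] by (intro mult_mono) auto
      then show "\<bar>soft_plus' (f s x) * f' s x\<bar> \<le> K" by (simp add: abs_mult)
    qed (use t in \<open>auto intro!: bounded_continuous_mult bcs bc\<close>)
  qed
  have decay: "(DINT x. soft_plus' (f t x) * f' t x) \<le> 0" if t: "t > 0" for t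
  proof -
    let ?D = "\<lambda>i x. PD i (PD i (f t)) x"
    have bD: "bounded_continuous (?D i)" for i by (rule C1_disk_partial[OF C1(2)[OF t]])
    note bci = bounded_continuous_intros bounded_continuous_sum bcs[OF t] bD
    have van: "vanishes_on_circle (\<lambda>x. soft_plus' (f t x))"
      unfolding vanishes_on_circle_def
      using continuous_on_compose2[OF cs(2) cont[OF t]] bdry[OF t] by (auto simp: soft_plus'_zero)
    have C1s: "C1_disk (\<lambda>x. soft_plus' (f t x))"
      by (rule C1_disk_compose[OF C1(1)[OF t] soft_plus'_derivative continuous_soft_plus''])
    have "(DINT x. soft_plus' (f t x) * f' t x)
        \<le> (DINT x. \<nu> * (\<Sum>i\<in>UNIV. soft_plus' (f t x) * ?D i x))"
    proof (rule disk_integral_mono)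
      show "bounded_continuous (\<lambda>x. soft_plus' (f t x) * f' t x)"
        by (intro bounded_continuous_mult bcs bc t)
      show "bounded_continuous (\<lambda>x. \<nu> * (\<Sum>i\<in>UNIV. soft_plus' (f t x) * ?D i x))" by (intro bci)
      fix x assume x: "x \<in> disk"
      show "soft_plus' (f t x) * f' t x \<le> \<nu> * (\<Sum>i\<in>UNIV. soft_plus' (f t x) * ?D i x)"
        using mult_left_mono[OF sub[OF t x] soft_plus'_bounds(1)[of "f t x"]]
        by (simp add: laplacian_def sum_distrib_left mult_ac)
    qed
    also have "\<dots> = \<nu> * (\<Sum>i\<in>UNIV. DINT x. soft_plus' (f t x) * ?D i x)"
      by (subst disk_integral_cmult, subst disk_integral_sum, (intro bci)+) simp
    also have "\<dots> \<le> 0"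
    proof (intro mult_nonneg_nonpos sum_nonpos)
      fix i
      have "(DINT x. soft_plus' (f t x) * ?D i x)
          = - (DINT x. PD i (\<lambda>x. soft_plus' (f t x)) x * PD i (f t) x)"
        by (rule integration_by_parts[OF van C1s C1(2)[OF t]])
      moreover have "0 \<le> (DINT x. PD i (\<lambda>x. soft_plus' (f t x)) x * PD i (f t) x)"
      proof (rule disk_integral_nonneg)
        fix x assume "x \<in> disk"
        then have "f t differentiable (at x)" by (rule C1_disk_differentiable[OF C1(1)[OF t]])
        from partial_deriv_compose_real(1)[OF this soft_plus'_derivative]
        show "0 \<le> PD i (\<lambda>x. soft_plus' (f t x)) x * PD i (f t) x"
          by (simp add: soft_plus''_nonneg mult.assoc)
      qed
      ultimately show "(DINT x. soft_plus' (f t x) * ?D i x) \<le> 0" by simp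
    qed (use \<nu> in simp)
    finally show ?thesis .
  qed
  have "H t \<le> 0"
  proof (rule tendsto_lowerbound[OF init])
    have "\<forall>\<^sub>F s in at_right 0. s \<in> {0<..<t}" using t by (rule eventually_at_right_real)
    then show "\<forall>\<^sub>F s in at_right 0. H t \<le> (DINT x. (max 0 (f s x))\<^sup>2)"
    proof eventually_elim
      case (elim s)
      then have s: "0 < s" "s \<le> t" by auto
      have "H t \<le> H s"
      proof (rule DERIV_nonpos_imp_nonincreasing[OF s(2)])
        fix r assume "s \<le> r" "r \<le> t"
        then have "r > 0" using s by simp
        then show "\<exists>y. (H has_real_derivative y) (at r) \<and> y \<le> 0" using H' decay by blast
      qed
      also have "\<dots> \<le> (DINT x. (max 0 (f s x))\<^sup>2)"
        unfolding H_def
      proof (rule disk_integral_mono)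
        have "continuous_on UNIV (\<lambda>s::real. (max 0 s)\<^sup>2)" by (intro continuous_intros)
        from bounded_continuous_compose[OF bcf[OF s(1)] this]
        show "bounded_continuous (\<lambda>x. (max 0 (f s x))\<^sup>2)" .
      qed (auto intro: bcs s soft_plus_le)
      finally show ?case .
    qed
  qed auto
  then have "soft_plus (f t x) = 0"
    unfolding H_def by (intro disk_integral_zero_imp[OF bcs(1)[OF t] soft_plus_nonneg _ x])
  then show ?thesis using soft_plus_pos[of "f t x"] by (cases "f t x > 0") auto
qed

lemma real_polynomial_function_partial:
  fixes f :: "real^2 \<Rightarrow> real"
  assumes "real_polynomial_function f"
  shows "f differentiable (at x)" "real_polynomial_function (PD i f)"
proof -
  have "(\<forall>x. f differentiable (at x)) \<and> real_polynomial_function (PD i f)"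
    using assms
  proof induction
    case (linear f)
    have "PD i f = (\<lambda>x. f (axis i 1))"
      using partial_deriv_unique[OF bounded_linear_imp_has_derivative[OF linear]] by blast
    then show ?case using bounded_linear_imp_differentiable[OF linear] by (simp add: real_polynomial_function.intros)
  next
    case (const c)
    have "PD i (\<lambda>x. c) = (\<lambda>x. 0)" by auto
    then show ?case by (simp add: real_polynomial_function.intros)
  next
    case (add f g)
    then have "PD i (\<lambda>x. f x + g x) = (\<lambda>x. PD i f x + PD i g x)"
      by (auto simp: partial_deriv_add)
    then show ?case using add by (simp add: real_polynomial_function.intros)
  next
    case (mult f g)
    then have "PD i (\<lambda>x. f x * g x) = (\<lambda>x. f x * PD i g x + PD i f x * g x)"
      by (auto simp: partial_deriv_mult)
    then show ?case using mult
      by (auto intro!: real_polynomial_function.intros(3,4))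
  qed
  then show "f differentiable (at x)" "real_polynomial_function (PD i f)" by auto
qed

lemma real_polynomial_function_continuous:
  fixes f :: "real^2 \<Rightarrow> real"
  shows "real_polynomial_function f \<Longrightarrow> continuous_on S f"
  by (meson continuous_at_imp_continuous_on differentiable_imp_continuous_within real_polynomial_function_partial(1))

lemma real_polynomial_function_C2:
  fixes f :: "real^2 \<Rightarrow> real"
  assumes "real_polynomial_function f"
  shows "C2_disk f"
proof -
  have C1: "C1_disk g" if "real_polynomial_function g" for g
    by (intro C1_diskI_partials bounded_continuous_closed real_polynomial_function_continuous
        real_polynomial_function_partial that)
  show ?thesis
    unfolding C2_disk_def using C1 real_polynomial_function_partial(2) assms by blast
qed

text \<open>
  A supersolution of the heat equation in the disk, since its Laplacian is at most \<open>2 a + a\<^sup>2\<close> times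
  itself; on the circle it is at least \<open>M\<close>, and it decays inwards at rate \<open>a\<close>.
\<close>

definition barrier :: "real \<Rightarrow> real \<Rightarrow> real \<Rightarrow> real \<Rightarrow> real^2 \<Rightarrow> real" where
  "barrier \<nu> M a t x = M * exp (a / 2 * ((x $ 1)\<^sup>2 + (x $ 2)\<^sup>2 - 1) + \<nu> * (2 * a + a\<^sup>2) * t)"

lemma barrier_partial:
  "barrier \<nu> M a t differentiable (at x)"
  "PD i (barrier \<nu> M a t) x = a * x $ i * barrier \<nu> M a t x"
proof -
  let ?h = "\<lambda>s. M * exp (a / 2 * (s - 1) + \<nu> * (2 * a + a\<^sup>2) * t)" and ?q = "\<lambda>x::real^2. x $ 1 * x $ 1 + x $ 2 * x $ 2"
  have xd: "(\<lambda>x::real^2. x $ j) differentiable (at x)" for j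
    by (intro bounded_linear_imp_differentiable bounded_linear_vec_nth)
  have q: "?q differentiable (at x)" using xd by (intro differentiable_add differentiable_mult)
  have pq: "PD i ?q x = 2 * x $ i"
    using xd exhaust_2[of i] by (auto simp: partial_deriv_add partial_deriv_mult differentiable_mult)
  have h: "(?h has_real_derivative a / 2 * ?h (?q x)) (at (?q x))"
    by (auto intro!: derivative_eq_intros)
  have eq: "barrier \<nu> M a t = (\<lambda>x. ?h (?q x))"
    by (simp add: barrier_def[abs_def] power2_eq_square)
  show "barrier \<nu> M a t differentiable (at x)"
    unfolding eq by (rule partial_deriv_compose_real(2)[OF q h])
  show "PD i (barrier \<nu> M a t) x = a * x $ i * barrier \<nu> M a t x"
    unfolding eq partial_deriv_compose_real(1)[OF q h] pq by simp
qed

lemma barrier_C2: "C2_disk (barrier \<nu> M a t)"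
  and barrier_laplacian: "laplacian (barrier \<nu> M a t) x
    = (2 * a + a\<^sup>2 * ((x $ 1)\<^sup>2 + (x $ 2)\<^sup>2)) * barrier \<nu> M a t x"
proof -
  have eq: "PD i (barrier \<nu> M a t) = (\<lambda>x. (a * x $ i) * barrier \<nu> M a t x)" for i
    using barrier_partial(2) by (intro ext)
  have c: "continuous_on S (barrier \<nu> M a t)" for S
    by (meson continuous_at_imp_continuous_on differentiable_imp_continuous_within barrier_partial(1))
  have "C1_disk (barrier \<nu> M a t)"
  proof (rule C1_diskI_partials)
    show "bounded_continuous (PD i (barrier \<nu> M a t))" for i
      unfolding eq by (intro bounded_continuous_closed continuous_intros c)
  qed (rule barrier_partial(1))
  then show "C2_disk (barrier \<nu> M a t)"
    unfolding C2_disk_def eq by (intro conjI allI C1_disk_mult C1_disk_const C1_disk_coordinate)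
  have xd: "(\<lambda>x::real^2. x $ j) differentiable (at x)" for j
    by (intro bounded_linear_imp_differentiable bounded_linear_vec_nth)
  then have d: "(\<lambda>x::real^2. a * x $ i) differentiable (at x)" for i
    by (intro differentiable_mult) auto
  have p: "PD i (\<lambda>x::real^2. a * x $ i) x = a" for i
    using xd by (simp add: partial_deriv_mult)
  show "laplacian (barrier \<nu> M a t) x = (2 * a + a\<^sup>2 * ((x $ 1)\<^sup>2 + (x $ 2)\<^sup>2)) * barrier \<nu> M a t x"
    unfolding laplacian_def eq partial_deriv_mult[OF d barrier_partial(1)] barrier_partial(2) p sum_2
    by (simp add: power2_eq_square algebra_simps)
qed

section \<open>Convergence away from the circle\<close>

text \<open>
  The right-hand side is a supersolution: \<open>\<nu> C t\<close> compensates the Laplacian of \<open>P\<close>. It dominates the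
  initial values by the choice of \<open>\<eta>\<close>, and the zero boundary values since the barrier outweighs \<open>- P\<close>.
\<close>

lemma velocity_component_bound:
  assumes \<nu>: "\<nu> > 0" and sol: "navier_stokes_solution \<nu> u\<^sub>0 u p"
    and u0: "continuous_on closed_disk u\<^sub>0"
    and sym: "rotationally_symmetric u\<^sub>0"
    and \<sigma>: "\<bar>\<sigma>\<bar> = 1" and P: "real_polynomial_function P"
    and \<eta>: "\<And>x. x \<in> closed_disk \<Longrightarrow> \<bar>\<sigma> * u\<^sub>0 x $ j - P x\<bar> \<le> \<eta>"
    and C: "C \<ge> 0" "\<And>x. x \<in> disk \<Longrightarrow> laplacian P x \<le> C"
    and M: "M \<ge> 0" "\<And>x. norm x = 1 \<Longrightarrow> - P x \<le> M" and a: "a \<ge> 0"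
    and t: "t > 0" and x: "x \<in> disk"
  shows "\<sigma> * u t x $ j \<le> P x + \<eta> + \<nu> * C * t + barrier \<nu> M a t x"
proof -
  note reg = solution_regular[OF sol]
  define \<kappa> where "\<kappa> = \<nu> * (2 * a + a\<^sup>2)"
  have \<kappa>0: "\<kappa> \<ge> 0" using \<nu> a by (simp add: \<kappa>_def)
  have \<eta>0: "\<eta> \<ge> 0" using \<eta>[of 0] by simp
  have B0: "barrier \<nu> M a t x \<ge> 0" for t x using M(1) by (simp add: barrier_def)
  define f where "f = (\<lambda>t x. \<sigma> * u t x $ j - P x - (\<eta> + \<nu> * C * t) - barrier \<nu> M a t x)"
  define f' where "f' = (\<lambda>t x. \<sigma> * time_deriv u t x $ j - \<nu> * C - \<kappa> * barrier \<nu> M a t x)"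
  have C2u: "C2_disk (\<lambda>x. u t x $ j)" if "t > 0" for t by (rule regular_C2_disk[OF reg that])
  note C2P = real_polynomial_function_C2[OF P] and C2B = barrier_C2[of \<nu> M a]
  have "C2_disk (f t) \<and> (\<forall>x\<in>disk. laplacian (f t) x
      = \<sigma> * laplacian (\<lambda>x. u t x $ j) x - laplacian P x - laplacian (barrier \<nu> M a t) x)"
    if t: "t > 0" for t
  proof -
    note 1 = C2_disk_cmult[OF C2u[OF t], where c = \<sigma>]
    note 2 = C2_disk_diff[OF 1(1) C2P] and c = C2_disk_const[of "\<eta> + \<nu> * C * t"]
    note 3 = C2_disk_diff[OF 2(1) c]
    note 4 = C2_disk_diff[OF 3(1) C2B]
    have "PD i (\<lambda>x. c) = (\<lambda>x. 0)" for i :: 2 and c :: real by (rule ext) simp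
    then show ?thesis unfolding f_def laplacian_def by (simp add: 1 2 3 4 sum_2 distrib_left)
  qed
  then have C2f: "C2_disk (f t)" and lapf: "x \<in> disk \<Longrightarrow> laplacian (f t) x
      = \<sigma> * laplacian (\<lambda>x. u t x $ j) x - laplacian P x - laplacian (barrier \<nu> M a t) x"
    if "t > 0" for t x using that by blast+
  have contB: "continuous_on S (barrier \<nu> M a t)" for S t
    by (meson continuous_at_imp_continuous_on differentiable_imp_continuous_within barrier_partial(1))
  have contf: "continuous_on closed_disk (f t)" if t: "t > 0" for t
  proof -
    have "continuous_on closed_disk (\<lambda>x. \<sigma> * u t x $ j)"
      by (intro continuous_on_mult_left continuous_on_component solution_continuous[OF sol t])
    then show ?thesis
      unfolding f_def
      by (intro continuous_on_diff contB real_polynomial_function_continuous[OF P] continuous_on_const)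
  qed
  have "f t x \<le> 0"
  proof (rule heat_comparison[where f' = f', OF \<nu> C2f contf])
    fix t :: real and x :: "real^2" assume t: "t > 0" and x: "norm x = 1"
    have "(x $ 1)\<^sup>2 + (x $ 2)\<^sup>2 = 1" using norm_square_vec2[of x] x by simp
    then have "barrier \<nu> M a t x = M * exp (\<nu> * (2 * a + a\<^sup>2) * t)" by (simp add: barrier_def)
    also have "\<dots> \<ge> M * 1" using M(1) \<kappa>0 t by (intro mult_left_mono) (auto simp: \<kappa>_def)
    finally have "barrier \<nu> M a t x \<ge> M" by simp
    moreover have "u t x $ j = 0" using solution_vanishing[OF sol t] x by (simp add: vanishes_on_circle_def)
    moreover have "\<nu> * C * t \<ge> 0" using \<nu> C(1) t by simp
    ultimately show "f t x \<le> 0" using M(2)[OF x] \<eta>0 by (simp add: f_def)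
  next
    fix t :: real and x :: "real^2" assume t: "t > 0" and x: "x \<in> disk"
    have "((\<lambda>\<tau>. barrier \<nu> M a \<tau> x) has_real_derivative \<kappa> * barrier \<nu> M a t x) (at t)"
      unfolding barrier_def \<kappa>_def by (auto intro!: derivative_eq_intros)
    then show "((\<lambda>\<tau>. f \<tau> x) has_real_derivative f' t x) (at t)"
      unfolding f_def f'_def using regular_time_deriv[OF reg t x, of j]
      by (auto intro!: derivative_eq_intros)
    have "f' t x = \<nu> * (\<sigma> * laplacian (\<lambda>x. u t x $ j) x) - \<nu> * C - \<kappa> * barrier \<nu> M a t x"
    proof -
      have "time_deriv u t x $ j = \<nu> * laplacian (\<lambda>x. u t x $ j) x"
        using symmetric_solution_heat[OF \<nu> sol u0 sym t x]
        by (simp add: laplacian_def regular_partials(2)[OF reg t x])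
      then show ?thesis by (simp add: f'_def algebra_simps)
    qed
    also have "\<dots> \<le> \<nu> * (\<sigma> * laplacian (\<lambda>x. u t x $ j) x)
        - \<nu> * laplacian P x
        - \<nu> * laplacian (barrier \<nu> M a t) x"
    proof -
      have n: "(x $ 1)\<^sup>2 + (x $ 2)\<^sup>2 \<le> 1"
        using norm_square_vec2[of x] power_le_one[of "norm x" 2] x by simp
      have "laplacian (barrier \<nu> M a t) x
          = (2 * a + a\<^sup>2 * ((x $ 1)\<^sup>2 + (x $ 2)\<^sup>2)) * barrier \<nu> M a t x"
        by (rule barrier_laplacian)
      also have "\<dots> \<le> (2 * a + a\<^sup>2 * 1) * barrier \<nu> M a t x"
        using n B0 by (intro mult_right_mono add_left_mono mult_left_mono) auto
      finally have "\<nu> * laplacian (barrier \<nu> M a t) x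
          \<le> \<nu> * ((2 * a + a\<^sup>2 * 1) * barrier \<nu> M a t x)"
        using \<nu> by (intro mult_left_mono) auto
      moreover have "\<nu> * laplacian P x \<le> \<nu> * C"
        using C(2)[OF x] \<nu> by (intro mult_left_mono) auto
      ultimately show ?thesis by (simp add: \<kappa>_def mult.assoc)
    qed
    also have "\<dots> = \<nu> * laplacian (f t) x"
      by (simp add: lapf[OF t x] algebra_simps)
    finally show "f' t x \<le> \<nu> * laplacian (f t) x" .
  next
    fix t :: real assume t: "t > 0"
    show "bounded_continuous (f' t)"
      unfolding f'_def
      by (intro bounded_continuous_intros solution_time_deriv_bounded[OF sol t] bounded_continuous_closed contB)
  next
    fix b c :: real assume b: "0 < b"
    have "extends_continuously (time_deriv u)" using reg by (simp add: regular_for_positive_time_def)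
    from extends_continuously_bounded(2)[OF this b]
    obtain K where K: "\<forall>t\<in>{b..c}. \<forall>x\<in>disk. \<bar>time_deriv u t x $ j\<bar> \<le> K" by blast
    have "\<bar>f' t x\<bar> \<le> K + \<nu> * C + \<kappa> * (M * exp (\<kappa> * c))" if t: "t \<in> {b..c}" and x: "x \<in> disk" for t x
    proof -
      have n: "(x $ 1)\<^sup>2 + (x $ 2)\<^sup>2 \<le> 1"
        using norm_square_vec2[of x] power_le_one[of "norm x" 2] x by simp
      have "a / 2 * ((x $ 1)\<^sup>2 + (x $ 2)\<^sup>2 - 1) \<le> 0" using n a by (intro mult_nonneg_nonpos) auto
      moreover have "\<kappa> * t \<le> \<kappa> * c" using t \<kappa>0 by (intro mult_left_mono) auto
      ultimately have "barrier \<nu> M a t x \<le> M * exp (\<kappa> * c)"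
        unfolding barrier_def using M(1) by (intro mult_left_mono) (auto simp: \<kappa>_def)
      then have 1: "\<kappa> * barrier \<nu> M a t x \<le> \<kappa> * (M * exp (\<kappa> * c))" "0 \<le> \<kappa> * barrier \<nu> M a t x"
        using \<kappa>0 B0 by (auto intro: mult_left_mono)
      have 2: "\<bar>\<sigma> * time_deriv u t x $ j\<bar> \<le> K" using K t x \<sigma> by (simp add: abs_mult)
      have 3: "0 \<le> \<nu> * C" using \<nu> C(1) by simp
      show ?thesis unfolding f'_def using 1 2 3 by linarith
    qed
    then show "\<exists>K. \<forall>t\<in>{b..c}. \<forall>x\<in>disk. \<bar>f' t x\<bar> \<le> K" by blast
  next
    show "((\<lambda>t. DINT x. (max 0 (f t x))\<^sup>2) \<longlongrightarrow> 0) (at_right 0)"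
    proof (rule tendsto_sandwich[OF _ _ tendsto_const])
      show "((\<lambda>t. DINT x. (norm (u t x - u\<^sub>0 x))\<^sup>2) \<longlongrightarrow> 0) (at_right 0)"
        using sol by (simp add: navier_stokes_solution_def)
      show "\<forall>\<^sub>F t in at_right 0. 0 \<le> (DINT x. (max 0 (f t x))\<^sup>2)"
        by (intro always_eventually allI disk_integral_nonneg) simp
      have "(DINT x. (max 0 (f t x))\<^sup>2) \<le> (DINT x. (norm (u t x - u\<^sub>0 x))\<^sup>2)"
        if t: "t > 0" for t
      proof (rule disk_integral_mono)
        have "continuous_on closed_disk (\<lambda>x. (max 0 (f t x))\<^sup>2)"
          by (intro continuous_intros contf t)
        then show "bounded_continuous (\<lambda>x. (max 0 (f t x))\<^sup>2)" by (rule bounded_continuous_closed)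
        show "bounded_continuous (\<lambda>x. (norm (u t x - u\<^sub>0 x))\<^sup>2)"
          by (intro bounded_continuous_closed continuous_intros solution_continuous[OF sol t] u0)
        fix x :: "real^2" assume x: "x \<in> disk"
        have "\<sigma> * u\<^sub>0 x $ j - P x \<le> \<eta>" using \<eta>[of x] x by (simp add: abs_le_iff)
        moreover have "\<nu> * C * t \<ge> 0" using \<nu> C(1) t by simp
        ultimately have "f t x \<le> \<sigma> * u t x $ j - \<sigma> * u\<^sub>0 x $ j"
          unfolding f_def using B0[of t x] by linarith
        also have "\<dots> \<le> \<bar>\<sigma> * (u t x - u\<^sub>0 x) $ j\<bar>" by (simp add: algebra_simps)
        also have "\<dots> = \<bar>(u t x - u\<^sub>0 x) $ j\<bar>" using \<sigma> by (simp add: abs_mult)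
        also have "\<dots> \<le> norm (u t x - u\<^sub>0 x)" by (rule component_le_norm_cart)
        finally have "max 0 (f t x) \<le> norm (u t x - u\<^sub>0 x)" by simp
        then show "(max 0 (f t x))\<^sup>2 \<le> (norm (u t x - u\<^sub>0 x))\<^sup>2" by (intro power_mono) auto
      qed
      then show "\<forall>\<^sub>F t in at_right 0. (DINT x. (max 0 (f t x))\<^sup>2) \<le> (DINT x. (norm (u t x - u\<^sub>0 x))\<^sup>2)"
        by (auto simp: eventually_at_right_field intro: exI[of _ 1])
    qed
  qed (use t x in auto)
  then show ?thesis by (simp add: f_def)
qed

text \<open>
  With \<open>a = 1 / sqrt \<nu>\<close> the growth rate \<open>\<nu> (2 a + a\<^sup>2)\<close> of the barrier in time stays bounded as \<open>\<nu>\<close>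
  tends to 0, while its decay length \<open>sqrt \<nu>\<close> becomes small compared with \<open>\<delta>\<close>.
\<close>

lemma interior_component_convergence:
  fixes u :: "real \<Rightarrow> real \<Rightarrow> real^2 \<Rightarrow> real^2" and p :: "real \<Rightarrow> real \<Rightarrow> real^2 \<Rightarrow> real"
  assumes u0: "continuous_on closed_disk u\<^sub>0"
    and sym: "rotationally_symmetric u\<^sub>0"
    and sol: "\<And>\<nu>. \<nu> > 0 \<Longrightarrow> navier_stokes_solution \<nu> u\<^sub>0 (u \<nu>) (p \<nu>)"
    and T: "0 < T" and \<delta>: "\<And>\<nu>. \<nu> > 0 \<Longrightarrow> \<delta> \<nu> > 0"
    and lim: "filterlim (\<lambda>\<nu>. \<delta> \<nu> / sqrt \<nu>) at_top (at_right 0)"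
    and \<sigma>: "\<bar>\<sigma>\<bar> = 1" and \<epsilon>: "\<epsilon> > 0"
  shows "\<forall>\<^sub>F \<nu> in at_right 0. \<forall>t x. 0 < t \<longrightarrow> t \<le> T \<longrightarrow> norm x \<le> 1 - \<delta> \<nu> \<longrightarrow> \<sigma> * (u \<nu> t x - u\<^sub>0 x) $ j \<le> \<epsilon>"
proof -
  have "continuous_on closed_disk (\<lambda>x. \<sigma> * u\<^sub>0 x $ j)" using u0 by (intro continuous_intros)
  from Stone_Weierstrass_real_polynomial_function[OF compact_cball this, of "\<epsilon> / 4"] \<epsilon>
  obtain P where P: "real_polynomial_function P" and PE: "\<And>x. x \<in> closed_disk \<Longrightarrow> \<bar>\<sigma> * u\<^sub>0 x $ j - P x\<bar> < \<epsilon> / 4"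
    by auto
  have bcP: "bounded_continuous (laplacian P)" by (intro C2_disk_laplacian real_polynomial_function_C2 P)
  obtain C where C: "C > 0" "\<And>x. x \<in> disk \<Longrightarrow> \<bar>laplacian P x\<bar> \<le> C"
    using bounded_continuousE[OF bcP] by blast
  have "bounded (P ` closed_disk)"
    by (intro compact_imp_bounded compact_continuous_image real_polynomial_function_continuous P compact_cball)
  then obtain M where M: "M > 0" "\<And>x. x \<in> closed_disk \<Longrightarrow> \<bar>P x\<bar> \<le> M"
    unfolding bounded_pos by auto
  define g where "g = (\<lambda>\<nu>. \<nu> * C * T + M * (exp (- (1/2 * (\<delta> \<nu> / sqrt \<nu>))) * exp ((2 * sqrt \<nu> + 1) * T)))"
  have "(g \<longlongrightarrow> 0 * C * T + M * (0 * exp ((2 * sqrt 0 + 1) * T))) (at_right 0)"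
    unfolding g_def
  proof (intro tendsto_intros)
    show "((\<lambda>\<nu>. exp (- (1/2 * (\<delta> \<nu> / sqrt \<nu>)))) \<longlongrightarrow> 0) (at_right 0)"
      by (intro filterlim_compose[OF exp_at_bot] filterlim_compose[OF filterlim_uminus_at_bot_at_top]
          filterlim_tendsto_pos_mult_at_top[OF tendsto_const _ lim]) simp
  qed
  then have "(g \<longlongrightarrow> 0) (at_right 0)" by simp
  then have "\<forall>\<^sub>F \<nu> in at_right 0. g \<nu> < \<epsilon> / 4" using \<epsilon> by (intro order_tendstoD) auto
  moreover have "\<forall>\<^sub>F \<nu> in at_right (0::real). \<nu> > 0" by (simp add: eventually_at_right_less)
  ultimately show ?thesis
  proof eventually_elim
    case (elim \<nu>)
    then have \<nu>: "\<nu> > 0" and g: "g \<nu> < \<epsilon> / 4" by auto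
    show ?case
    proof (intro allI impI)
      fix t and x :: "real^2" assume t: "0 < t" "t \<le> T" and x: "norm x \<le> 1 - \<delta> \<nu>"
      note d = \<delta>[OF \<nu>]
      define a where "a = 1 / sqrt \<nu>"
      have sq: "sqrt \<nu> > 0" "sqrt \<nu> * sqrt \<nu> = \<nu>" using \<nu> by auto
      have a0: "a \<ge> 0" using sq by (simp add: a_def)
      have xd: "x \<in> disk" using x d by simp
      have bound: "\<sigma> * u \<nu> t x $ j \<le> P x + \<epsilon> / 4 + \<nu> * C * t + barrier \<nu> M a t x"
      proof (rule velocity_component_bound[OF \<nu> sol[OF \<nu>] u0 sym \<sigma> P _ _ _ _ _ a0 t(1) xd])
        show "\<bar>\<sigma> * u\<^sub>0 y $ j - P y\<bar> \<le> \<epsilon> / 4" if "y \<in> closed_disk" for y using PE[OF that] by simp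
        show "laplacian P y \<le> C" if "y \<in> disk" for y
          using C(2)[OF that] by (simp add: abs_le_iff)
        show "- P y \<le> M" if "norm y = 1" for y using M(2)[of y] that by (simp add: abs_le_iff)
      qed (use C M in auto)
      have "barrier \<nu> M a t x \<le> M * (exp (- (1/2 * (\<delta> \<nu> / sqrt \<nu>))) * exp ((2 * sqrt \<nu> + 1) * T))"
      proof -
        have "(x $ 1)\<^sup>2 + (x $ 2)\<^sup>2 - 1 \<le> - \<delta> \<nu>"
        proof -
          \<comment> \<open>\<open>1 - |x|\<^sup>2 \<ge> 1 - (1 - \<delta>)\<^sup>2 = 2 \<delta> - \<delta>\<^sup>2 \<ge> \<delta>\<close> because \<open>\<delta> \<le> 1\<close>.\<close>
          have d1: "\<delta> \<nu> \<le> 1" using x norm_ge_zero[of x] by linarith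
          have "(norm x)\<^sup>2 \<le> (1 - \<delta> \<nu>)\<^sup>2" using x by (intro power_mono) auto
          also have "\<dots> = 1 - \<delta> \<nu> - \<delta> \<nu> * (1 - \<delta> \<nu>)" by (simp add: power2_eq_square algebra_simps)
          also have "\<dots> \<le> 1 - \<delta> \<nu>" using d d1 by simp
          finally show ?thesis by (simp add: norm_square_vec2)
        qed
        then have "a / 2 * ((x $ 1)\<^sup>2 + (x $ 2)\<^sup>2 - 1) \<le> a / 2 * (- \<delta> \<nu>)"
          using a0 by (intro mult_left_mono) auto
        also have "\<dots> = - (1/2 * (\<delta> \<nu> / sqrt \<nu>))" by (simp add: a_def)
        finally have 1: "a / 2 * ((x $ 1)\<^sup>2 + (x $ 2)\<^sup>2 - 1) \<le> - (1/2 * (\<delta> \<nu> / sqrt \<nu>))" .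
        have "\<nu> * (2 * a + a\<^sup>2) = 2 * sqrt \<nu> + 1"
        proof -
          have "\<nu> * a = sqrt \<nu>" unfolding a_def using sq by (simp add: divide_eq_eq)
          moreover have "sqrt \<nu> * a = 1" using sq(1) by (simp add: a_def)
          ultimately show ?thesis by (simp add: power2_eq_square distrib_left mult.assoc[symmetric] mult.commute[of \<nu> 2])
        qed
        then have "\<nu> * (2 * a + a\<^sup>2) * t \<le> (2 * sqrt \<nu> + 1) * T"
          using t sq by (auto intro!: mult_left_mono)
        with 1 show ?thesis
          unfolding barrier_def exp_add[symmetric] using M(1) by (intro mult_left_mono) auto
      qed
      moreover have "\<nu> * C * t \<le> \<nu> * C * T" using \<nu> C(1) t by (intro mult_left_mono) auto
      ultimately have "\<sigma> * u \<nu> t x $ j \<le> P x + \<epsilon> / 4 + \<epsilon> / 4"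
        using bound g unfolding g_def by linarith
      moreover have "P x \<le> \<sigma> * u\<^sub>0 x $ j + \<epsilon> / 4"
      proof -
        have "\<bar>\<sigma> * u\<^sub>0 x $ j - P x\<bar> < \<epsilon> / 4" using xd by (intro PE) simp
        then show ?thesis by linarith
      qed
      ultimately show "\<sigma> * (u \<nu> t x - u\<^sub>0 x) $ j \<le> \<epsilon>"
        using \<epsilon> by (simp add: right_diff_distrib)
    qed
  qed
qed

theorem proposition10p3:
  fixes u\<^sub>0 :: "real^2 \<Rightarrow> real^2"
    and s\<^sub>0 :: "real \<Rightarrow> real"
    and u :: "real \<Rightarrow> real \<Rightarrow> real^2 \<Rightarrow> real^2"
    and p :: "real \<Rightarrow> real \<Rightarrow> real^2 \<Rightarrow> real"
    and \<delta> :: "real \<Rightarrow> real"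
    and T\<^sub>0 :: real
  assumes "continuous_on closed_disk u\<^sub>0"
    and "\<And>x. x \<in> closed_disk \<Longrightarrow> u\<^sub>0 x = s\<^sub>0 (norm x) *\<^sub>R perp x"
    and "\<And>\<nu>. \<nu> > 0 \<Longrightarrow> navier_stokes_solution \<nu> u\<^sub>0 (u \<nu>) (p \<nu>)"
    and "0 < T\<^sub>0"
    and "\<And>\<nu>. \<nu> > 0 \<Longrightarrow> \<delta> \<nu> > 0"
    and "filterlim (\<lambda>\<nu>. \<delta> \<nu> / sqrt \<nu>) at_top (at_right 0)"
  shows "((\<lambda>\<nu>. SUP t\<in>{0..T\<^sub>0}. SUP x\<in>{x. norm x \<le> 1 - \<delta> \<nu>}.
            ennreal (norm (u \<nu> t x - u\<^sub>0 x))) \<longlongrightarrow> 0) (at_right 0)"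
proof -
  have "u\<^sub>0 (rotation a b x) = rotation a b (u\<^sub>0 x)" if ab: "a\<^sup>2 + b\<^sup>2 = 1" and x: "x \<in> closed_disk" for a b x
  proof -
    have "rotation a b x \<in> closed_disk" using rotation_in_disk(2)[OF ab] x by blast
    then have "u\<^sub>0 (rotation a b x) = s\<^sub>0 (norm x) *\<^sub>R perp (rotation a b x)"
      by (simp add: assms(2) norm_rotation[OF ab])
    also have "\<dots> = rotation a b (u\<^sub>0 x)"
      unfolding assms(2)[OF x] by (simp add: vec2_eq_iff rotation_nth perp_simps algebra_simps)
    finally show ?thesis .
  qed
  then have sym: "rotationally_symmetric u\<^sub>0" unfolding rotationally_symmetric_def by blast
  have conv: "\<forall>\<^sub>F \<nu> in at_right 0. \<forall>t x. 0 < t \<longrightarrow> t \<le> T\<^sub>0 \<longrightarrow> norm x \<le> 1 - \<delta> \<nu> \<longrightarrow>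
      \<sigma> * (u \<nu> t x - u\<^sub>0 x) $ j \<le> \<epsilon>" if "\<bar>\<sigma>\<bar> = 1" "\<epsilon> > 0" for \<sigma> \<epsilon> j
    using assms(1) sym assms(3-6) that by (rule interior_component_convergence)
  have main: "\<forall>\<^sub>F \<nu> in at_right 0. (SUP t\<in>{0..T\<^sub>0}. SUP x\<in>{x. norm x \<le> 1 - \<delta> \<nu>}.
      ennreal (norm (u \<nu> t x - u\<^sub>0 x))) \<le> ennreal (2 * \<epsilon>)" if \<epsilon>: "\<epsilon> > 0" for \<epsilon>
  proof -
    have pos: "\<forall>\<^sub>F \<nu> in at_right (0::real). \<nu> > 0" by (simp add: eventually_at_right_less)
    have one: "\<bar>1::real\<bar> = 1" "\<bar>-1::real\<bar> = 1" by simp_all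
    show ?thesis
      using conv[OF one(1) \<epsilon>, of 1] conv[OF one(1) \<epsilon>, of 2] conv[OF one(2) \<epsilon>, of 1] conv[OF one(2) \<epsilon>, of 2] pos
    proof eventually_elim
      case (elim \<nu>)
      show ?case
      proof (intro SUP_least ennreal_leI)
        fix t and x :: "real^2" assume t: "t \<in> {0..T\<^sub>0}" and "x \<in> {x. norm x \<le> 1 - \<delta> \<nu>}"
        then have x: "norm x \<le> 1 - \<delta> \<nu>" by simp
        show "norm (u \<nu> t x - u\<^sub>0 x) \<le> 2 * \<epsilon>"
        \<comment> \<open>At time 0 the velocity is \<open>u\<^sub>0\<close> by definition; the bounds above are for positive times.\<close>
        proof (cases "t = 0")
          case True
          have "x \<in> closed_disk" using x assms(5)[OF elim(5)] by simp
          then have "u \<nu> 0 x = u\<^sub>0 x"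
            using assms(3)[OF elim(5)] by (simp add: navier_stokes_solution_def)
          then show ?thesis using True \<epsilon> by simp
        next
          case False
          then have t': "0 < t" "t \<le> T\<^sub>0" using t by auto
          let ?d = "u \<nu> t x - u\<^sub>0 x"
          have "\<bar>?d $ 1\<bar> \<le> \<epsilon>" "\<bar>?d $ 2\<bar> \<le> \<epsilon>"
            using elim(1-4)[rule_format, OF t' x] unfolding abs_le_iff by simp_all
          moreover have "norm ?d \<le> \<bar>?d $ 1\<bar> + \<bar>?d $ 2\<bar>"
            using norm_le_l1_cart[of ?d] by (simp add: sum_2)
          ultimately show ?thesis by linarith
        qed
      qed
    qed
  qed
  show ?thesis
  proof (rule order_tendstoI)
    fix c :: ennreal assume "0 < c"
    then obtain e where e: "0 < e" "e < c" using dense by blast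
    then obtain r where r: "e = ennreal r" "r > 0" by (cases e) auto
    show "\<forall>\<^sub>F \<nu> in at_right 0. (SUP t\<in>{0..T\<^sub>0}. SUP x\<in>{x. norm x \<le> 1 - \<delta> \<nu>}.
        ennreal (norm (u \<nu> t x - u\<^sub>0 x))) < c"
      using main[of "r / 2"] r e by (auto elim!: eventually_mono)
  qed auto
qed

end
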